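(* Let $N\ge 2$ be an integer and let $k=1$. Let $g$ be a bistable nonlinearity with parameters $0<\beta<\alpha$, and let $\xi^*\in(\beta,\alpha)$ be the unique number such that $$g^2(\beta)\int_\beta^{\xi^*}\frac{ds}{g(s)}=\int_\beta^\alpha g(s)\,ds .$$ Then for any $\xi\in\mathbb R$ there is a unique radial solution $(R,u)$ to $\mathcal P_1^+U+g(U)=0$ starting from $u(0)=\xi$. Moreover, depending on $\xi$, it has the following properties. (i) If $\xi\in\{-\alpha,0,\alpha\}$ then $u$ is constant (and $R=+\infty$). (ii) If $\xi<-\alpha$ then $u'<0$ on $(0,R)$ and $u(r)\to-\infty$ as $r\nearrow R$. (iii) If $\xi>\alpha$ then $u'>0$ on $(0,R)$ and $u(r)\to+\infty$ as $r\nearrow R$. (iv) If $-\alpha<\xi<0$ then $R=+\infty$, $u'>0$ on $(0,+\infty)$, and $u(r)\to 0$ as $r\to+\infty$. (v) If $0<\xi<\alpha$ then the following three outcomes are possible. (a) If $\xi^*<\xi<\alpha$ then $u'<0$ on $(0,R)$ and $u(r)\to-\infty$ as $r\nearrow R$. (b) If $\xi=\xi^*$ then $R=+\infty$, $u'<0$ on $(0,+\infty)$, and $u(r)\to-\alpha$ as $r\to+\infty$. (c) If $0<\xi<\xi^*$ then $R=+\infty$ and there is $b>0$ such that $u'<0$ on $(0,b)$, $u(b)<0$, $u'>0$ on $(b,+\infty)$, and $u(r)\to0$ as $r\to+\infty$.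
   Context: Bistable nonlinearity with parameters $0<\beta<\alpha$: an odd function $g:\mathbb R\to\mathbb R$ of class $C^1$ such that (1) $g>0$ on $(0,\alpha)$ and $g<0$ on $(\alpha,+\infty)$; (2) $g'>0$ on $[0,\beta)$ and $g'<0$ on $(\beta,+\infty)$; (3) $g$ is twice differentiable at $\pm\beta$ and $g''(\beta)<0$. Truncated Laplacian: for $1\le k<N$ and a function $U$ on (a subset of) $\mathbb R^N$ that is $C^2$ near $x$, let $\lambda_1(D^2U(x))\le\dots\le\lambda_N(D^2U(x))$ be the eigenvalues of the Hessian matrix; then $\mathcal P_k^+U(x):=\sum_{i=N-k+1}^N\lambda_i(D^2U(x))$. In particular $\mathcal P_1^+U=\lambda_N(D^2U)$. Radial solution to $\mathcal P_k^+U+g(U)=0$: a pair $(R,u)$ with $0<R\le+\infty$ and $u:[0,R)\to\mathbb R$ piecewise $C^2$ with $u'(0)=0$, such that $U(x):=u(|x|)$ solves $\mathcal P_k^+U+g(U)=0$ on the ball $B(0,R)\subset\mathbb R^N$; moreover, if $R<+\infty$, it is required that $|u(r)|+|u'(r)|\to+\infty$ as $r\nearrow R$ (maximality). Here piecewise $C^2$ means: $u$ is $C^1$ on $[0,R)$ and $C^2$ off a set of points of $(0,R)$ having finitely many elements in each $[0,\rho]$, $\rho<R$, at which $u''$ has finite one-sided limits; the equation is required at all $x$ with $|x|$ outside this exceptional set. *)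

theory Defs
  imports
    "HOL-Analysis.Analysis"
    "HOL-Computational_Algebra.Computational_Algebra"
begin

definition bistable :: "real \<Rightarrow> real \<Rightarrow> (real \<Rightarrow> real) \<Rightarrow> bool" where
  "bistable \<alpha> \<beta> g \<longleftrightarrow>
     0 < \<beta> \<and> \<beta> < \<alpha> \<and>
     (\<forall>s. g (- s) = - g s) \<and>
     (\<forall>s. g differentiable at s) \<and> continuous_on UNIV (deriv g) \<and>
     (\<forall>s. 0 < s \<and> s < \<alpha> \<longrightarrow> g s > 0) \<and> (\<forall>s. \<alpha> < s \<longrightarrow> g s < 0) \<and>
     (\<forall>s. 0 \<le> s \<and> s < \<beta> \<longrightarrow> deriv g s > 0) \<and> (\<forall>s. \<beta> < s \<longrightarrow> deriv g s < 0) \<and>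
     deriv g differentiable at \<beta> \<and> deriv g differentiable at (- \<beta>) \<and>
     deriv (deriv g) \<beta> < 0"

definition threshold :: "real \<Rightarrow> real \<Rightarrow> (real \<Rightarrow> real) \<Rightarrow> real \<Rightarrow> bool" where
  "threshold \<alpha> \<beta> g \<xi> \<longleftrightarrow>
     \<beta> < \<xi> \<and> \<xi> < \<alpha> \<and>
     (g \<beta>)\<^sup>2 * integral {\<beta>..\<xi>} (\<lambda>s. 1 / g s) = integral {\<beta>..\<alpha>} g"

definition partial_deriv :: "'n::finite \<Rightarrow> (real ^ 'n \<Rightarrow> real) \<Rightarrow> real ^ 'n \<Rightarrow> real" where
  "partial_deriv i U x = frechet_derivative U (at x) (axis i 1)"

definition hessian :: "(real ^ 'n::finite \<Rightarrow> real) \<Rightarrow> real ^ 'n \<Rightarrow> real ^ 'n ^ 'n" where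
  "hessian U x = (\<chi> i j. partial_deriv i (partial_deriv j U) x)"

definition charpoly :: "real ^ 'n ^ 'n::finite \<Rightarrow> real poly" where
  "charpoly A = det (mat [:0, 1:] - map_matrix (\<lambda>a. [:a:]) A)"

text \<open>The real eigenvalues in increasing order, repeated according to their multiplicity and
  numbered from 1. If \<^term>\<open>A\<close> is symmetric, there are \<^term>\<open>CARD('n)\<close> of them.\<close>

definition eigenvalue :: "real ^ 'n ^ 'n::finite \<Rightarrow> nat \<Rightarrow> real" where
  "eigenvalue A i = sorted_list_of_multiset (proots (charpoly A)) ! (i - 1)"

text \<open>Meaningful for \<^term>\<open>1 \<le> k \<and> k < CARD('n)\<close> and \<^term>\<open>U\<close> of class \<open>C\<^sup>2\<close> near
  \<^term>\<open>x\<close>.\<close>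

definition truncated_laplacian :: "nat \<Rightarrow> (real ^ 'n::finite \<Rightarrow> real) \<Rightarrow> real ^ 'n \<Rightarrow> real" where
  "truncated_laplacian k U x = (\<Sum>i = CARD('n) - k + 1..CARD('n). eigenvalue (hessian U x) i)"

text \<open>The interval \<open>[0, R)\<close>, and the filter of \<open>r\<close> increasing to \<open>R\<close>, for \<open>0 < R \<le> \<infinity>\<close>.\<close>

definition upto_R :: "ereal \<Rightarrow> real set" where
  "upto_R R = {r. 0 \<le> r \<and> ereal r < R}"

definition to_R :: "ereal \<Rightarrow> real filter" where
  "to_R R = (if R = \<infinity> then at_top else at_left (real_of_ereal R))"

text \<open>\<^term>\<open>E\<close> is the set off which \<^term>\<open>u\<close> is \<open>C\<^sup>2\<close>. Derivatives are taken within \<open>[0, R)\<close>, so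
  they are one-sided at \<open>0\<close>, ordinary elsewhere, and independent of the values of \<^term>\<open>u\<close>
  outside \<open>[0, R)\<close>.\<close>

definition piecewise_C2_off :: "ereal \<Rightarrow> (real \<Rightarrow> real) \<Rightarrow> real set \<Rightarrow> bool" where
  "piecewise_C2_off R u E \<longleftrightarrow>
     E \<subseteq> upto_R R - {0} \<and>
     (\<forall>\<rho>. ereal \<rho> < R \<longrightarrow> finite (E \<inter> {0..\<rho>})) \<and>
     (\<exists>u' u''.
        (\<forall>r\<in>upto_R R. (u has_real_derivative u' r) (at r within upto_R R)) \<and>
        continuous_on (upto_R R) u' \<and>
        (\<forall>r\<in>upto_R R - E. (u' has_real_derivative u'' r) (at r within upto_R R)) \<and>
        continuous_on (upto_R R - E) u'' \<and>
        (\<forall>e\<in>E. (\<exists>l. (u'' \<longlongrightarrow> l) (at_left e)) \<and> (\<exists>l. (u'' \<longlongrightarrow> l) (at_right e))))"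

text \<open>The type argument fixes the space \<open>\<real>\<^sup>N\<close>, with \<open>N = CARD('n)\<close>. Off the exceptional spheres,
  \<open>x \<mapsto> u (norm x)\<close> is automatically \<open>C\<^sup>2\<close>, at the origin because \<open>u' 0 = 0\<close>. The values of
  \<^term>\<open>u\<close> outside \<open>[0, R)\<close> are irrelevant.\<close>

definition radial_solution ::
  "'n::finite itself \<Rightarrow> nat \<Rightarrow> (real \<Rightarrow> real) \<Rightarrow> ereal \<Rightarrow> (real \<Rightarrow> real) \<Rightarrow> bool" where
  "radial_solution TYPE('n) k g R u \<longleftrightarrow>
     0 < R \<and>
     (\<exists>E. piecewise_C2_off R u E \<and>
        (\<forall>x :: real ^ 'n. ereal (norm x) < R \<and> norm x \<notin> E \<longrightarrow>
           truncated_laplacian k (\<lambda>y. u (norm y)) x + g (u (norm x)) = 0)) \<and>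
     (u has_real_derivative 0) (at 0 within upto_R R) \<and>
     (R \<noteq> \<infinity> \<longrightarrow> filterlim (\<lambda>r. \<bar>u r\<bar> + \<bar>deriv u r\<bar>) at_top (to_R R))"

end

theory Submission
  imports Defs
begin

text \<open>The Hessian of \<open>x \<mapsto> u (norm x)\<close> has the eigenvalues \<open>u''\<close> and \<open>u' / r\<close>, so the equation reads
  \<open>max u'' (u' / r) + g u = 0\<close>. Hence \<open>\<phi> = u' + r g(u) \<le> 0\<close>, and the nondecreasing function
  \<open>- u' - \<integral> g(u)\<close> grows only where \<open>\<phi> = 0\<close>. Skorokhod's formula expresses it as a running maximum
  that depends on \<open>u\<close> in a Lipschitz way, which gives uniqueness. A solution alternates between
  first-order phases \<open>u' = - r g(u)\<close>, admissible where \<open>g g' \<le> 0\<close>, and second-order phases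
  \<open>u'' = - g(u)\<close>, admissible while \<open>\<phi> \<le> 0\<close>. For \<open>\<beta> < \<xi> < \<alpha>\<close> the first phase reaches \<open>\<beta>\<close> at a
  radius \<open>a\<close> with \<open>a\<^sup>2 / 2 = \<integral> 1 / g\<close> over \<open>[\<beta>, \<xi>]\<close>, and the threshold condition compares the
  energy \<open>u'\<^sup>2 / 2 + G(u)\<close> there with the maximum of the primitive \<open>G\<close> of \<open>g\<close>.\<close>

section \<open>Ordinary differential equations with locally Lipschitz right-hand side\<close>

text \<open>Although \<open>g\<close> is odd, the equation is not invariant under u -> -u, because
  this exchanges the largest and the smallest eigenvalue. Hence starting values below -\<alpha> and
  above \<alpha> need different phases, and an excursion below zero does not mirror one above it.
  Which phase is admissible is read off from two formulas. A first-order phase has u'' = - g(u) +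
  r^2 g(u) g'(u), so g g' \<le> 0 restricts it to values in [-\<beta>, 0], in [\<beta>, \<alpha>] or
  at most -\<alpha>. A second-order phase has \<phi>' = r g'(u) u', so \<phi> \<le> 0 is preserved
  as long as g'(u) and u' have opposite signs. The obstacle to uniqueness is that at a radius with
  \<phi> = 0 the values of u and u' fit both phases. Uniqueness for each of the two differential
  equations therefore does not exclude a different switching, and the argument has to treat the
  equation as a whole. As \<open>g\<close> is only C^1 and has no growth bound, solutions may blow
  up; this is why the differential equations are solved up to a maximal radius with a blow-up
  alternative.\<close>

lemma eq_zero_if_deriv_le_past:
  fixes d :: "real \<Rightarrow> 'a::real_normed_vector"
  assumes C: "0 \<le> C"
    and deriv: "\<And>t. t \<in> {a..b} \<Longrightarrow> (d has_vector_derivative d' t) (at t within {a..b})"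
    and d0: "d a = 0"
    and bd: "\<And>t m. t \<in> {a..b} \<Longrightarrow> (\<And>s. s \<in> {a..t} \<Longrightarrow> norm (d s) \<le> m) \<Longrightarrow> norm (d' t) \<le> C * m"
    and t: "t \<in> {a..b}"
  shows "d t = 0"
proof -
  have cont: "continuous_on {a..b} d"
    using deriv by (rule continuous_on_vector_derivative)
  \<comment> \<open>The exponent C + 1 exceeds the constant in \<open>bd\<close>, so integrating the
    bound on \<open>d'\<close> returns the maximum of \<open>h\<close> with the factor C / (C + 1) <
    1, and a nonnegative number that is at most a proper fraction of itself is zero. In
    \<open>bd\<close> the derivative is bounded by the whole past of \<open>d\<close>; Skorokhod's
    formula will supply a bound of just this kind.\<close>
  define h where "h = (\<lambda>t. norm (d t) * exp (- (C + 1) * t))"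
  have "continuous_on {a..b} h"
    unfolding h_def by (intro continuous_intros cont)
  then obtain x where x: "x \<in> {a..b}" and max: "\<And>s. s \<in> {a..b} \<Longrightarrow> h s \<le> h x"
    using continuous_attains_sup[of "{a..b}" h] t by auto
  define m where "m = h x"
  have m0: "m \<ge> 0" unfolding m_def h_def by simp
  have le: "norm (d s) \<le> m * exp ((C + 1) * s)" if "s \<in> {a..b}" for s
  proof -
    have "norm (d s) = h s * exp ((C + 1) * s)"
      unfolding h_def by (simp add: exp_add[symmetric] algebra_simps)
    also have "\<dots> \<le> m * exp ((C + 1) * s)" using max[OF that] m_def by simp
    finally show ?thesis .
  qed
  have d'le: "norm (d' s) \<le> C * m * exp ((C + 1) * s)" if s: "s \<in> {a..b}" for s
  proof -
    have "norm (d' s) \<le> C * (m * exp ((C + 1) * s))"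
    proof (rule bd[OF s])
      fix r assume r: "r \<in> {a..s}"
      have "norm (d r) \<le> m * exp ((C + 1) * r)" using le r s by auto
      also have "\<dots> \<le> m * exp ((C + 1) * s)"
        using r m0 C by (intro mult_left_mono) (auto intro!: mult_left_mono)
      finally show "norm (d r) \<le> m * exp ((C + 1) * s)" .
    qed
    then show ?thesis by (simp add: mult.assoc)
  qed
  have "m = 0"
  proof (cases "x = a")
    case True
    then show ?thesis unfolding m_def h_def using d0 by simp
  next
    case False
    define p where "p = (\<lambda>s. C * m / (C + 1) * exp ((C + 1) * s))"
    have ax: "a < x" using False x by auto
    have "norm (d x - d a) \<le> p x - p a"
    proof (rule differentiable_bound_general[OF ax])
      show "continuous_on {a..x} d" using cont by (rule continuous_on_subset) (use x in auto)
      show "continuous_on {a..x} p" unfolding p_def by (intro continuous_intros)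
      fix s assume s: "a < s" "s < x"
      show "(d has_vector_derivative d' s) (at s)"
        using deriv[of s] s x at_within_Icc_at[of a s b] by auto
      show "(p has_vector_derivative C * m * exp ((C + 1) * s)) (at s)"
        unfolding p_def has_real_derivative_iff_has_vector_derivative[symmetric]
        using C by (auto intro!: derivative_eq_intros)
      show "norm (d' s) \<le> C * m * exp ((C + 1) * s)" using d'le s x by auto
    qed
    also have "\<dots> \<le> p x" unfolding p_def using m0 C by simp
    finally have "norm (d x) \<le> p x" using d0 by simp
    then have "m \<le> p x * exp (- (C + 1) * x)" unfolding m_def h_def by simp
    also have "\<dots> = C * m / (C + 1)" unfolding p_def by (simp add: exp_add[symmetric] algebra_simps)
    finally show "m = 0" using C m0 by (simp add: field_simps)
  qed
  then show ?thesis using le[OF t] by simp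
qed

lemma integral_from_has_vector_derivative:
  fixes h :: "real \<Rightarrow> 'a::banach"
  assumes "continuous_on {a..} h" "a \<le> t"
  shows "((\<lambda>u. integral {a..u} h) has_vector_derivative h t) (at t within {a..})"
proof -
  have "((\<lambda>u. integral {a..u} h) has_vector_derivative h t) (at t within {a..t + 1})"
    using assms by (intro integral_has_vector_derivative) (auto elim: continuous_on_subset)
  moreover have "at t within {a..t + 1} = at t within {a..}"
    by (rule at_within_nhd[of _ "{..<t + 1}"]) auto
  ultimately show ?thesis by simp
qed

text \<open>Banach's fixed point theorem for the Picard operator on bounded continuous functions.
  The unknown is rescaled by exp(- l t) with l = K + 1, which makes the operator a contraction with
  factor K / l on the whole half line at once. Boundedness of \<open>f\<close> limits the integral
  to linear growth, so the rescaled image is bounded.\<close>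

lemma bounded_lipschitz_ode_solution:
  fixes f :: "'a::banach \<Rightarrow> 'a"
  assumes K: "0 \<le> K" and lip: "\<And>x y. norm (f x - f y) \<le> K * norm (x - y)"
    and B: "\<And>x. norm (f x) \<le> B"
  obtains x where "x 0 = x0"
    "\<And>t. 0 \<le> t \<Longrightarrow> (x has_vector_derivative f (x t)) (at t within {0..})"
proof -
  have fcont: "continuous_on UNIV f"
  proof -
    have "K-lipschitz_on UNIV f" using K lip by (intro lipschitz_onI) (auto simp: dist_norm)
    then show ?thesis by (rule lipschitz_on_continuous_on)
  qed
  define l where "l = K + 1"
  have l: "l \<ge> 1" "l > 0" using K l_def by auto
  \<comment> \<open>The fixed point is y(t) = exp(- l t) x(t) for the solution x, so
    \<open>J y\<close> is the right-hand side along x.\<close>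
  define J where "J = (\<lambda>y s. f (exp (l * s) *\<^sub>R apply_bcontfun y s))"
  \<comment> \<open>\<open>max 0 t\<close> continues the image by the constant \<open>x0\<close> to
    negative times, because the function space consists of functions on the whole line.\<close>
  define \<Phi> where "\<Phi> = (\<lambda>y t. exp (- l * max 0 t) *\<^sub>R (x0 + integral {0..max 0 t} (J y)))"
  have Jcont: "continuous_on S (J y)" for S y
  proof -
    have "continuous_on S (f \<circ> (\<lambda>s. exp (l * s) *\<^sub>R apply_bcontfun y s))"
      by (intro continuous_on_compose continuous_intros continuous_on_subset[OF fcont]) auto
    then show ?thesis unfolding J_def comp_def .
  qed
  have Jint: "(J y) integrable_on {0..t}" for y t
    by (rule integrable_continuous_real[OF Jcont])
  have Ider: "((\<lambda>u. integral {0..u} (J y)) has_vector_derivative J y t) (at t within {0..})" if "0 \<le> t" for y t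
    by (rule integral_from_has_vector_derivative[OF Jcont that])
  have Icont: "continuous_on {0..} (\<lambda>u. integral {0..u} (J y))" for y
    by (rule continuous_on_vector_derivative[OF Ider]) auto
  have bc: "\<Phi> y \<in> bcontfun" for y
  proof (rule bcontfun_normI)
    show "continuous_on UNIV (\<Phi> y)"
      unfolding \<Phi>_def by (intro continuous_intros continuous_on_compose2[OF Icont]) auto
    fix t :: real
    have B0: "B \<ge> 0" using B[of 0] norm_ge_zero order_trans by blast
    let ?t = "max 0 t"
    have "norm (integral {0..?t} (J y)) \<le> B * (?t - 0)"
      by (rule integral_bound) (use Jcont B in \<open>auto simp: J_def\<close>)
    then have "norm (\<Phi> y t) \<le> exp (- l * ?t) * (norm x0 + B * ?t)"
      unfolding \<Phi>_def by (auto intro!: mult_left_mono order.trans[OF norm_triangle_ineq])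
    also have "\<dots> = exp (- l * ?t) * norm x0 + B * (?t * exp (- l * ?t))" by (simp add: algebra_simps)
    also have "\<dots> \<le> 1 * norm x0 + B * 1"
    proof (intro add_mono mult_right_mono mult_left_mono B0)
      have "?t \<le> l * ?t" using mult_right_mono[OF l(1), of ?t] by simp
      also have "\<dots> \<le> exp (l * ?t)" using exp_ge_add_one_self[of "l * ?t"] by linarith
      finally show "?t * exp (- l * ?t) \<le> 1" by (simp add: exp_minus field_simps)
      show "exp (- l * max 0 t) \<le> 1" using l by simp
    qed simp
    finally show "norm (\<Phi> y t) \<le> norm x0 + B" by simp
  qed
  define F where "F = (\<lambda>y. Bcontfun (\<Phi> y))"
  have Fapp: "apply_bcontfun (F y) = \<Phi> y" for y
    unfolding F_def using bc by (simp add: Bcontfun_inverse)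
  have contr: "dist (F y) (F z) \<le> (K / l) * dist y z" for y z
  proof (rule dist_bound)
    fix t :: real
    let ?t = "max 0 t"
    define D where "D = dist y z"
    have "norm (integral {0..?t} (J y) - integral {0..?t} (J z)) = norm (integral {0..?t} (\<lambda>s. J y s - J z s))"
      by (simp add: integral_diff Jint)
    also have "\<dots> \<le> integral {0..?t} (\<lambda>s. K * D * exp (l * s))"
    proof (rule integral_norm_bound_integral)
      show "(\<lambda>s. J y s - J z s) integrable_on {0..?t}" by (intro integrable_diff Jint)
      show "(\<lambda>s. K * D * exp (l * s)) integrable_on {0..?t}"
        by (intro integrable_continuous_real continuous_intros)
      fix s :: real
      have "norm (J y s - J z s) \<le> K * norm (exp (l * s) *\<^sub>R apply_bcontfun y s - exp (l * s) *\<^sub>R apply_bcontfun z s)"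
        unfolding J_def by (rule lip)
      also have "\<dots> = K * (exp (l * s) * dist (apply_bcontfun y s) (apply_bcontfun z s))"
        by (simp add: scaleR_diff_right[symmetric] dist_norm)
      also have "\<dots> \<le> K * (exp (l * s) * D)"
        unfolding D_def by (intro mult_left_mono dist_bounded K) auto
      finally show "norm (J y s - J z s) \<le> K * D * exp (l * s)" by (simp add: mult_ac)
    qed
    also have "\<dots> = K * D / l * exp (l * ?t) - K * D / l * exp (l * 0)"
    proof (rule integral_unique, rule fundamental_theorem_of_calculus)
      show "((\<lambda>s. K * D / l * exp (l * s)) has_vector_derivative K * D * exp (l * s)) (at s within {0..?t})" for s
        unfolding has_real_derivative_iff_has_vector_derivative[symmetric]
        using l by (auto intro!: derivative_eq_intros)
    qed auto
    also have "\<dots> \<le> K * D / l * exp (l * ?t)" using K l by (simp add: D_def)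
    finally have "exp (- l * ?t) * norm (integral {0..?t} (J y) - integral {0..?t} (J z)) \<le> exp (- l * ?t) * (K * D / l * exp (l * ?t))"
      by (intro mult_left_mono) auto
    also have "\<dots> = K / l * D" by (simp add: exp_minus field_simps)
    finally show "dist (apply_bcontfun (F y) t) (apply_bcontfun (F z) t) \<le> K / l * dist y z"
      unfolding Fapp \<Phi>_def dist_norm D_def by (simp add: scaleR_diff_right[symmetric])
  qed
  have "\<exists>!y. F y = y"
    by (rule banach_fix_type[of "K / l"]) (use K l l_def contr in \<open>auto simp: field_simps\<close>)
  then obtain y where y: "F y = y" by blast
  define x where "x = (\<lambda>t. exp (l * t) *\<^sub>R apply_bcontfun y t)"
  have Jx: "J y t = f (x t)" for t unfolding J_def x_def ..
  have xt: "x t = x0 + integral {0..t} (J y)" if "t \<ge> 0" for t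
  proof -
    have "apply_bcontfun y t = \<Phi> y t" using Fapp[of y] y by simp
    then show ?thesis unfolding x_def \<Phi>_def using that by (simp add: max_def exp_minus)
  qed
  show thesis
  proof
    show "x 0 = x0" using xt[of 0] by simp
    fix t :: real assume t: "0 \<le> t"
    have "((\<lambda>t. x0 + integral {0..t} (J y)) has_vector_derivative f (x t)) (at t within {0..})"
      using Ider[OF t, of y] unfolding Jx by (auto intro!: derivative_eq_intros)
    then show "(x has_vector_derivative f (x t)) (at t within {0..})"
      by (rule has_vector_derivative_transform[rotated 2]) (use t xt in auto)
  qed
qed

section \<open>Half-open intervals with a possibly infinite right end\<close>

definition ival :: "real \<Rightarrow> ereal \<Rightarrow> real set" where
  "ival a R = {r. a \<le> r \<and> ereal r < R}"

lemma upto_R_eq_ival: "upto_R R = ival 0 R"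
  by (simp add: upto_R_def ival_def)

lemma ival_iff: "r \<in> ival a R \<longleftrightarrow> a \<le> r \<and> ereal r < R"
  by (simp add: ival_def)

lemma ival_infinity [simp]: "ival a \<infinity> = {a..}"
  by (auto simp: ival_def)

lemma ival_subset: "r \<in> ival a R \<Longrightarrow> {a..r} \<subseteq> ival a R"
  unfolding ival_def using le_less_trans[of "ereal _" "ereal r" R] by fastforce

lemma ival_downward: "r \<in> ival a R \<Longrightarrow> a \<le> s \<Longrightarrow> s \<le> r \<Longrightarrow> s \<in> ival a R"
  using ival_subset by fastforce

lemma ival_exceeds:
  assumes "r \<in> ival a R"
  obtains s where "s > r" "s \<in> ival a R"
  using assms ereal_dense2[of "ereal r" R] by (auto simp: ival_def)

lemma at_within_ival_interior:
  assumes "a < r" "ereal r < R"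
  shows "at r within ival a R = at r"
proof -
  obtain s where s: "s > r" "s \<in> ival a R"
    using ival_exceeds[of r a R] assms by (auto simp: ival_def)
  have "{a<..<s} \<subseteq> ival a R" using ival_subset[OF s(2)] by auto
  then show ?thesis using s assms by (intro at_within_open_subset[of r "{a<..<s}"]) auto
qed

lemma at_within_ival_Icc:
  assumes "r \<in> ival a R" "r < s" "s \<in> ival a R"
  shows "at r within ival a R = at r within {a..s}"
  using assms ival_subset[OF assms(3)] by (intro at_within_nhd[of r "{..<s}"]) (auto simp: ival_def)

lemma eventually_to_R:
  assumes "ereal c < R"
  shows "eventually (\<lambda>r. c < r \<and> ereal r < R) (to_R R)"
proof (cases R)
  case (real x)
  then show ?thesis using assms eventually_at_left_real[of c x]
    by (auto simp: to_R_def elim: eventually_mono)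
qed (use assms in \<open>auto simp: to_R_def eventually_gt_at_top\<close>)

text \<open>Agreement of values and of derivatives at \<open>c\<close> joins the two one-sided
  derivatives. The right piece \<open>J\<close> is left abstract since it is compact when a solution
  is prolonged and half-open when profiles are glued.\<close>

lemma has_vector_derivative_If_le:
  fixes x y :: "real \<Rightarrow> 'a::real_normed_vector"
  assumes x: "\<And>s. s \<in> {a..c} \<Longrightarrow> (x has_vector_derivative x' s) (at s within {a..c})"
    and y: "\<And>s. s \<in> J \<Longrightarrow> (y has_vector_derivative y' s) (at s within J)"
    and J: "J \<subseteq> {c..}" "c \<in> J" and eq: "x c = y c" "x' c = y' c"
    and ac: "a \<le> c" and s: "s \<in> {a..c} \<union> J"
  shows "((\<lambda>s. if s \<le> c then x s else y s) has_vector_derivative (if s \<le> c then x' s else y' s))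
    (at s within {a..c} \<union> J)"
proof -
  have cl: "closure J \<subseteq> {c..}" using closure_mono[OF J(1)] by simp
  have "{a..c} \<inter> closure J = {c}" using cl J(2) closure_subset ac by fastforce
  then have int: "closure {a..c} \<inter> closure J = {c}" by simp
  have "((\<lambda>s. if s \<in> {a..c} then x s else y s) has_vector_derivative (if s \<in> {a..c} then x' s else y' s))
    (at s within {a..c} \<union> J)"
  proof (rule has_vector_derivative_If_within_closures[OF s refl])
    have eq1: "{a..c} \<union> {c} = {a..c}" "J \<union> {c} = J" using ac J by auto
    show "s \<in> {a..c} \<union> (closure {a..c} \<inter> closure J) \<Longrightarrow> (x has_vector_derivative x' s) (at s within {a..c} \<union> (closure {a..c} \<inter> closure J))"
      unfolding int eq1 by (rule x)
    show "s \<in> J \<union> (closure {a..c} \<inter> closure J) \<Longrightarrow> (y has_vector_derivative y' s) (at s within J \<union> (closure {a..c} \<inter> closure J))"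
      unfolding int eq1 by (rule y)
    show "s \<in> closure {a..c} \<Longrightarrow> s \<in> closure J \<Longrightarrow> x s = y s" "s \<in> closure {a..c} \<Longrightarrow> s \<in> closure J \<Longrightarrow> x' s = y' s"
      using int eq by auto
  qed
  moreover have "(s \<in> {a..c}) = (s \<le> c)" using s J(1) ac by auto
  ultimately have "((\<lambda>s. if s \<in> {a..c} then x s else y s) has_vector_derivative (if s \<le> c then x' s else y' s))
    (at s within {a..c} \<union> J)" by simp
  then show ?thesis
    by (rule has_vector_derivative_transform[OF s, rotated]) (use J(1) ac in auto)
qed

text \<open>Composition with the projection onto a ball turns \<open>f\<close> into a bounded,
  globally Lipschitz field. With speed at most \<open>B\<close>, the solution of the modified
  equation stays in the ball until time 1 / B and solves the original equation there. Essential for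
  later use is that \<tau> depends on \<open>C\<close> only and not on the starting point.\<close>

lemma local_lipschitz_ode_short_time:
  fixes f :: "'a::euclidean_space \<Rightarrow> 'a"
  assumes lip: "\<And>M. \<exists>K. \<forall>x y. norm x \<le> M \<longrightarrow> norm y \<le> M \<longrightarrow> norm (f x - f y) \<le> K * norm (x - y)"
  shows "\<exists>\<tau>>0. \<forall>x0. norm x0 \<le> C \<longrightarrow> (\<exists>x. x 0 = x0 \<and>
    (\<forall>t\<in>{0..\<tau>}. (x has_vector_derivative f (x t)) (at t within {0..\<tau>})))"
proof (cases "C \<ge> 0")
  case True
  define S where "S = cball (0::'a) (C + 1)"
  have S: "convex S" "closed S" "S \<noteq> {}" unfolding S_def using True by auto
  define P where "P = closest_point S"
  have PS: "P x \<in> S" for x unfolding P_def using S by (intro closest_point_in_set) auto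
  obtain K0 where "\<And>x y. norm x \<le> C + 1 \<Longrightarrow> norm y \<le> C + 1 \<Longrightarrow> norm (f x - f y) \<le> K0 * norm (x - y)"
    using lip[of "C + 1"] by blast
  then have K0: "\<And>x y. x \<in> S \<Longrightarrow> y \<in> S \<Longrightarrow> norm (f x - f y) \<le> K0 * norm (x - y)"
    unfolding S_def by simp
  define K where "K = max 0 K0"
  have K: "K \<ge> 0" "norm (f x - f y) \<le> K * norm (x - y)" if "x \<in> S" "y \<in> S" for x y
    unfolding K_def using order.trans[OF K0[OF that] mult_right_mono[of K0 "max 0 K0" "norm (x - y)"]] by simp_all
  have K_nonneg: "K \<ge> 0" unfolding K_def by simp
  \<comment> \<open>The first two terms bound \<open>f\<close> on the ball; the last one keeps
    \<open>B\<close> positive, so that 1 / B is a genuine time.\<close>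
  define B where "B = norm (f 0) + K * (C + 1) + 1"
  have B: "norm (f x) \<le> B" if "x \<in> S" for x
  proof -
    have "norm (f x) \<le> norm (f 0) + norm (f x - f 0)" by (metis add.commute diff_add_cancel norm_triangle_ineq)
    also have "\<dots> \<le> norm (f 0) + K * norm (x - 0)" by (intro add_left_mono K) (use that True in \<open>auto simp: S_def\<close>)
    also have "\<dots> \<le> norm (f 0) + K * (C + 1)" using that K_nonneg by (intro add_left_mono mult_left_mono) (auto simp: S_def)
    finally show ?thesis unfolding B_def by simp
  qed
  have Bpos: "B > 0" unfolding B_def using K_nonneg True by (simp add: add_nonneg_pos)
  have "\<exists>x. x 0 = x0 \<and> (\<forall>t\<in>{0..1 / B}. (x has_vector_derivative f (x t)) (at t within {0..1 / B}))"
    if x0: "norm x0 \<le> C" for x0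
  proof -
    have lipP: "norm ((f \<circ> P) x - (f \<circ> P) y) \<le> K * norm (x - y)" for x y
    proof -
      have "norm (f (P x) - f (P y)) \<le> K * norm (P x - P y)" by (intro K PS)
      also have "\<dots> \<le> K * norm (x - y)"
        using closest_point_lipschitz[OF S, of x y] K_nonneg unfolding P_def dist_norm by (intro mult_left_mono)
      finally show ?thesis by simp
    qed
    obtain x where x: "x 0 = x0" "\<And>t. 0 \<le> t \<Longrightarrow> (x has_vector_derivative (f \<circ> P) (x t)) (at t within {0..})"
      using bounded_lipschitz_ode_solution[of K "f \<circ> P" B x0] K_nonneg lipP B[OF PS] by (metis comp_apply)
    have "x t \<in> S" if t: "t \<in> {0..1 / B}" for t
    proof -
      have "norm (x t - x 0) \<le> B * t - B * 0"
      proof (cases "t = 0")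
        case False
        then have t0: "0 < t" using t by auto
        show ?thesis
        proof (rule differentiable_bound_general[OF t0])
          show "continuous_on {0..t} x"
            using has_vector_derivative_within_subset[OF x(2), of _ "{0..t}"] by (intro continuous_on_vector_derivative) auto
          show "(x has_vector_derivative (f \<circ> P) (x s)) (at s)" if "0 < s" "s < t" for s
            using x(2)[of s] that at_within_interior[of s "{0..}"] by auto
          show "((\<lambda>t. B * t) has_vector_derivative B) (at s)" for s
            by (auto intro!: derivative_eq_intros)
        qed (use B PS in \<open>auto intro!: continuous_intros\<close>)
      qed simp
      also have "\<dots> \<le> 1" using t Bpos by (auto simp: field_simps)
      finally have "norm (x t) \<le> norm x0 + 1"
        using x norm_triangle_ineq2[of "x t" x0] by simp
      then show ?thesis using x0 by (auto simp: S_def)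
    qed
    then have "P (x t) = x t" if "t \<in> {0..1 / B}" for t
      using that unfolding P_def by (simp add: closest_point_self)
    then have "(x has_vector_derivative f (x t)) (at t within {0..1 / B})" if "t \<in> {0..1 / B}" for t
      using has_vector_derivative_within_subset[OF x(2)[of t], of "{0..1 / B}"] that by auto
    then show ?thesis using x by blast
  qed
  then show ?thesis using Bpos by (meson zero_less_divide_1_iff)
next
  case False
  then have "\<not> norm x0 \<le> C" for x0 :: 'a using norm_ge_zero[of x0] by linarith
  then show ?thesis by (intro exI[of _ 1] conjI allI impI) simp_all
qed

lemma local_lipschitz_ode_unique:
  fixes f :: "'a::euclidean_space \<Rightarrow> 'a"
  assumes lip: "\<And>M. \<exists>K. \<forall>x y. norm x \<le> M \<longrightarrow> norm y \<le> M \<longrightarrow> norm (f x - f y) \<le> K * norm (x - y)"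
    and x: "\<And>t. t \<in> {a..b} \<Longrightarrow> (x has_vector_derivative f (x t)) (at t within {a..b})"
    and y: "\<And>t. t \<in> {a..b} \<Longrightarrow> (y has_vector_derivative f (y t)) (at t within {a..b})"
    and eq: "x a = y a" and t: "t \<in> {a..b}"
  shows "x t = y t"
proof -
  have "continuous_on {a..b} x" "continuous_on {a..b} y"
    by (rule continuous_on_vector_derivative[OF x], assumption)
      (rule continuous_on_vector_derivative[OF y], assumption)
  then have "bounded (x ` {a..b} \<union> y ` {a..b})"
    by (auto intro!: compact_imp_bounded compact_continuous_image)
  then obtain M where M: "\<And>s. s \<in> {a..b} \<Longrightarrow> norm (x s) \<le> M \<and> norm (y s) \<le> M"
    unfolding bounded_iff by blast
  obtain K0 where K0: "\<And>x y. norm x \<le> M \<Longrightarrow> norm y \<le> M \<Longrightarrow> norm (f x - f y) \<le> K0 * norm (x - y)"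
    using lip[of M] by blast
  have "x t - y t = 0"
  proof (rule eq_zero_if_deriv_le_past[where C = "max 0 K0" and d' = "\<lambda>s. f (x s) - f (y s)" and d = "\<lambda>s. x s - y s"])
    fix s m assume s: "s \<in> {a..b}" and m: "\<And>r. r \<in> {a..s} \<Longrightarrow> norm (x r - y r) \<le> m"
    have "norm (f (x s) - f (y s)) \<le> K0 * norm (x s - y s)" by (intro K0) (use M[OF s] in auto)
    also have "\<dots> \<le> max 0 K0 * m" using m[of s] s by (intro mult_mono) auto
    finally show "norm (f (x s) - f (y s)) \<le> max 0 K0 * m" .
  qed (use x y eq t in \<open>auto intro!: derivative_eq_intros\<close>)
  then show ?thesis by simp
qed

text \<open>The blow-up is a full limit: if the norm were below some \<open>C\<close> at times
  arbitrarily near a finite \<open>R\<close>, then restarting at such a time would give a solution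
  that lives for a time \<tau> depending on \<open>C\<close> only, and hence beyond
  \<open>R\<close>.\<close>

theorem maximal_ode_solution:
  fixes f :: "'a::euclidean_space \<Rightarrow> 'a"
  assumes lip: "\<And>M. \<exists>K. \<forall>x y. norm x \<le> M \<longrightarrow> norm y \<le> M \<longrightarrow> norm (f x - f y) \<le> K * norm (x - y)"
  obtains R x where "(0::ereal) < R" "x 0 = x0"
    "\<And>t. t \<in> ival 0 R \<Longrightarrow> (x has_vector_derivative f (x t)) (at t within ival 0 R)"
    "R \<noteq> \<infinity> \<Longrightarrow> filterlim (\<lambda>t. norm (x t)) at_top (to_R R)"
proof -
  define sol where "sol = (\<lambda>T x. x 0 = x0 \<and> (\<forall>t\<in>{0..T}. (x has_vector_derivative f (x t)) (at t within {0..T::real})))"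
  define A where "A = {T. 0 < T \<and> (\<exists>x. sol T x)}"
  define R where "R = (SUP T\<in>A. ereal T)"
  obtain xs where xs: "\<And>T. T \<in> A \<Longrightarrow> sol T (xs T)"
  proof -
    have "\<forall>T. \<exists>x. T \<in> A \<longrightarrow> sol T x" unfolding A_def by blast
    then show ?thesis using that by metis
  qed
  have agree: "x t = y t" if "sol S x" "sol T y" "0 \<le> t" "t \<le> S" "t \<le> T" for S T x y t
  proof (rule local_lipschitz_ode_unique[OF lip, of 0 t x y])
    show "(x has_vector_derivative f (x s)) (at s within {0..t})" if "s \<in> {0..t}" for s
      using \<open>sol S x\<close> \<open>t \<le> S\<close> that unfolding sol_def by (auto intro: has_vector_derivative_within_subset[of _ _ _ "{0..S}"])
    show "(y has_vector_derivative f (y s)) (at s within {0..t})" if "s \<in> {0..t}" for s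
      using \<open>sol T y\<close> \<open>t \<le> T\<close> that unfolding sol_def by (auto intro: has_vector_derivative_within_subset[of _ _ _ "{0..T}"])
    show "x 0 = y 0" using that(1,2) unfolding sol_def by simp
    show "t \<in> {0..t}" using that(3) by simp
  qed
  \<comment> \<open>The solutions on the compact intervals are patched together; by
    \<open>agree\<close>, the value does not depend on the interval that is picked.\<close>
  define X where "X = (\<lambda>t. xs (SOME T. T \<in> A \<and> t < T) t)"
  have ex: "\<exists>T. T \<in> A \<and> t < T" if "ereal t < R" for t
    using that unfolding R_def less_SUP_iff by auto
  have X: "X t = x t" if "sol T x" "0 \<le> t" "t \<le> T" "ereal t < R" for T x t
    using agree[OF xs that(1,2) _ that(3)] someI_ex[OF ex[OF that(4)]] unfolding X_def by auto
  have le_R: "ereal T \<le> R" if "T \<in> A" for T using that unfolding R_def by (rule SUP_upper)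
  obtain \<tau> where "\<tau> > 0" "\<exists>x. sol \<tau> x"
    using local_lipschitz_ode_short_time[OF lip, of "norm x0"] unfolding sol_def by auto
  then have "\<tau> \<in> A" unfolding A_def by auto
  then have Rpos: "0 < R" using le_R[of \<tau>] \<open>\<tau> > 0\<close> by (metis ereal_less(2) less_le_trans)
  have X0: "X 0 = x0" using X[of \<tau> _ 0] xs[OF \<open>\<tau> \<in> A\<close>] Rpos \<open>\<tau> > 0\<close> unfolding sol_def by (auto simp: zero_ereal_def)
  have Xder: "(X has_vector_derivative f (X t)) (at t within ival 0 R)" if t: "t \<in> ival 0 R" for t
  proof -
    have tR: "0 \<le> t" "ereal t < R" using t by (auto simp: ival_def)
    obtain s where s: "s > t" "s \<in> ival 0 R" using ival_exceeds[OF t] .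
    obtain T where T: "T \<in> A" "s < T" using ex[of s] s(2) unfolding ival_iff by blast
    have XT: "X r = xs T r" if "r \<in> {0..s}" for r
      by (rule X[OF xs[OF T(1)]]) (use that T(2) ival_downward[OF s(2), of r] in \<open>auto simp: ival_iff\<close>)
    have "t \<in> {0..T}" "{0..s} \<subseteq> {0..T}" using tR s(1) T(2) by auto
    then have "(xs T has_vector_derivative f (xs T t)) (at t within {0..s})"
      using xs[OF T(1)] unfolding sol_def by (meson has_vector_derivative_within_subset)
    moreover have t0s: "t \<in> {0..s}" using tR s(1) by simp
    ultimately have "(X has_vector_derivative f (xs T t)) (at t within {0..s})"
      using has_vector_derivative_transform[OF t0s] XT by blast
    with XT[OF t0s] show ?thesis using at_within_ival_Icc[OF t s] by simp
  qed
  have blow: "filterlim (\<lambda>t. norm (X t)) at_top (to_R R)" if fin: "R \<noteq> \<infinity>"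
  proof (rule ccontr)
    assume neg: "\<not> filterlim (\<lambda>t. norm (X t)) at_top (to_R R)"
    obtain \<rho> where \<rho>: "R = ereal \<rho>" "\<rho> > 0" using Rpos fin by (cases R) auto
    obtain C where C: "\<not> eventually (\<lambda>t. C \<le> norm (X t)) (to_R R)"
      using neg unfolding filterlim_at_top by blast
    obtain \<tau> where \<tau>: "\<tau> > 0" "\<And>x0. norm x0 \<le> C \<Longrightarrow> (\<exists>x. x 0 = x0 \<and>
      (\<forall>t\<in>{0..\<tau>}. (x has_vector_derivative f (x t)) (at t within {0..\<tau>})))"
      using local_lipschitz_ode_short_time[OF lip, of C] by blast
    \<comment> \<open>A restart within \<tau> / 2 of the end suffices for the prolonged solution to
      pass it.\<close>
    have "ereal (max 0 (\<rho> - \<tau> / 2)) < R" using \<rho> \<tau> by auto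
    note ev = eventually_to_R[OF this]
    have "\<exists>t. (max 0 (\<rho> - \<tau> / 2) < t \<and> ereal t < R) \<and> \<not> C \<le> norm (X t)"
      using C eventually_mono[OF ev, of "\<lambda>t. C \<le> norm (X t)"] by blast
    then obtain t where t: "0 < t" "\<rho> - \<tau> / 2 < t" "ereal t < R" "norm (X t) \<le> C" by auto
    obtain z where z: "z 0 = X t" "\<And>s. s \<in> {0..\<tau>} \<Longrightarrow> (z has_vector_derivative f (z s)) (at s within {0..\<tau>})"
      using \<tau>(2)[OF t(4)] by blast
    define y where "y = (\<lambda>s. if s \<le> t then X s else z (s - t))"
    have z': "((\<lambda>s. z (s - t)) has_vector_derivative f (z (s - t))) (at s within {t..t + \<tau>})" if "s \<in> {t..t + \<tau>}" for s
    proof -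
      have im: "(\<lambda>s. s - t) ` {t..t + \<tau>} = {0..\<tau>}"
        by (auto simp: image_minus_const_atLeastAtMost')
      have "((\<lambda>s. s - t) has_vector_derivative 1) (at s within {t..t + \<tau>})"
        by (auto intro!: derivative_eq_intros)
      moreover have "(z has_vector_derivative f (z (s - t))) (at (s - t) within (\<lambda>s. s - t) ` {t..t + \<tau>})"
        unfolding im using z(2)[of "s - t"] that by auto
      ultimately show ?thesis using vector_diff_chain_within[of "\<lambda>s. s - t" 1 s "{t..t + \<tau>}" z] by (simp add: comp_def)
    qed
    have "{0..t} \<union> {t..t + \<tau>} = {0..t + \<tau>}" using t \<tau> by auto
    have "sol (t + \<tau>) y"
      unfolding sol_def
    proof (intro conjI ballI)
      show "y 0 = x0" unfolding y_def using t X0 by simp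
      fix s assume s: "s \<in> {0..t + \<tau>}"
      have "(y has_vector_derivative (if s \<le> t then f (X s) else f (z (s - t)))) (at s within {0..t} \<union> {t..t + \<tau>})"
        unfolding y_def
      proof (rule has_vector_derivative_If_le)
        show "(X has_vector_derivative f (X s)) (at s within {0..t})" if "s \<in> {0..t}" for s
          by (rule has_vector_derivative_within_subset[OF Xder])
            (use ival_subset[of t 0 R] t that in \<open>auto simp: ival_def\<close>)
      qed (use z' z(1) s t \<tau> in auto)
      then show "(y has_vector_derivative f (y s)) (at s within {0..t + \<tau>})"
        unfolding \<open>{0..t} \<union> {t..t + \<tau>} = {0..t + \<tau>}\<close> y_def by (auto split: if_splits)
    qed
    then have "t + \<tau> \<in> A" unfolding A_def using t \<tau> by auto
    from le_R[OF this] show False using \<rho> t \<tau> by simp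
  qed
  show thesis using that[OF Rpos X0 Xder blow] by blast
qed

lemma filtermap_minus_at_left: "filtermap (\<lambda>t. t - d) (at_left a) = at_left (a - d)" for a d :: real
  by (simp add: filter_eq_iff eventually_filtermap eventually_at_filter filtermap_nhds_shift[symmetric])

text \<open>Time is adjoined as a component with derivative 1, which is why the Lipschitz condition
  covers time as well.\<close>

theorem maximal_ode_solution_nonautonomous:
  fixes f :: "real \<Rightarrow> 'a::euclidean_space \<Rightarrow> 'a"
  assumes lip: "\<And>M. \<exists>K. \<forall>s t x y. \<bar>s\<bar> \<le> M \<longrightarrow> \<bar>t\<bar> \<le> M \<longrightarrow> norm x \<le> M \<longrightarrow> norm y \<le> M \<longrightarrow>
    norm (f s x - f t y) \<le> K * \<bar>s - t\<bar> + K * norm (x - y)"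
  obtains R x where "ereal a < R" "x a = x0"
    "\<And>t. t \<in> ival a R \<Longrightarrow> (x has_vector_derivative f t (x t)) (at t within ival a R)"
    "R \<noteq> \<infinity> \<Longrightarrow> filterlim (\<lambda>t. norm (x t)) at_top (to_R R)"
proof -
  define F where "F = (\<lambda>p. (1::real, f (fst p) (snd p)))"
  have lipF: "\<exists>K. \<forall>p q. norm p \<le> M \<longrightarrow> norm q \<le> M \<longrightarrow> norm (F p - F q) \<le> K * norm (p - q)" for M
  proof -
    obtain K0 where K0: "\<And>s t x y. \<bar>s\<bar> \<le> M \<Longrightarrow> \<bar>t\<bar> \<le> M \<Longrightarrow> norm x \<le> M \<Longrightarrow> norm y \<le> M \<Longrightarrow>
      norm (f s x - f t y) \<le> K0 * \<bar>s - t\<bar> + K0 * norm (x - y)"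
      using lip[of M] by blast
    have "norm (F p - F q) \<le> (2 * \<bar>K0\<bar>) * norm (p - q)" if "norm p \<le> M" "norm q \<le> M" for p q
    proof -
      have n: "norm (fst p) \<le> M" "norm (snd p) \<le> M" "norm (fst q) \<le> M" "norm (snd q) \<le> M"
        using that norm_fst_le[of "fst p" "snd p"] norm_snd_le[of "snd p" "fst p"]
          norm_fst_le[of "fst q" "snd q"] norm_snd_le[of "snd q" "fst q"] by auto
        have pq: "p - q = (fst p - fst q, snd p - snd q)" by (simp add: prod_eq_iff)
      have d: "\<bar>fst p - fst q\<bar> \<le> norm (p - q)" "norm (snd p - snd q) \<le> norm (p - q)"
        unfolding pq real_norm_def[symmetric] by (rule norm_fst_le, rule norm_snd_le)
      have "F p - F q = (0, f (fst p) (snd p) - f (fst q) (snd q))"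
        unfolding F_def by simp
      then have "norm (F p - F q) = norm (f (fst p) (snd p) - f (fst q) (snd q))"
        by (simp add: norm_Pair)
      also have "\<dots> \<le> K0 * \<bar>fst p - fst q\<bar> + K0 * norm (snd p - snd q)"
        by (intro K0) (use n in simp_all)
      also have "\<dots> \<le> \<bar>K0\<bar> * norm (p - q) + \<bar>K0\<bar> * norm (p - q)"
        by (intro add_mono mult_mono d) simp_all
      finally show ?thesis by simp
    qed
    then show ?thesis by blast
  qed
  obtain S p where S: "(0::ereal) < S" and p0: "p 0 = (a, x0)"
    and p: "\<And>t. t \<in> ival 0 S \<Longrightarrow> (p has_vector_derivative F (p t)) (at t within ival 0 S)"
    and blow: "S \<noteq> \<infinity> \<Longrightarrow> filterlim (\<lambda>t. norm (p t)) at_top (to_R S)"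
    using maximal_ode_solution[of F "(a, x0)"] lipF by blast
  have p1: "((\<lambda>t. fst (p t)) has_vector_derivative 1) (at t within ival 0 S)"
    and p2: "((\<lambda>t. snd (p t)) has_vector_derivative f (fst (p t)) (snd (p t))) (at t within ival 0 S)"
    if "t \<in> ival 0 S" for t
    using bounded_linear.has_vector_derivative[OF bounded_linear_fst p[OF that]]
      bounded_linear.has_vector_derivative[OF bounded_linear_snd p[OF that]] by (auto simp: F_def)
  have conv: "convex (ival 0 S)"
    by (rule is_interval_convex) (unfold is_interval_1, meson atLeastAtMost_iff ival_downward ival_iff order_trans)
  have fst_p: "fst (p t) = a + t" if t: "t \<in> ival 0 S" for t
  proof -
    obtain c where c: "\<And>t. t \<in> ival 0 S \<Longrightarrow> fst (p t) - t = c"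
    proof (rule has_vector_derivative_zero_constant[OF conv])
      show "((\<lambda>t. fst (p t) - t) has_vector_derivative 0) (at t within ival 0 S)" if "t \<in> ival 0 S" for t
        using p1[OF that] by (auto intro!: derivative_eq_intros)
    qed blast
    have "0 \<in> ival 0 S" using S by (auto simp: ival_def zero_ereal_def)
    from c[OF this] c[OF t] p0 show ?thesis by simp
  qed
  define R where "R = ereal a + S"
  define x where "x = (\<lambda>t. snd (p (t - a)))"
  have im: "(\<lambda>t. t - a) ` ival a R = ival 0 S"
  proof -
    have "ereal (t - a) < S \<longleftrightarrow> ereal t < ereal a + S" for t
      by (cases S) auto
    then have "t \<in> ival a R \<longleftrightarrow> t - a \<in> ival 0 S" for t unfolding R_def ival_def by auto
    note iff = this
    show ?thesis
    proof (intro subset_antisym subsetI)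
      fix r assume "r \<in> ival 0 S"
      then have "r + a \<in> ival a R" using iff[of "r + a"] by simp
      then show "r \<in> (\<lambda>t. t - a) ` ival a R" by (rule rev_image_eqI) simp
    qed (use iff in blast)
  qed
  show thesis
  proof (rule that[of R x])
    show "ereal a < R" unfolding R_def using S by (cases S) auto
    show "x a = x0" unfolding x_def using p0 by simp
    show "(x has_vector_derivative f t (x t)) (at t within ival a R)" if t: "t \<in> ival a R" for t
    proof -
      have "t - a \<in> ival 0 S" using t im by blast
      then have "((\<lambda>t. snd (p t)) has_vector_derivative f t (x t)) (at (t - a) within (\<lambda>t. t - a) ` ival a R)"
        unfolding im using p2[of "t - a"] fst_p[of "t - a"] by (simp add: x_def)
      moreover have "((\<lambda>t. t - a) has_vector_derivative 1) (at t within ival a R)"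
        by (auto intro!: derivative_eq_intros)
      ultimately show ?thesis
        using vector_diff_chain_within[of "\<lambda>t. t - a" 1 t "ival a R" "\<lambda>t. snd (p t)"] by (simp add: comp_def x_def)
    qed
    assume "R \<noteq> \<infinity>"
    then have Sf: "S \<noteq> \<infinity>" unfolding R_def by auto
    then obtain s where s: "S = ereal s" "s > 0" using S by (cases S) auto
    have fl: "filterlim (\<lambda>t. norm (p t)) at_top (at_left s)" using blow[OF Sf] s by (simp add: to_R_def)
    \<comment> \<open>The time component stays below |a| + s, so the blow-up is carried by the
      state.\<close>
    have "filterlim (\<lambda>t. norm (snd (p t))) at_top (at_left s)"
    proof (rule filterlim_at_top_mono[OF filterlim_tendsto_add_at_top[OF tendsto_const[of "- (\<bar>a\<bar> + s)"] fl]])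
      have "eventually (\<lambda>t. 0 < t \<and> ereal t < S) (to_R S)"
        using eventually_to_R[of 0 S] S by (simp add: zero_ereal_def)
      then have "eventually (\<lambda>t. 0 < t \<and> t < s) (at_left s)" using s by (simp add: to_R_def)
      then show "eventually (\<lambda>t. - (\<bar>a\<bar> + s) + norm (p t) \<le> norm (snd (p t))) (at_left s)"
      proof (rule eventually_mono)
        fix t assume t: "0 < t \<and> t < s"
        have "norm (p t) \<le> norm (fst (p t)) + norm (snd (p t))"
          using norm_Pair_le[of "fst (p t)" "snd (p t)"] by simp
        moreover have "norm (fst (p t)) \<le> \<bar>a\<bar> + s" using fst_p[of t] t s by (auto simp: ival_def)
        ultimately show "- (\<bar>a\<bar> + s) + norm (p t) \<le> norm (snd (p t))" by linarith
      qed
    qed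
    then have "filterlim (\<lambda>t. norm (snd (p t))) at_top (filtermap (\<lambda>t. t - a) (at_left (s + a)))"
      using filtermap_minus_at_left[of a "s + a"] by simp
    then have "filterlim (\<lambda>t. norm (snd (p (t - a)))) at_top (at_left (s + a))"
      unfolding filterlim_filtermap .
    then show "filterlim (\<lambda>t. norm (x t)) at_top (to_R R)"
      unfolding x_def R_def to_R_def using s by (simp add: add.commute)
  qed
qed

section \<open>The truncated Laplacian of a radial function\<close>

lemma poly_charpoly:
  fixes A :: "real ^ 'n ^ 'n::finite"
  shows "poly (charpoly A) t = det (mat t - A)"
proof -
  have "poly ((mat [:0, 1:] - map_matrix (\<lambda>a. [:a:]) A) $ i $ j) t = (mat t - A) $ i $ j" for i j
    by (simp add: mat_def)
  then show ?thesis
    unfolding charpoly_def det_def by (simp add: poly_sum poly_prod del: vector_minus_component)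
qed

text \<open>The Hessian of a radial function has this form, a multiple of the identity plus a
  multiple of the projection onto the line of \<open>x\<close>. An orthogonal matrix with x / |x| as
  one of its columns diagonalises it, with c + d |x|^2 in that direction and \<open>c\<close> in all
  others.\<close>

lemma charpoly_scalar_plus_rank_one:
  fixes x :: "real ^ 'n::finite"
  assumes "x \<noteq> 0"
  shows "charpoly (\<chi> i j. (if i = j then c else 0) + d * (x $ i * x $ j))
    = [:- (c + d * (norm x)\<^sup>2), 1:] * [:- c, 1:] ^ (CARD('n) - 1)" (is "charpoly ?A = ?P")
proof -
  define r where "r = norm x"
  have r: "r > 0" unfolding r_def using assms by simp
  have "norm (x /\<^sub>R r) = 1" unfolding r_def using assms by simp
  from orthogonal_matrix_exists_basis[OF this, of undefined]
  obtain Q k where Q: "orthogonal_matrix Q" "Q *v axis k 1 = x /\<^sub>R r" by blast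
  have Qk: "Q $ i $ k = x $ i / r" for i
    using arg_cong[OF Q(2), of "\<lambda>v. v $ i"]
    by (simp add: matrix_vector_mult_def axis_def if_distrib[of "\<lambda>a. _ * a"] sum.delta cong: if_cong)
      (simp add: field_simps)
  have orth: "(\<Sum>l\<in>UNIV. Q $ l $ i * Q $ l $ j) = (if i = j then 1 else 0)" for i j
  proof -
    have "transpose Q ** Q = mat 1" using Q(1) by (simp add: orthogonal_matrix)
    from arg_cong[OF this, of "\<lambda>M. M $ i $ j"] show ?thesis
      by (simp add: matrix_matrix_mult_def transpose_def mat_def)
  qed
  have detQ: "det Q \<noteq> 0" using det_orthogonal_matrix[OF Q(1)] by auto
  have "poly (charpoly ?A) t = poly ?P t" for t
  proof -
    define D where "D = (\<chi> i j. if i = j then (if i = k then t - c - d * r\<^sup>2 else t - c) else 0 :: real ^ 'n ^ 'n)"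
    \<comment> \<open>An intertwining relation in place of a similarity: no inverse of
      \<open>Q\<close> is formed, and its nonzero determinant cancels.\<close>
    have "(mat t - ?A) ** Q = Q ** D"
    proof (intro vec_eq_iff[THEN iffD2] allI)
      fix i j
      have "((mat t - ?A) ** Q) $ i $ j = (\<Sum>l\<in>UNIV. ((if i = l then (t - c) * Q $ l $ j else 0) - d * x $ i * (x $ l * Q $ l $ j)))"
        unfolding matrix_matrix_mult_def mat_def by (auto intro!: sum.cong simp: algebra_simps)
      also have "\<dots> = (t - c) * Q $ i $ j - d * x $ i * (\<Sum>l\<in>UNIV. x $ l * Q $ l $ j)"
        by (simp add: sum_subtractf sum_distrib_left)
      also have "(\<Sum>l\<in>UNIV. x $ l * Q $ l $ j) = r * (\<Sum>l\<in>UNIV. Q $ l $ k * Q $ l $ j)"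
        unfolding Qk sum_distrib_left using r by (intro sum.cong) auto
      also have "\<dots> = (if k = j then r else 0)" unfolding orth by simp
      also have "(t - c) * Q $ i $ j - d * x $ i * (if k = j then r else 0)
        = Q $ i $ j * (if j = k then t - c - d * r\<^sup>2 else t - c)"
        using r Qk[of i] by (auto simp: field_simps power2_eq_square)
      also have "\<dots> = (Q ** D) $ i $ j"
        unfolding D_def matrix_matrix_mult_def
        by (simp add: if_distrib[of "\<lambda>a. _ * a"] sum.delta cong: if_cong)
      finally show "((mat t - ?A) ** Q) $ i $ j = (Q ** D) $ i $ j" .
    qed
    from arg_cong[OF this, of det] have "det (mat t - ?A) = det D"
      using detQ by (simp add: det_mul)
    also have "\<dots> = (\<Prod>i\<in>UNIV. D $ i $ i)" by (rule det_diagonal) (simp add: D_def)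
    also have "\<dots> = D $ k $ k * (\<Prod>i\<in>UNIV - {k}. D $ i $ i)" by (rule prod.remove) auto
    also have "(\<Prod>i\<in>UNIV - {k}. D $ i $ i) = (\<Prod>i\<in>UNIV - {k}. t - c)" by (rule prod.cong) (auto simp: D_def)
    also have "\<dots> = (t - c) ^ (CARD('n) - 1)" by (simp add: card_Diff_singleton)
    finally show ?thesis by (simp add: poly_charpoly D_def r_def algebra_simps)
  qed
  then show ?thesis by (simp add: poly_eq_poly_eq_iff[symmetric] fun_eq_iff)
qed

text \<open>The eigenvalue list is sorted, so its last entry is the largest of its members.
  \<open>CARD('n) \<ge> 2\<close> makes the multiplicity of \<open>c\<close> positive, so both
  values occur in it.\<close>

lemma last_eigenvalue_scalar_plus_rank_one:
  fixes x :: "real ^ 'n::finite"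
  assumes "x \<noteq> 0" "CARD('n) \<ge> 2"
  shows "eigenvalue (\<chi> i j. (if i = j then c else 0) + d * (x $ i * x $ j)) (CARD('n)) = max (c + d * (norm x)\<^sup>2) c"
    (is "eigenvalue ?A _ = max ?a c")
proof -
  have roots: "proots (charpoly ?A) = add_mset ?a (replicate_mset (CARD('n) - 1) c)"
    unfolding charpoly_scalar_plus_rank_one[OF assms(1)]
    by (subst proots_mult) (simp_all add: proots_power)
  define l where "l = sorted_list_of_multiset (proots (charpoly ?A))"
  have "length l = size (mset l)" by simp
  also have "\<dots> = Suc (CARD('n) - 1)" unfolding l_def roots mset_sorted_list_of_multiset by simp
  finally have len: "length l = CARD('n)" using assms(2) by simp
  have "set l = set_mset (mset l)" by simp
  also have "\<dots> = {?a, c}" unfolding l_def roots mset_sorted_list_of_multiset using assms(2) by simp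
  finally have set: "set l = {?a, c}" .
  have "sorted l" unfolding l_def by simp
  have le: "y \<le> l ! (CARD('n) - 1)" if "y \<in> set l" for y
  proof -
    obtain k where "k < CARD('n)" "y = l ! k" using \<open>y \<in> set l\<close> len by (auto simp: in_set_conv_nth)
    then show ?thesis using sorted_nth_mono[OF \<open>sorted l\<close>, of k "CARD('n) - 1"] len by simp
  qed
  have "l ! (CARD('n) - 1) \<in> set l" using len by (intro nth_mem) auto
  then have "l ! (CARD('n) - 1) = max ?a c" using le[of ?a] le[of c] set by auto
  then show ?thesis unfolding eigenvalue_def l_def .
qed

lemma truncated_laplacian_1:
  "truncated_laplacian 1 U (x :: real ^ 'n::finite) = eigenvalue (hessian U x) (CARD('n))"
proof -
  have "CARD('n) - 1 + 1 = CARD('n)" using zero_less_card_finite[where 'a = 'n] by linarith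
  then show ?thesis unfolding truncated_laplacian_def by simp
qed

lemma partial_deriv_radial:
  fixes y :: "real ^ 'n::finite"
  assumes "y \<noteq> 0" "(u has_real_derivative w) (at (norm y))"
  shows "partial_deriv j (\<lambda>y. u (norm y)) y = w / norm y * y $ j"
proof -
  have "(norm has_derivative (\<lambda>h. h \<bullet> sgn y)) (at y)" by (rule has_derivative_norm[OF assms(1)])
  moreover have "(u has_derivative (\<lambda>h. w * h)) (at (norm y))"
    using assms(2) by (simp add: has_field_derivative_def)
  ultimately have "((\<lambda>y. u (norm y)) has_derivative (\<lambda>h. w * (h \<bullet> sgn y))) (at y)"
    by (rule has_derivative_compose)
  then show ?thesis
    unfolding partial_deriv_def by (subst frechet_derivative_at[symmetric], assumption) (simp add: inner_axis' sgn_div_norm divide_inverse)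
qed

text \<open>The formula w(|y|) y_j / |y| for the gradient holds in a whole neighbourhood, but it is
  differentiated at \<open>x\<close> only. Thus \<open>w\<close> has to be differentiable at the
  single radius |x|, which is what the exceptional set permits.\<close>

lemma truncated_laplacian_1_radial:
  fixes x :: "real ^ 'n::finite"
  assumes N: "CARD('n) \<ge> 2" and x: "x \<noteq> 0"
    and I: "open I" "norm x \<in> I" "\<And>s. s \<in> I \<Longrightarrow> (u has_real_derivative w s) (at s)"
    and w: "(w has_real_derivative z) (at (norm x))"
  shows "truncated_laplacian 1 (\<lambda>y. u (norm y)) x = max z (w (norm x) / norm x)"
proof -
  define r where "r = norm x"
  have r: "r > 0" unfolding r_def using x by simp
  define c d where "c = w r / r" and "d = (z - w r / r) / r\<^sup>2"
  define V where "V = {y :: real ^ 'n. norm y \<in> I} - {0}"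
  have V: "open V" "x \<in> V"
  proof -
    have "open {y :: real ^ 'n. norm y \<in> I}"
      using continuous_open_vimage[OF I(1), of "norm :: real ^ 'n \<Rightarrow> real"] by (auto simp: vimage_def intro: continuous_intros)
    then show "open V" unfolding V_def by (rule open_delete)
  qed (use x I in \<open>auto simp: V_def\<close>)
  have "hessian (\<lambda>y. u (norm y)) x $ i $ j = (if i = j then c else 0) + d * (x $ i * x $ j)" for i j
  proof -
    have "((\<lambda>s. w s / s) has_derivative (\<lambda>h. (z - w r / r) / r * h)) (at (norm x))"
      using w r unfolding r_def[symmetric] has_field_derivative_def[symmetric]
      by (auto intro!: derivative_eq_intros simp: field_simps)
    from has_derivative_compose[OF has_derivative_norm[OF x] this]
    have "((\<lambda>y. w (norm y) / norm y) has_derivative (\<lambda>h. (z - w r / r) / r * (h \<bullet> sgn x))) (at x)" .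
    moreover have "((\<lambda>y. y $ j) has_derivative (\<lambda>h. h $ j)) (at x)"
      by (intro bounded_linear_imp_has_derivative bounded_linear_vec_nth)
    ultimately have "((\<lambda>y. w (norm y) / norm y * y $ j) has_derivative
        (\<lambda>h. w (norm x) / norm x * h $ j + (z - w r / r) / r * (h \<bullet> sgn x) * x $ j)) (at x)"
      by (rule has_derivative_mult)
    then have "(partial_deriv j (\<lambda>y. u (norm y)) has_derivative
        (\<lambda>h. w (norm x) / norm x * h $ j + (z - w r / r) / r * (h \<bullet> sgn x) * x $ j)) (at x)"
      by (rule has_derivative_transform_within_open[OF _ V]) (rule partial_deriv_radial[symmetric], use I(3) in \<open>auto simp: V_def\<close>)
    note D = frechet_derivative_at[OF this, symmetric]
    have "hessian (\<lambda>y. u (norm y)) x $ i $ j =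
        w r / r * (axis i 1 :: real ^ 'n) $ j + (z - w r / r) / r * (axis i 1 \<bullet> sgn x) * x $ j"
      by (simp add: hessian_def partial_deriv_def[of i "partial_deriv j _"] D r_def)
    also have "(axis i 1 :: real ^ 'n) \<bullet> sgn x = x $ i / r"
      by (simp add: inner_axis' sgn_div_norm r_def field_simps)
    finally show ?thesis unfolding c_def d_def by (simp add: axis_def power2_eq_square)
  qed
  then have "hessian (\<lambda>y. u (norm y)) x = (\<chi> i j. (if i = j then c else 0) + d * (x $ i * x $ j))"
    by (simp add: vec_eq_iff)
  moreover have "c + d * (norm x)\<^sup>2 = z" unfolding c_def d_def r_def[symmetric] using r by (simp add: field_simps)
  ultimately show ?thesis
    unfolding truncated_laplacian_1 using last_eigenvalue_scalar_plus_rank_one[OF x N, of c d] by (simp add: c_def r_def)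
qed

lemma tendsto_compose_norm_at_0:
  fixes f :: "real \<Rightarrow> real"
  assumes "(f \<longlongrightarrow> l) (at_right 0)"
  shows "((\<lambda>y :: 'a::real_normed_vector. f (norm y)) \<longlongrightarrow> l) (at 0)"
proof (rule filterlim_compose[OF assms])
  show "filterlim (norm :: 'a \<Rightarrow> real) (at_right 0) (at 0)"
    unfolding filterlim_at by (auto intro!: tendsto_norm_zero simp: eventually_at_filter)
qed

text \<open>Derivatives from the right are enough at the origin, since only norms enter: the
  difference quotient of w(|y|) y_j / |y| misses its limit by at most |w(s) / s - z| with s = |y|.
  The Hessian is therefore \<open>z\<close> times the identity.\<close>

lemma truncated_laplacian_1_radial_at_0:
  fixes u :: "real \<Rightarrow> real"
  assumes N: "CARD('n::finite) \<ge> 2" and e: "0 < e"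
    and u: "\<And>s. 0 < s \<Longrightarrow> s < e \<Longrightarrow> (u has_real_derivative w s) (at s)"
    and u0: "(u has_real_derivative 0) (at 0 within {0..})"
    and w: "w 0 = 0" "(w has_real_derivative z) (at 0 within {0..})"
  shows "truncated_laplacian 1 (\<lambda>y. u (norm y)) (0 :: real ^ 'n) = z"
proof -
  have at: "at 0 within {0::real..} = at_right 0"
    by (rule at_within_nhd[of _ UNIV]) auto
  have ulim: "((\<lambda>s. (u s - u 0) / s) \<longlongrightarrow> 0) (at_right 0)"
    using u0 unfolding has_field_derivative_iff at by simp
  have wlim: "((\<lambda>s. w s / s) \<longlongrightarrow> z) (at_right 0)"
    using w unfolding has_field_derivative_iff at by simp
  have p0: "partial_deriv j (\<lambda>y. u (norm y)) (0 :: real ^ 'n) = 0" for j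
  proof -
    have "((\<lambda>y :: real ^ 'n. u (norm y)) has_derivative (\<lambda>h. 0)) (at 0)"
      unfolding has_derivative_at
    proof (intro conjI)
      show "(\<lambda>h :: real ^ 'n. norm (u (norm (0 + h)) - u (norm (0 :: real ^ 'n)) - 0) / norm h) \<midarrow>0\<rightarrow> 0"
        using tendsto_rabs_zero[OF tendsto_compose_norm_at_0[OF ulim]] by (simp add: abs_divide)
    qed simp
    from frechet_derivative_at[OF this, symmetric] show ?thesis unfolding partial_deriv_def by simp
  qed
  have pj: "partial_deriv j (\<lambda>y. u (norm y)) y = w (norm y) / norm y * y $ j" if "y \<in> ball 0 e" for y :: "real ^ 'n" and j
    using partial_deriv_radial[of y u "w (norm y)" j] u[of "norm y"] that p0 by (cases "y = 0") auto
  have "hessian (\<lambda>y. u (norm y)) (0 :: real ^ 'n) $ i $ j = (if i = j then z else 0)" for i j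
  proof -
    have "((\<lambda>y :: real ^ 'n. w (norm y) / norm y * y $ j) has_derivative (\<lambda>h. z * h $ j)) (at 0)"
      unfolding has_derivative_at
    proof (intro conjI)
      show "bounded_linear (\<lambda>h :: real ^ 'n. z * h $ j)"
        by (intro bounded_linear_const_mult bounded_linear_vec_nth)
      have lim: "((\<lambda>h :: real ^ 'n. \<bar>w (norm h) / norm h - z\<bar>) \<longlongrightarrow> 0) (at 0)"
        using tendsto_compose_norm_at_0[OF wlim] by (simp add: LIM_zero_iff tendsto_rabs_zero_iff)
      show "(\<lambda>h :: real ^ 'n. norm (w (norm (0 + h)) / norm (0 + h) * (0 + h) $ j - w (norm (0 :: real ^ 'n)) / norm (0 :: real ^ 'n) * (0 :: real ^ 'n) $ j - z * h $ j) / norm h) \<midarrow>0\<rightarrow> 0"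
      proof (rule tendsto_sandwich[OF _ _ tendsto_const lim])
        show "eventually (\<lambda>h :: real ^ 'n. norm (w (norm (0 + h)) / norm (0 + h) * (0 + h) $ j - w (norm (0 :: real ^ 'n)) / norm (0 :: real ^ 'n) * (0 :: real ^ 'n) $ j - z * h $ j) / norm h \<le> \<bar>w (norm h) / norm h - z\<bar>) (at 0)"
        proof (rule always_eventually, rule allI)
          fix h :: "real ^ 'n"
          have "\<bar>w (norm h) / norm h * h $ j - z * h $ j\<bar> = \<bar>w (norm h) / norm h - z\<bar> * \<bar>h $ j\<bar>"
            by (simp add: abs_mult[symmetric] algebra_simps)
          also have "\<dots> \<le> \<bar>w (norm h) / norm h - z\<bar> * norm h"
            using component_le_norm_cart[of h j] by (intro mult_left_mono) auto
          finally show "norm (w (norm (0 + h)) / norm (0 + h) * (0 + h) $ j - w (norm (0 :: real ^ 'n)) / norm (0 :: real ^ 'n) * (0 :: real ^ 'n) $ j - z * h $ j) / norm h \<le> \<bar>w (norm h) / norm h - z\<bar>"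
            by (cases "h = 0") (simp_all add: divide_le_eq)
        qed
      qed (auto intro!: always_eventually)
    qed
    then have "(partial_deriv j (\<lambda>y :: real ^ 'n. u (norm y)) has_derivative (\<lambda>h. z * h $ j)) (at 0)"
      by (rule has_derivative_transform_within_open[of _ _ _ _ "ball 0 e"]) (use pj e in auto)
    note D = frechet_derivative_at[OF this, symmetric]
    have "hessian (\<lambda>y. u (norm y)) (0 :: real ^ 'n) $ i $ j = z * (axis i 1 :: real ^ 'n) $ j"
      by (simp add: hessian_def partial_deriv_def[of i "partial_deriv j _"] D)
    then show ?thesis by (simp add: axis_def)
  qed
  \<comment> \<open>The scalar matrix is written with a vanishing rank-one part along an arbitrary
    unit vector, because the eigenvalue formula asks for a nonzero vector.\<close>
  then have "hessian (\<lambda>y. u (norm y)) (0 :: real ^ 'n) = (\<chi> i j. (if i = j then z else 0) + 0 * (axis undefined 1 $ i * axis undefined 1 $ j))"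
    by (simp add: vec_eq_iff)
  then show ?thesis
    unfolding truncated_laplacian_1
    using last_eigenvalue_scalar_plus_rank_one[OF _ N, of "axis undefined 1" z 0] by simp
qed

section \<open>Uniqueness of radial solutions\<close>

lemma le_if_deriv_nonneg_off_finite:
  fixes f :: "real \<Rightarrow> real"
  assumes "a \<le> b" "finite S" "continuous_on {a..b} f"
    and f: "\<And>x. a < x \<Longrightarrow> x < b \<Longrightarrow> x \<notin> S \<Longrightarrow> (f has_real_derivative f' x) (at x) \<and> 0 \<le> f' x"
  shows "f a \<le> f b"
proof -
  define h where "h = (\<lambda>x. if a < x \<and> x < b \<and> x \<notin> S then f' x else 0)"
  have "(h has_integral (f b - f a)) {a..b}"
  proof (rule fundamental_theorem_of_calculus_interior_strong[OF assms(2,1) _ assms(3)])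
    fix x assume "x \<in> {a<..<b} - S"
    then show "(f has_vector_derivative h x) (at x)"
      using f[of x] by (simp add: h_def has_real_derivative_iff_has_vector_derivative)
  qed
  then have "0 \<le> f b - f a" by (rule has_integral_nonneg) (use f in \<open>auto simp: h_def\<close>)
  then show ?thesis by simp
qed

text \<open>The equation max(u'', u' / r) = - g(u), with \<open>w\<close> for u' and
  \<open>z\<close> for u'', in a form without division: two inequalities of which one is an
  equality. The condition 0 < r in the last alternative leaves only u'' = - g(u) at the origin. The
  bound on \<open>w\<close> is demanded at exceptional radii too. The domain \<open>I\<close> is
  arbitrary because each phase, on a compact or a half-open interval, is a profile by
  itself.\<close>

definition profile ::
  "(real \<Rightarrow> real) \<Rightarrow> real set \<Rightarrow> (real \<Rightarrow> real) \<Rightarrow> (real \<Rightarrow> real) \<Rightarrow> (real \<Rightarrow> real) \<Rightarrow> real set \<Rightarrow> bool" where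
  "profile g I u w z E \<longleftrightarrow>
     (\<forall>\<rho>\<in>I. finite (E \<inter> {..\<rho>})) \<and>
     (\<forall>r\<in>I. (u has_real_derivative w r) (at r within I)) \<and> continuous_on I w \<and>
     (\<forall>r\<in>I - E. (w has_real_derivative z r) (at r within I)) \<and> continuous_on (I - E) z \<and>
     (\<forall>e\<in>E. (\<exists>l. (z \<longlongrightarrow> l) (at_left e)) \<and> (\<exists>l. (z \<longlongrightarrow> l) (at_right e))) \<and>
     (\<forall>r\<in>I. w r \<le> - r * g (u r)) \<and>
     (\<forall>r\<in>I - E. z r \<le> - g (u r) \<and> (z r = - g (u r) \<or> 0 < r \<and> w r = - r * g (u r)))"

lemma at_0_within_ival:
  assumes "0 < R"
  shows "at 0 within ival 0 R = at_right 0"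
proof -
  have "0 \<in> ival 0 R" using assms by (simp add: ival_iff zero_ereal_def)
  then obtain s where s: "s > 0" "s \<in> ival 0 R" by (rule ival_exceeds)
  show ?thesis
    by (rule at_within_nhd[of _ "{..<s}"]) (use s ival_subset[OF s(2)] in \<open>auto simp: ival_iff\<close>)
qed

lemma truncated_laplacian_radial_profile:
  fixes x :: "real ^ 'n::finite"
  assumes N: "CARD('n) \<ge> 2" and x: "ereal (norm x) < R"
    and u: "\<And>r. r \<in> ival 0 R \<Longrightarrow> (u has_real_derivative w r) (at r within ival 0 R)"
    and w: "w 0 = 0" "(w has_real_derivative z) (at (norm x) within ival 0 R)"
  shows "truncated_laplacian 1 (\<lambda>y. u (norm y)) x = (if x = 0 then z else max z (w (norm x) / norm x))"
proof (cases "x = 0")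
  case True
  have R: "0 < R" using x True by (simp add: zero_ereal_def)
  have "0 \<in> ival 0 R" using R by (simp add: ival_iff zero_ereal_def)
  then obtain s where s: "s > 0" "s \<in> ival 0 R" by (rule ival_exceeds)
  have at0: "at 0 within ival 0 R = at 0 within {0..}"
    using at_0_within_ival[OF R] at_0_within_ival[of \<infinity>] by simp
  have "truncated_laplacian 1 (\<lambda>y. u (norm y)) (0 :: real ^ 'n) = z"
  proof (rule truncated_laplacian_1_radial_at_0[OF N s(1), of u w])
    show "(u has_real_derivative w r) (at r)" if "0 < r" "r < s" for r
      using u[of r] ival_downward[OF s(2), of r] that at_within_ival_interior[of 0 r R] by (auto simp: ival_iff)
    show "(u has_real_derivative 0) (at 0 within {0..})" using u[OF \<open>0 \<in> ival 0 R\<close>] w at0 by simp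
    show "(w has_real_derivative z) (at 0 within {0..})" using w True at0 by simp
  qed (use w in simp)
  then show ?thesis using True by simp
next
  case False
  have r: "norm x \<in> ival 0 R" using x by (simp add: ival_iff)
  obtain s where s: "s > norm x" "s \<in> ival 0 R" using ival_exceeds[OF r] .
  have "truncated_laplacian 1 (\<lambda>y. u (norm y)) x = max z (w (norm x) / norm x)"
  proof (rule truncated_laplacian_1_radial[OF N False, of "{0<..<s}"])
    show "(u has_real_derivative w r) (at r)" if "r \<in> {0<..<s}" for r
      using u[of r] ival_downward[OF s(2), of r] that at_within_ival_interior[of 0 r R] by (auto simp: ival_iff)
    show "(w has_real_derivative z) (at (norm x))"
      using w at_within_ival_interior[of 0 "norm x" R] x False by simp
  qed (use s False in auto)
  then show ?thesis using False by simp
qed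

lemma deriv_eq_on_ival:
  assumes "\<And>r. r \<in> ival a R \<Longrightarrow> (u has_real_derivative w r) (at r within ival a R)" "a < r" "ereal r < R"
  shows "deriv u r = w r"
  using assms(1)[of r] assms(2,3) at_within_ival_interior[of a r R] by (auto simp: ival_iff intro: DERIV_imp_deriv)

lemma filterlim_deriv_blow_up_cong:
  assumes "\<And>r. r \<in> ival a R \<Longrightarrow> (u has_real_derivative w r) (at r within ival a R)" "ereal a < R"
  shows "filterlim (\<lambda>r. \<bar>u r\<bar> + \<bar>deriv u r\<bar>) at_top (to_R R) \<longleftrightarrow> filterlim (\<lambda>r. \<bar>u r\<bar> + \<bar>w r\<bar>) at_top (to_R R)"
  by (rule filterlim_cong[OF refl refl], rule eventually_mono[OF eventually_to_R[OF assms(2)]])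
    (use deriv_eq_on_ival[OF assms(1)] in auto)

lemma radial_solution_imp_profile:
  assumes N: "CARD('n::finite) \<ge> 2" and g: "continuous_on UNIV g"
    and sol: "radial_solution TYPE('n) 1 g R u"
  obtains w z E where "0 < R" "profile g (ival 0 R) u w z E" "w 0 = 0"
    "R \<noteq> \<infinity> \<Longrightarrow> filterlim (\<lambda>r. \<bar>u r\<bar> + \<bar>w r\<bar>) at_top (to_R R)"
proof -
  obtain E where R: "0 < R" and pw: "piecewise_C2_off R u E"
    and eq: "\<And>x :: real ^ 'n. ereal (norm x) < R \<Longrightarrow> norm x \<notin> E \<Longrightarrow>
      truncated_laplacian 1 (\<lambda>y. u (norm y)) x + g (u (norm x)) = 0"
    and u0: "(u has_real_derivative 0) (at 0 within ival 0 R)"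
    and blow: "R \<noteq> \<infinity> \<Longrightarrow> filterlim (\<lambda>r. \<bar>u r\<bar> + \<bar>deriv u r\<bar>) at_top (to_R R)"
    using sol unfolding radial_solution_def upto_R_eq_ival by blast
  obtain w z where E: "E \<subseteq> ival 0 R - {0}" "\<And>\<rho>. ereal \<rho> < R \<Longrightarrow> finite (E \<inter> {0..\<rho>})"
    and u: "\<And>r. r \<in> ival 0 R \<Longrightarrow> (u has_real_derivative w r) (at r within ival 0 R)"
    and wc: "continuous_on (ival 0 R) w"
    and w: "\<And>r. r \<in> ival 0 R - E \<Longrightarrow> (w has_real_derivative z r) (at r within ival 0 R)"
    and z: "continuous_on (ival 0 R - E) z"
      "\<forall>e\<in>E. (\<exists>l. (z \<longlongrightarrow> l) (at_left e)) \<and> (\<exists>l. (z \<longlongrightarrow> l) (at_right e))"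
    using pw unfolding piecewise_C2_off_def upto_R_eq_ival by blast
  have zero_in: "0 \<in> ival 0 R" using R by (simp add: ival_iff zero_ereal_def)
  have w0: "w 0 = 0"
    using u[OF zero_in] u0 unfolding has_field_derivative_iff at_0_within_ival[OF R]
    by (rule tendsto_unique[rotated]) simp
  have eqr: "z r \<le> - g (u r)" "w r \<le> - r * g (u r)" "z r = - g (u r) \<or> 0 < r \<and> w r = - r * g (u r)"
    if r: "r \<in> ival 0 R - E" for r
  proof -
    define x :: "real ^ 'n" where "x = r *\<^sub>R axis undefined 1"
    have nx: "norm x = r" using r unfolding x_def by (simp add: ival_iff)
    have x0: "x = 0 \<longleftrightarrow> r = 0" using nx by auto
    have "truncated_laplacian 1 (\<lambda>y. u (norm y)) x = (if x = 0 then z r else max (z r) (w (norm x) / norm x))"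
      using r by (intro truncated_laplacian_radial_profile[OF N _ u w0]) (use w nx in \<open>auto simp: ival_iff\<close>)
    then have "(if r = 0 then z r else max (z r) (w r / r)) = - g (u r)"
      using eq[of x] r unfolding x0 nx by (auto simp: ival_iff)
    moreover have "r \<ge> 0" using r by (simp add: ival_iff)
    moreover have "w r \<le> - r * g (u r) \<longleftrightarrow> w r / r \<le> - g (u r)" "w r = - r * g (u r) \<longleftrightarrow> w r / r = - g (u r)"
      if "r > 0" using that by (simp_all add: field_simps)
    ultimately have "z r \<le> - g (u r) \<and> w r \<le> - r * g (u r) \<and> (z r = - g (u r) \<or> 0 < r \<and> w r = - r * g (u r))"
      using w0 by (cases "r = 0") (simp_all, linarith)
    then show "z r \<le> - g (u r)" "w r \<le> - r * g (u r)" "z r = - g (u r) \<or> 0 < r \<and> w r = - r * g (u r)"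
      by blast+
  qed
  \<comment> \<open>At exceptional radii the bound follows by continuity, because radii outside
    \<open>E\<close> accumulate at every radius from the right.\<close>
  have le: "w r \<le> - r * g (u r)" if r: "r \<in> ival 0 R" for r
  proof (rule ccontr)
    assume neg: "\<not> w r \<le> - r * g (u r)"
    obtain s where s: "s > r" "s \<in> ival 0 R" using ival_exceeds[OF r] .
    define h where "h = (\<lambda>r. w r + r * g (u r))"
    have "continuous_on (ival 0 R) u" by (rule DERIV_continuous_on[OF u])
    then have "continuous_on (ival 0 R) h"
      unfolding h_def by (intro continuous_intros wc continuous_on_compose2[OF g]) auto
    then have "continuous (at r within ival 0 R) h" using r by (simp add: continuous_on_eq_continuous_within)
    then have "eventually (\<lambda>s. h s > 0) (at r within ival 0 R)"
      using neg unfolding continuous_within by (intro order_tendstoD) (auto simp: h_def)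
    then obtain d where d: "d > 0" "\<And>t. t \<in> ival 0 R \<Longrightarrow> t \<noteq> r \<Longrightarrow> dist t r < d \<Longrightarrow> h t > 0"
      unfolding eventually_at by blast
    have "infinite ({r<..<min s (r + d)} - (E \<inter> {0..s}))"
      using E(2)[of s] s d by (intro Diff_infinite_finite) (auto simp: ival_iff infinite_Ioo)
    then obtain t where t: "t \<in> {r<..<min s (r + d)} - (E \<inter> {0..s})"
      by (metis all_not_in_conv finite.emptyI)
    have "0 \<le> r" using r by (simp add: ival_iff)
    then have "t \<in> ival 0 R - E" using t ival_downward[OF s(2), of t] by auto
    then show False using d(2)[of t] eqr(2)[of t] t by (auto simp: h_def dist_real_def)
  qed
  show thesis
  proof (rule that[of w z E, OF R])
    show "w 0 = 0" by fact
    have "finite (E \<inter> {..\<rho>})" if "\<rho> \<in> ival 0 R" for \<rho>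
    proof -
      have "E \<inter> {..\<rho>} = E \<inter> {0..\<rho>}" using E(1) by (auto simp: ival_iff)
      then show ?thesis using E(2) that by (simp add: ival_iff)
    qed
    then show "profile g (ival 0 R) u w z E"
      unfolding profile_def using u wc w z eqr le by blast
    assume "R \<noteq> \<infinity>"
    then show "filterlim (\<lambda>r. \<bar>u r\<bar> + \<bar>w r\<bar>) at_top (to_R R)"
      using blow filterlim_deriv_blow_up_cong[of 0 R u w] u R by (simp add: zero_ereal_def)
  qed
qed

lemma profile_imp_radial_solution:
  assumes N: "CARD('n::finite) \<ge> 2" and R: "0 < R"
    and p: "profile g (ival 0 R) u w z E" and E: "E \<subseteq> ival 0 R - {0}" and w0: "w 0 = 0"
    and blow: "R \<noteq> \<infinity> \<Longrightarrow> filterlim (\<lambda>r. \<bar>u r\<bar> + \<bar>w r\<bar>) at_top (to_R R)"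
  shows "radial_solution TYPE('n) 1 g R u"
proof -
  have u: "\<And>r. r \<in> ival 0 R \<Longrightarrow> (u has_real_derivative w r) (at r within ival 0 R)"
    and w: "\<And>r. r \<in> ival 0 R - E \<Longrightarrow> (w has_real_derivative z r) (at r within ival 0 R)"
    using p unfolding profile_def by blast+
  have zero_in: "0 \<in> ival 0 R" using R by (simp add: ival_iff zero_ereal_def)
  have fin: "finite (E \<inter> {0..\<rho>})" if "ereal \<rho> < R" for \<rho>
  proof (cases "\<rho> \<ge> 0")
    case True
    then have "finite (E \<inter> {..\<rho>})" using p that unfolding profile_def by (simp add: ival_iff)
    then show ?thesis by (rule rev_finite_subset) auto
  qed simp
  have "piecewise_C2_off R u E"
    unfolding piecewise_C2_off_def upto_R_eq_ival
    using p E fin unfolding profile_def by blast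
  moreover have "truncated_laplacian 1 (\<lambda>y. u (norm y)) x + g (u (norm x)) = 0"
    if x: "ereal (norm x) < R" "norm x \<notin> E" for x :: "real ^ 'n"
  proof -
    have r: "norm x \<in> ival 0 R - E" using x by (simp add: ival_iff)
    have "z (norm x) \<le> - g (u (norm x))" "w (norm x) \<le> - norm x * g (u (norm x))"
      "z (norm x) = - g (u (norm x)) \<or> 0 < norm x \<and> w (norm x) = - norm x * g (u (norm x))"
      using p r unfolding profile_def by blast+
    moreover have "truncated_laplacian 1 (\<lambda>y. u (norm y)) x = (if x = 0 then z (norm x) else max (z (norm x)) (w (norm x) / norm x))"
      by (rule truncated_laplacian_radial_profile[OF N x(1) u w0]) (use w r in auto)
    moreover have "w (norm x) \<le> - norm x * g (u (norm x)) \<longleftrightarrow> w (norm x) / norm x \<le> - g (u (norm x))"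
      "w (norm x) = - norm x * g (u (norm x)) \<longleftrightarrow> w (norm x) / norm x = - g (u (norm x))"
      if "x \<noteq> 0" using that by (simp_all add: field_simps)
    ultimately show ?thesis by (cases "x = 0") (simp_all, linarith)
  qed
  moreover have "R \<noteq> \<infinity> \<longrightarrow> filterlim (\<lambda>r. \<bar>u r\<bar> + \<bar>deriv u r\<bar>) at_top (to_R R)"
    using blow filterlim_deriv_blow_up_cong[of 0 R u w] u R by (simp add: zero_ereal_def)
  moreover have "(u has_real_derivative 0) (at 0 within ival 0 R)" using u[OF zero_in] w0 by simp
  ultimately show ?thesis unfolding radial_solution_def upto_R_eq_ival using R by blast
qed

text \<open>The equation is a reflection problem: \<open>- u' - \<integral> g(u)\<close> is nondecreasing and grows only where
  the constraint \<open>u' \<le> - r g(u)\<close> is active, hence it is given by Skorokhod's formula.\<close>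

lemma profile_skorokhod_formula:
  assumes g: "continuous_on UNIV g"
    and p: "profile g (ival 0 R) u w z E" and w0: "w 0 = 0" and t: "t \<in> ival 0 R"
    and I: "I = (\<lambda>r. integral {0..r} (\<lambda>s. g (u s)))"
  shows "\<exists>s\<in>{0..t}. - w t - I t = s * g (u s) - I s"
    and "\<And>s. s \<in> {0..t} \<Longrightarrow> s * g (u s) - I s \<le> - w t - I t"
proof -
  have u: "\<And>r. r \<in> ival 0 R \<Longrightarrow> (u has_real_derivative w r) (at r within ival 0 R)"
    and w: "\<And>r. r \<in> ival 0 R - E \<Longrightarrow> (w has_real_derivative z r) (at r within ival 0 R)"
    and wc: "continuous_on (ival 0 R) w"
    and fin: "finite (E \<inter> {..t})"
    and le: "\<And>r. r \<in> ival 0 R \<Longrightarrow> w r \<le> - r * g (u r)"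
    and z: "\<And>r. r \<in> ival 0 R - E \<Longrightarrow> z r \<le> - g (u r)"
      "\<And>r. r \<in> ival 0 R - E \<Longrightarrow> z r = - g (u r) \<or> 0 < r \<and> w r = - r * g (u r)"
    using p t unfolding profile_def by blast+
  \<comment> \<open>The pushing term of the reflection problem: its derivative - z - g(u) is
    nonnegative, and it vanishes where w < - r g(u).\<close>
  define L where "L = (\<lambda>r. - w r - I r)"
  have sub: "{0..t} \<subseteq> ival 0 R" by (rule ival_subset[OF t])
  have uc: "continuous_on (ival 0 R) u" by (rule DERIV_continuous_on[OF u])
  have guc: "continuous_on (ival 0 R) (\<lambda>r. g (u r))"
    by (intro continuous_on_compose2[OF g uc]) auto
  have Ider: "(I has_real_derivative g (u r)) (at r within {0..t})" if "r \<in> {0..t}" for r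
    unfolding I by (rule integral_has_real_derivative[OF continuous_on_subset[OF guc sub] that])
  have Ic: "continuous_on {0..t} I" by (rule DERIV_continuous_on[OF Ider])
  have Lc: "continuous_on {0..t} L"
    unfolding L_def by (intro continuous_intros Ic continuous_on_subset[OF wc sub])
  have Lder: "(L has_real_derivative - z r - g (u r)) (at r)" if "0 < r" "r < t" "r \<notin> E \<inter> {..t}" for r
  proof -
    have "r \<in> ival 0 R" using that sub by auto
    then have r: "r \<in> ival 0 R - E" "ereal r < R" using that by (auto simp: ival_iff)
    have "(w has_real_derivative z r) (at r)"
      using w[OF r(1)] at_within_ival_interior[of 0 r R] that r by simp
    moreover have "(I has_real_derivative g (u r)) (at r)"
      using Ider[of r] that at_within_Icc_at[of 0 r t] by simp
    ultimately show ?thesis unfolding L_def by (auto intro!: derivative_eq_intros)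
  qed
  have mono: "L s \<le> L t" if s: "s \<in> {0..t}" for s
  proof (rule le_if_deriv_nonneg_off_finite[OF _ fin, of s t L "\<lambda>r. - z r - g (u r)"])
    show "continuous_on {s..t} L" by (rule continuous_on_subset[OF Lc]) (use s in auto)
    fix r assume r: "s < r" "r < t" "r \<notin> E \<inter> {..t}"
    then show "(L has_real_derivative - z r - g (u r)) (at r) \<and> 0 \<le> - z r - g (u r)"
      using Lder[of r] z(1)[of r] subsetD[OF sub, of r] s by auto
  qed (use s in auto)
  show "s * g (u s) - I s \<le> - w t - I t" if "s \<in> {0..t}" for s
    using mono[OF that] le[OF subsetD[OF sub that]] unfolding L_def by simp
  \<comment> \<open>The contact set. From its last element \<open>s\<close> up to \<open>t\<close>
    the function \<open>L\<close> is constant, so the supremum is attained at \<open>s\<close>. The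
    set is nonempty because \<open>w\<close> vanishes at 0.\<close>
  define Z where "Z = {s \<in> {0..t}. w s + s * g (u s) = 0}"
  have "continuous_on {0..t} (\<lambda>s. w s + s * g (u s))"
    by (intro continuous_intros continuous_on_subset[OF wc sub] continuous_on_subset[OF guc sub])
  then have "closed Z" unfolding Z_def by (intro continuous_closed_preimage_constant) auto
  then have "compact Z" unfolding Z_def by (auto simp: compact_eq_bounded_closed intro: bounded_subset[of "{0..t}"])
  moreover have "0 \<in> Z" using w0 t unfolding Z_def by (simp add: ival_iff)
  ultimately obtain s where s: "s \<in> Z" "\<And>r. r \<in> Z \<Longrightarrow> r \<le> s"
    using compact_attains_sup[of Z] by blast
  have st: "s \<in> {0..t}" "w s + s * g (u s) = 0" using s(1) unfolding Z_def by auto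
  have "- L s \<le> - L t"
  proof (rule le_if_deriv_nonneg_off_finite[OF _ fin, of s t "\<lambda>r. - L r" "\<lambda>r. z r + g (u r)"])
    show "continuous_on {s..t} (\<lambda>r. - L r)"
      by (intro continuous_intros continuous_on_subset[OF Lc]) (use st in auto)
    fix r assume r: "s < r" "r < t" "r \<notin> E \<inter> {..t}"
    have "r \<notin> Z" using s(2)[of r] r by auto
    then have "z r = - g (u r)" using z(2)[of r] r st subsetD[OF sub, of r] unfolding Z_def by auto
    then show "((\<lambda>r. - L r) has_real_derivative z r + g (u r)) (at r) \<and> 0 \<le> z r + g (u r)"
      using DERIV_minus[OF Lder[of r]] r st by auto
  qed (use st in auto)
  with mono[OF st(1)] st have "- w t - I t = s * g (u s) - I s" unfolding L_def by simp
  then show "\<exists>s\<in>{0..t}. - w t - I t = s * g (u s) - I s" using st(1) by blast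
qed

text \<open>Running maxima differ by no more than the functions under them: each maximum is tested
  at the maximiser of the other. In the formula for \<open>w\<close>, the function \<open>u\<close>
  enters three times, through the integral up to \<open>t\<close>, the integral up to the maximiser,
  and s g(u(s)); each contributes a Lipschitz constant \<rho> K, whence 3 \<rho> K.\<close>

lemma profile_unique:
  assumes lip: "\<And>M. \<exists>K\<ge>0. \<forall>x y. \<bar>x\<bar> \<le> M \<longrightarrow> \<bar>y\<bar> \<le> M \<longrightarrow> \<bar>g x - g y\<bar> \<le> K * \<bar>x - y :: real\<bar>"
    and g: "continuous_on UNIV g"
    and p1: "profile g (ival 0 R1) u1 w1 z1 E1" "w1 0 = 0"
    and p2: "profile g (ival 0 R2) u2 w2 z2 E2" "w2 0 = 0"
    and eq: "u1 0 = u2 0" and \<rho>: "\<rho> \<in> ival 0 R1" "\<rho> \<in> ival 0 R2"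
  shows "u1 \<rho> = u2 \<rho>"
proof -
  have u1: "\<And>r. r \<in> ival 0 R1 \<Longrightarrow> (u1 has_real_derivative w1 r) (at r within ival 0 R1)"
    and u2: "\<And>r. r \<in> ival 0 R2 \<Longrightarrow> (u2 has_real_derivative w2 r) (at r within ival 0 R2)"
    using p1 p2 unfolding profile_def by blast+
  note sub1 = ival_subset[OF \<rho>(1)] and sub2 = ival_subset[OF \<rho>(2)]
  have d1: "(u1 has_real_derivative w1 r) (at r within {0..\<rho>})" if "r \<in> {0..\<rho>}" for r
    using DERIV_subset[OF u1 sub1] sub1 that by blast
  have d2: "(u2 has_real_derivative w2 r) (at r within {0..\<rho>})" if "r \<in> {0..\<rho>}" for r
    using DERIV_subset[OF u2 sub2] sub2 that by blast
  have c1: "continuous_on {0..\<rho>} u1" by (rule DERIV_continuous_on[OF d1])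
  have c2: "continuous_on {0..\<rho>} u2" by (rule DERIV_continuous_on[OF d2])
  have "bounded (u1 ` {0..\<rho>} \<union> u2 ` {0..\<rho>})"
    using c1 c2 by (auto intro!: compact_imp_bounded compact_continuous_image)
  then obtain M where "\<And>x. x \<in> u1 ` {0..\<rho>} \<union> u2 ` {0..\<rho>} \<Longrightarrow> norm x \<le> M"
    unfolding bounded_iff by blast
  then have M: "\<And>s. s \<in> {0..\<rho>} \<Longrightarrow> \<bar>u1 s\<bar> \<le> M \<and> \<bar>u2 s\<bar> \<le> M"
    by simp
  obtain K where K: "K \<ge> 0" "\<And>x y. \<bar>x\<bar> \<le> M \<Longrightarrow> \<bar>y\<bar> \<le> M \<Longrightarrow> \<bar>g x - g y\<bar> \<le> K * \<bar>x - y\<bar>"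
    using lip[of M] by blast
  have "\<rho> \<ge> 0" using \<rho> by (simp add: ival_iff)
  define I1 where "I1 = (\<lambda>r. integral {0..r} (\<lambda>s. g (u1 s)))"
  define I2 where "I2 = (\<lambda>r. integral {0..r} (\<lambda>s. g (u2 s)))"
  have "u1 \<rho> - u2 \<rho> = 0"
  proof (rule eq_zero_if_deriv_le_past[where d = "\<lambda>r. u1 r - u2 r" and d' = "\<lambda>r. w1 r - w2 r" and C = "3 * \<rho> * K" and a = 0 and b = \<rho>])
    show "((\<lambda>r. u1 r - u2 r) has_vector_derivative w1 r - w2 r) (at r within {0..\<rho>})" if "r \<in> {0..\<rho>}" for r
      using DERIV_diff[OF d1[OF that] d2[OF that]] by (simp add: has_real_derivative_iff_has_vector_derivative)
    fix t m assume t: "t \<in> {0..\<rho>}" and m: "\<And>s. s \<in> {0..t} \<Longrightarrow> norm (u1 s - u2 s) \<le> m"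
    have t1: "t \<in> ival 0 R1" and t2: "t \<in> ival 0 R2" using t sub1 sub2 by auto
    have m0: "m \<ge> 0" using order.trans[OF norm_ge_zero m[of 0]] t by simp
    have gd: "\<bar>g (u1 s) - g (u2 s)\<bar> \<le> K * m" if s: "s \<in> {0..t}" for s
    proof -
      have "\<bar>g (u1 s) - g (u2 s)\<bar> \<le> K * \<bar>u1 s - u2 s\<bar>" by (intro K) (use M s t in auto)
      also have "\<dots> \<le> K * m" using m[OF s] K by (intro mult_left_mono) auto
      finally show ?thesis .
    qed
    have Id: "\<bar>I1 s - I2 s\<bar> \<le> \<rho> * K * m" if s: "s \<in> {0..t}" for s
    proof -
      have i: "(\<lambda>s. g (u1 s)) integrable_on {0..s}" "(\<lambda>s. g (u2 s)) integrable_on {0..s}"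
        using s t by (auto intro!: integrable_continuous_real continuous_on_compose2[OF g] continuous_on_subset[OF c1] continuous_on_subset[OF c2])
      have "I1 s - I2 s = integral {0..s} (\<lambda>s. g (u1 s) - g (u2 s))"
        unfolding I1_def I2_def using i by (simp add: integral_diff)
      also have "norm \<dots> \<le> K * m * (s - 0)"
        using s gd t by (intro integral_bound) (auto intro!: continuous_intros continuous_on_compose2[OF g] continuous_on_subset[OF c1] continuous_on_subset[OF c2])
      also have "\<dots> \<le> K * m * \<rho>" using s t K m0 by (intro mult_left_mono) auto
      finally show ?thesis by (simp add: mult_ac)
    qed
    have gs: "\<bar>s * g (u1 s) - s * g (u2 s)\<bar> \<le> \<rho> * K * m" if s: "s \<in> {0..t}" for s
    proof -
      have "\<bar>s * g (u1 s) - s * g (u2 s)\<bar> = s * \<bar>g (u1 s) - g (u2 s)\<bar>"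
        using s by (simp add: right_diff_distrib[symmetric] abs_mult)
      also have "\<dots> \<le> \<rho> * (K * m)" using gd[OF s] s t by (intro mult_mono) auto
      finally show ?thesis by (simp add: mult.assoc)
    qed
    note sk1 = profile_skorokhod_formula[OF g p1 t1 I1_def]
    note sk2 = profile_skorokhod_formula[OF g p2 t2 I2_def]
    obtain s where s: "s \<in> {0..t}" "- w1 t - I1 t = s * g (u1 s) - I1 s" using sk1(1) by blast
    obtain s' where s': "s' \<in> {0..t}" "- w2 t - I2 t = s' * g (u2 s') - I2 s'" using sk2(1) by blast
    have tt: "t \<in> {0..t}" using t by simp
    have "\<bar>w1 t - w2 t\<bar> \<le> 3 * (\<rho> * K * m)"
      using s(2) s'(2) sk2(2)[OF s(1)] sk1(2)[OF s'(1)] Id[OF s(1)] Id[OF s'(1)] Id[OF tt] gs[OF s(1)] gs[OF s'(1)]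
      by linarith
    then show "norm (w1 t - w2 t) \<le> 3 * \<rho> * K * m" by (simp add: mult_ac)
  qed (use eq \<open>\<rho> \<ge> 0\<close> K in auto)
  then show ?thesis by simp
qed

section \<open>Gluing phases\<close>

lemma has_real_derivative_local_cong:
  assumes f: "(f has_real_derivative d) (at r within T)" and U: "open U" "r \<in> U"
    and eq: "S \<inter> U = T \<inter> U" "\<And>s. s \<in> S \<Longrightarrow> s \<in> U \<Longrightarrow> h s = f s" and r: "r \<in> S"
  shows "(h has_real_derivative d) (at r within S)"
proof -
  have "at r within S = at r within T" by (rule at_within_nhd[OF U(2,1)]) (use eq in auto)
  then have "(f has_real_derivative d) (at r within S)" using f by simp
  moreover have "eventually (\<lambda>s. f s = h s) (at r within S)"
    unfolding eventually_at_topological using U eq by metis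
  ultimately show ?thesis using has_field_derivative_cong_eventually[of f h r S d] eq(2)[OF r U(2)] by simp
qed

text \<open>On common radii the solutions agree by \<open>profile_unique\<close>, so what remains is
  that they end together. If one ended first, its end would be finite and it would blow up there,
  while the other one and its derivative are bounded on the compact interval up to that
  radius.\<close>

lemma radial_solution_unique:
  assumes N: "CARD('n::finite) \<ge> 2"
    and lip: "\<And>M. \<exists>K\<ge>0. \<forall>x y. \<bar>x\<bar> \<le> M \<longrightarrow> \<bar>y\<bar> \<le> M \<longrightarrow> \<bar>g x - g y\<bar> \<le> K * \<bar>x - y :: real\<bar>"
    and g: "continuous_on UNIV g"
    and sol: "radial_solution TYPE('n) 1 g R u" "radial_solution TYPE('n) 1 g S v" "u 0 = v 0"
  shows "S = R \<and> (\<forall>r\<in>upto_R R. v r = u r)"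
proof -
  have main: "S \<le> R" "\<forall>r\<in>ival 0 S. u r = v r"
    if sol: "radial_solution TYPE('n) 1 g R u" "radial_solution TYPE('n) 1 g S v" "u 0 = v 0" and "R \<le> S \<or> S \<le> R"
    for R S u v
  proof -
    obtain w z E where R: "0 < R" and p: "profile g (ival 0 R) u w z E" "w 0 = 0"
      and blow: "R \<noteq> \<infinity> \<Longrightarrow> filterlim (\<lambda>r. \<bar>u r\<bar> + \<bar>w r\<bar>) at_top (to_R R)"
      using radial_solution_imp_profile[OF N g sol(1)] by blast
    obtain w' z' E' where S: "0 < S" and p': "profile g (ival 0 S) v w' z' E'" "w' 0 = 0"
      using radial_solution_imp_profile[OF N g sol(2)] by blast
    have eq: "u r = v r" if "r \<in> ival 0 R" "r \<in> ival 0 S" for r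
      by (rule profile_unique[OF lip g p p' sol(3) that])
    have u: "\<And>r. r \<in> ival 0 R \<Longrightarrow> (u has_real_derivative w r) (at r within ival 0 R)"
      using p unfolding profile_def by blast
    have v: "\<And>r. r \<in> ival 0 S \<Longrightarrow> (v has_real_derivative w' r) (at r within ival 0 S)"
      and wc': "continuous_on (ival 0 S) w'"
      using p' unfolding profile_def by blast+
    show le: "S \<le> R"
    proof (rule ccontr)
      assume "\<not> S \<le> R"
      then have RS: "R < S" by simp
      then obtain \<rho> where \<rho>: "R = ereal \<rho>" "\<rho> > 0" using R by (cases R) auto
      then have "\<rho> \<in> ival 0 S" using RS by (simp add: ival_iff)
      note sub = ival_subset[OF this]
      have cont: "continuous_on {0..\<rho>} (\<lambda>r. \<bar>v r\<bar> + \<bar>w' r\<bar>)"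
        by (intro continuous_intros continuous_on_subset[OF DERIV_continuous_on[OF v] sub] continuous_on_subset[OF wc' sub])
      obtain m where m: "\<And>r. r \<in> {0..\<rho>} \<Longrightarrow> \<bar>v r\<bar> + \<bar>w' r\<bar> \<le> m"
        using continuous_attains_sup[OF _ _ cont] \<rho> by fastforce
      have "filterlim (\<lambda>r. \<bar>u r\<bar> + \<bar>w r\<bar>) at_top (to_R R)" using blow \<rho> by simp
      then have "eventually (\<lambda>r. m + 1 \<le> \<bar>u r\<bar> + \<bar>w r\<bar>) (to_R R)" unfolding filterlim_at_top by blast
      moreover have "eventually (\<lambda>r. 0 < r \<and> ereal r < R) (to_R R)"
        using eventually_to_R[of 0 R] R by (simp add: zero_ereal_def)
      ultimately have ev: "eventually (\<lambda>r. m + 1 \<le> \<bar>u r\<bar> + \<bar>w r\<bar> \<and> 0 < r \<and> ereal r < R) (to_R R)"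
        by eventually_elim simp
      have "to_R R \<noteq> bot" using \<rho> by (simp add: to_R_def)
      then obtain r where r: "m + 1 \<le> \<bar>u r\<bar> + \<bar>w r\<bar>" "0 < r" "ereal r < R"
        using eventually_happens[OF ev] by blast
      have r\<rho>: "r < \<rho>" using r \<rho> by simp
      have iR: "s \<in> ival 0 R" "s \<in> ival 0 S" if "0 < s" "s < \<rho>" for s
        using that \<rho> subsetD[OF sub, of s] by (auto simp: ival_iff)
      \<comment> \<open>The blow-up condition involves derivatives, so these have to be identified
        as well: the two functions coincide on a neighbourhood of \<open>r\<close>.\<close>
      have "(v has_real_derivative w r) (at r)"
      proof (rule has_real_derivative_local_cong[where f = u and T = UNIV and U = "{0<..<\<rho>}"])
        show "(u has_real_derivative w r) (at r)"
          using u[OF iR(1)[OF r(2) r\<rho>]] unfolding at_within_ival_interior[OF r(2,3)] .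
        show "v s = u s" if "s \<in> {0<..<\<rho>}" for s using eq[OF iR(1) iR(2), of s] that by simp
      qed (use r r\<rho> in auto)
      moreover have "(v has_real_derivative w' r) (at r)"
        using v[OF iR(2)[OF r(2) r\<rho>]] at_within_ival_interior[of 0 r S] r RS by (simp add: less_trans)
      ultimately have "w r = w' r" by (rule DERIV_unique)
      moreover have "u r = v r" using eq iR r r\<rho> by blast
      ultimately show False using m[of r] r r\<rho> by simp
    qed
    have "ival 0 S \<subseteq> ival 0 R" using le by (auto simp: ival_iff)
    then show "\<forall>r\<in>ival 0 S. u r = v r" using eq by blast
  qed
  have "S \<le> R" "\<forall>r\<in>ival 0 S. u r = v r" using main[OF sol] linear by blast+
  moreover have "R \<le> S" using main[OF sol(2,1) sol(3)[symmetric]] linear by blast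
  ultimately show ?thesis unfolding upto_R_eq_ival by (metis antisym)
qed

lemma ival_split:
  assumes "a \<le> c" "c \<in> ival c R"
  shows "{a..c} \<union> ival c R = ival a R"
proof -
  have "ereal s < R" if "s \<le> c" for s
    using assms(2) that le_less_trans[of "ereal s" "ereal c" R] by (simp add: ival_iff)
  then show ?thesis using assms by (auto simp: ival_iff)
qed

text \<open>Matching \<open>u\<close> and \<open>w\<close> keeps the glued function C^1, but u'' may
  jump from \<open>z1 c\<close> to \<open>z2 c\<close>. The joint is therefore added to the
  exceptional set, where only the one-sided limits of u'' have to exist.\<close>

lemma profile_glue:
  assumes p1: "profile g {a..c} u1 w1 z1 {}" and p2: "profile g (ival c R) u2 w2 z2 E"
    and ac: "a < c" and cR: "ereal c < R" and E: "E \<subseteq> ival c R - {c}"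
    and eq: "u1 c = u2 c" "w1 c = w2 c"
  shows "profile g (ival a R) (\<lambda>r. if r \<le> c then u1 r else u2 r) (\<lambda>r. if r \<le> c then w1 r else w2 r)
    (\<lambda>r. if r \<le> c then z1 r else z2 r) (insert c E)" (is "profile g ?I ?u ?w ?z ?E")
    and "insert c E \<subseteq> ival a R - {a}"
proof -
  have c: "c \<in> ival c R" using cR by (simp add: ival_iff)
  have I: "{a..c} \<union> ival c R = ?I" by (rule ival_split) (use ac c in auto)
  have Il: "?I \<inter> {..<c} = {a..c} \<inter> {..<c}" and Ir: "?I \<inter> {c<..} = ival c R \<inter> {c<..}"
    unfolding I[symmetric] by (auto simp: ival_iff)
  have fin: "\<And>\<rho>. \<rho> \<in> ival c R \<Longrightarrow> finite (E \<inter> {..\<rho>})"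
    and u1: "\<And>r. r \<in> {a..c} \<Longrightarrow> (u1 has_real_derivative w1 r) (at r within {a..c})"
    and u2: "\<And>r. r \<in> ival c R \<Longrightarrow> (u2 has_real_derivative w2 r) (at r within ival c R)"
    and wc1: "continuous_on {a..c} w1" and wc2: "continuous_on (ival c R) w2"
    and w1: "\<And>r. r \<in> {a..c} \<Longrightarrow> (w1 has_real_derivative z1 r) (at r within {a..c})"
    and w2: "\<And>r. r \<in> ival c R - E \<Longrightarrow> (w2 has_real_derivative z2 r) (at r within ival c R)"
    and zc1: "continuous_on {a..c} z1" and zc2: "continuous_on (ival c R - E) z2"
    and lim2: "\<And>e. e \<in> E \<Longrightarrow> (\<exists>l. (z2 \<longlongrightarrow> l) (at_left e)) \<and> (\<exists>l. (z2 \<longlongrightarrow> l) (at_right e))"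
    and le1: "\<And>r. r \<in> {a..c} \<Longrightarrow> w1 r \<le> - r * g (u1 r)" and le2: "\<And>r. r \<in> ival c R \<Longrightarrow> w2 r \<le> - r * g (u2 r)"
    and eq1: "\<And>r. r \<in> {a..c} \<Longrightarrow> z1 r \<le> - g (u1 r) \<and> (z1 r = - g (u1 r) \<or> 0 < r \<and> w1 r = - r * g (u1 r))"
    and eq2: "\<And>r. r \<in> ival c R - E \<Longrightarrow> z2 r \<le> - g (u2 r) \<and> (z2 r = - g (u2 r) \<or> 0 < r \<and> w2 r = - r * g (u2 r))"
    using p1 p2 unfolding profile_def Diff_empty by blast+
  have "finite (?E \<inter> {..\<rho>})" if "\<rho> \<in> ?I" for \<rho>
  proof (cases "c \<le> \<rho>")
    case True
    then have "finite (insert c (E \<inter> {..\<rho>}))" using fin[of \<rho>] that by (simp add: ival_iff)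
    then show ?thesis by (rule rev_finite_subset) auto
  next
    case False
    then have "?E \<inter> {..\<rho>} = {}" using E by (auto simp: ival_iff)
    then show ?thesis by simp
  qed
  moreover have "(?u has_real_derivative ?w r) (at r within ?I)" if "r \<in> ?I" for r
  proof -
    have "ival c R \<subseteq> {c..}" by (auto simp: ival_iff)
    then show ?thesis
      using has_vector_derivative_If_le[of a c u1 w1 "ival c R" u2 w2 r] u1 u2 eq ac c that
      unfolding has_real_derivative_iff_has_vector_derivative I by auto
  qed
  moreover have "continuous_on ?I ?w"
  proof (rule continuous_on_cases_le[where h = "\<lambda>r. r"])
    have "{t \<in> ?I. t \<le> c} = {a..c}" "{t \<in> ?I. c \<le> t} = ival c R" unfolding I[symmetric] using ac c by (auto simp: ival_iff)
    then show "continuous_on {t \<in> ?I. t \<le> c} w1" "continuous_on {t \<in> ?I. c \<le> t} w2" using wc1 wc2 by simp_all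
  qed (use eq in auto)
  moreover have "(?w has_real_derivative ?z r) (at r within ?I)" if r: "r \<in> ?I - ?E" for r
  proof (cases "r < c")
    case True
    then have "r \<in> {a..c}" using r by (auto simp: ival_iff)
    have "(?w has_real_derivative z1 r) (at r within ?I)"
      by (rule has_real_derivative_local_cong[OF w1[OF \<open>r \<in> {a..c}\<close>], of "{..<c}"]) (use True r Il in auto)
    then show ?thesis using True by simp
  next
    case False
    then have "c < r" using r by auto
    then have "r \<in> ival c R - E" using r by (auto simp: ival_iff)
    have "(?w has_real_derivative z2 r) (at r within ?I)"
      by (rule has_real_derivative_local_cong[OF w2[OF \<open>r \<in> ival c R - E\<close>], of "{c<..}"]) (use \<open>c < r\<close> r Ir in auto)
    then show ?thesis using \<open>c < r\<close> by simp
  qed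
  moreover have "continuous_on (?I - ?E) ?z"
  proof -
    define A where "A = (?I - ?E) \<inter> {..<c}"
    define B where "B = (?I - ?E) \<inter> {c<..}"
    have AB: "?I - ?E = A \<union> B" unfolding A_def B_def by auto
    have "continuous_on (A \<union> B) ?z"
    proof (rule continuous_on_Un_local_open)
      show "openin (top_of_set (A \<union> B)) A" "openin (top_of_set (A \<union> B)) B"
        unfolding AB[symmetric] unfolding A_def B_def by (auto intro: openin_open_Int)
      have "A \<subseteq> {a..c}" "B \<subseteq> ival c R - E" unfolding A_def B_def by (auto simp: ival_iff)
      then have "continuous_on A z1" "continuous_on B z2"
        using continuous_on_subset[OF zc1] continuous_on_subset[OF zc2] by auto
      moreover have "continuous_on A ?z \<longleftrightarrow> continuous_on A z1" "continuous_on B ?z \<longleftrightarrow> continuous_on B z2"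
        by (auto intro!: continuous_on_cong simp: A_def B_def)
      ultimately show "continuous_on A ?z" "continuous_on B ?z" by simp_all
    qed
    then show ?thesis unfolding AB .
  qed
  moreover have "(\<exists>l. (?z \<longlongrightarrow> l) (at_left e)) \<and> (\<exists>l. (?z \<longlongrightarrow> l) (at_right e))" if e: "e \<in> ?E" for e
  proof (cases "e = c")
    case True
    have "(z1 \<longlongrightarrow> z1 c) (at_left c)"
      using zc1 ac unfolding continuous_on_def at_within_Icc_at_left[OF ac, symmetric] by simp
    moreover have "eventually (\<lambda>r. z1 r = ?z r) (at_left c)"
      by (rule eventually_at_leftI[of "c - 1"]) auto
    ultimately have l: "(?z \<longlongrightarrow> z1 c) (at_left c)" by (rule Lim_transform_eventually)
    obtain s where s: "s > c" "s \<in> ival c R" using ival_exceeds[OF c] .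
    \<comment> \<open>Exceptional radii of the second piece do not accumulate at \<open>c\<close>,
      so continuity of \<open>z2\<close> off \<open>E\<close> gives the limit from the
      right.\<close>
    have "at c within (ival c R - E) = at c within {c<..}"
    proof (rule at_within_nhd)
      show "open ({..<s} - (E \<inter> {..s}))" using fin[OF s(2)] by (intro open_Diff open_lessThan finite_imp_closed)
      show "c \<in> {..<s} - (E \<inter> {..s})" using s E by auto
      show "(ival c R - E) \<inter> ({..<s} - (E \<inter> {..s})) - {c} = {c<..} \<inter> ({..<s} - (E \<inter> {..s})) - {c}"
        using ival_subset[OF s(2)] by (auto simp: ival_iff)
    qed
    moreover have "(z2 \<longlongrightarrow> z2 c) (at c within (ival c R - E))"
      using zc2 c E unfolding continuous_on_def by blast
    ultimately have "(z2 \<longlongrightarrow> z2 c) (at_right c)" by simp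
    moreover have "eventually (\<lambda>r. z2 r = ?z r) (at_right c)"
      by (rule eventually_at_rightI[of c "c + 1"]) auto
    ultimately have r: "(?z \<longlongrightarrow> z2 c) (at_right c)" by (rule Lim_transform_eventually)
    show ?thesis using l r True by blast
  next
    case False
    then have eE: "e \<in> E" "c < e" using e E by (auto simp: ival_iff)
    obtain l1 l2 where "(z2 \<longlongrightarrow> l1) (at_left e)" "(z2 \<longlongrightarrow> l2) (at_right e)" using lim2[OF eE(1)] by blast
    moreover have "eventually (\<lambda>r. z2 r = ?z r) (at_left e)"
      by (rule eventually_at_leftI[of c]) (use eE in auto)
    moreover have "eventually (\<lambda>r. z2 r = ?z r) (at_right e)"
      by (rule eventually_at_rightI[of e "e + 1"]) (use eE in auto)
    ultimately show ?thesis by (blast intro: Lim_transform_eventually)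
  qed
  moreover have "?w r \<le> - r * g (?u r)" if "r \<in> ?I" for r
    using le1[of r] le2[of r] that by (auto simp: ival_iff)
  moreover have "?z r \<le> - g (?u r) \<and> (?z r = - g (?u r) \<or> 0 < r \<and> ?w r = - r * g (?u r))" if "r \<in> ?I - ?E" for r
    using eq1[of r] eq2[of r] that by (auto simp: ival_iff)
  ultimately show "profile g ?I ?u ?w ?z ?E" unfolding profile_def by blast
  show "insert c E \<subseteq> ival a R - {a}" using E ac cR by (auto simp: ival_iff)
qed

text \<open>The constraint is active throughout, so the equation holds as soon as u'' \<le> - g(u).
  Differentiating u' = - r g(u) gives the excess r^2 g(u) g'(u), and its sign is the hypothesis
  \<open>sign\<close>.\<close>

lemma profile_first_order:
  assumes g: "\<And>s. (g has_real_derivative g' s) (at s)" "continuous_on UNIV g'"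
    and u: "\<And>r. r \<in> I \<Longrightarrow> (u has_real_derivative - r * g (u r)) (at r within I)"
    and I: "\<And>r. r \<in> I \<Longrightarrow> 0 \<le> r" and sign: "\<And>r. r \<in> I \<Longrightarrow> g (u r) * g' (u r) \<le> 0"
  shows "profile g I u (\<lambda>r. - r * g (u r)) (\<lambda>r. - g (u r) + r\<^sup>2 * (g (u r) * g' (u r))) {}"
proof -
  have gc: "continuous_on UNIV g" by (rule DERIV_continuous_on[OF g(1)])
  have uc: "continuous_on I u" by (rule DERIV_continuous_on[OF u])
  have "((\<lambda>r. - r * g (u r)) has_real_derivative - g (u r) + r\<^sup>2 * (g (u r) * g' (u r))) (at r within I)"
    if "r \<in> I" for r
    using DERIV_chain2[OF g(1) u[OF that]]
    by (auto intro!: derivative_eq_intros simp: power2_eq_square)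
  moreover have "continuous_on I (\<lambda>r. - r * g (u r))" "continuous_on I (\<lambda>r. - g (u r) + r\<^sup>2 * (g (u r) * g' (u r)))"
    by (intro continuous_intros continuous_on_compose2[OF gc uc] continuous_on_compose2[OF g(2) uc]; auto)+
  moreover have "r\<^sup>2 * (g (u r) * g' (u r)) \<le> 0" if "r \<in> I" for r
    using sign[OF that] by (simp add: mult_nonneg_nonpos)
  moreover have "r = 0 \<or> 0 < r" if "r \<in> I" for r using I[OF that] by auto
  ultimately show ?thesis unfolding profile_def using u by fastforce
qed

lemma profile_second_order:
  assumes g: "continuous_on UNIV g"
    and u: "\<And>r. r \<in> I \<Longrightarrow> (u has_real_derivative w r) (at r within I)"
    and w: "\<And>r. r \<in> I \<Longrightarrow> (w has_real_derivative - g (u r)) (at r within I)"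
    and le: "\<And>r. r \<in> I \<Longrightarrow> w r \<le> - r * g (u r)"
  shows "profile g I u w (\<lambda>r. - g (u r)) {}"
proof -
  have "continuous_on I u" "continuous_on I w" using DERIV_continuous_on[OF u] DERIV_continuous_on[OF w] by auto
  then have "continuous_on I (\<lambda>r. - g (u r))" "continuous_on I w"
    by (auto intro!: continuous_intros continuous_on_compose2[OF g])
  then show ?thesis unfolding profile_def using u w le by auto
qed

section \<open>Maximal solutions of the two phase equations\<close>

lemma first_order_solution:
  assumes lip: "\<And>M. \<exists>K\<ge>0. \<forall>x y. \<bar>x\<bar> \<le> M \<longrightarrow> \<bar>y\<bar> \<le> M \<longrightarrow> \<bar>g x - g y\<bar> \<le> K * \<bar>x - y :: real\<bar>"
  obtains R u where "ereal a < R" "u a = p"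
    "\<And>r. r \<in> ival a R \<Longrightarrow> (u has_real_derivative - r * g (u r)) (at r within ival a R)"
    "R \<noteq> \<infinity> \<Longrightarrow> filterlim (\<lambda>r. \<bar>u r\<bar>) at_top (to_R R)"
proof -
  have "\<exists>K. \<forall>s t x y. \<bar>s\<bar> \<le> M \<longrightarrow> \<bar>t\<bar> \<le> M \<longrightarrow> norm x \<le> M \<longrightarrow> norm y \<le> M \<longrightarrow>
    norm (- s * g x - - t * g y) \<le> K * \<bar>s - t\<bar> + K * norm (x - y)" for M
  proof -
    obtain K where K: "K \<ge> 0" "\<And>x y. \<bar>x\<bar> \<le> M \<Longrightarrow> \<bar>y\<bar> \<le> M \<Longrightarrow> \<bar>g x - g y\<bar> \<le> K * \<bar>x - y\<bar>"
      using lip[of M] by blast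
    define C where "C = \<bar>g 0\<bar> + K * \<bar>M\<bar> + \<bar>M\<bar> * K"
    have "norm (- s * g x - - t * g y) \<le> C * \<bar>s - t\<bar> + C * norm (x - y)"
      if h: "\<bar>s\<bar> \<le> M" "\<bar>t\<bar> \<le> M" "norm x \<le> M" "norm y \<le> M" for s t x y
    proof -
      have M: "M \<ge> 0" using h(1) by linarith
      have "\<bar>g x - g 0\<bar> \<le> K * \<bar>x - 0\<bar>" using h M by (intro K) auto
      also have "\<dots> \<le> K * \<bar>M\<bar>" using h K by (intro mult_left_mono) auto
      finally have gx: "\<bar>g x\<bar> \<le> C" unfolding C_def using K by (simp add: add_increasing2)
      have "- s * g x - - t * g y = (t - s) * g x + t * (g y - g x)" by (simp add: algebra_simps)
      also have "norm \<dots> \<le> \<bar>s - t\<bar> * \<bar>g x\<bar> + \<bar>t\<bar> * \<bar>g y - g x\<bar>"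
        by (rule order.trans[OF norm_triangle_ineq]) (simp add: abs_mult abs_minus_commute)
      also have "\<dots> \<le> \<bar>s - t\<bar> * C + M * (K * \<bar>y - x\<bar>)"
        using h M by (intro add_mono mult_mono gx K) auto
      also have "M * (K * \<bar>y - x\<bar>) \<le> C * norm (x - y)"
        unfolding C_def using K M by (simp add: abs_minus_commute algebra_simps)
      finally show ?thesis by (simp add: mult.commute)
    qed
    then show ?thesis by blast
  qed
  then obtain R u where "ereal a < R" "u a = p"
    "\<And>t. t \<in> ival a R \<Longrightarrow> (u has_vector_derivative - t * g (u t)) (at t within ival a R)"
    "R \<noteq> \<infinity> \<Longrightarrow> filterlim (\<lambda>t. norm (u t)) at_top (to_R R)"
    using maximal_ode_solution_nonautonomous[of "\<lambda>r u. - r * g u" a p] by blast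
  then show thesis using that by (simp add: has_real_derivative_iff_has_vector_derivative)
qed

lemma second_order_solution:
  assumes lip: "\<And>M. \<exists>K\<ge>0. \<forall>x y. \<bar>x\<bar> \<le> M \<longrightarrow> \<bar>y\<bar> \<le> M \<longrightarrow> \<bar>g x - g y\<bar> \<le> K * \<bar>x - y :: real\<bar>"
  obtains R u w where "ereal a < R" "u a = p" "w a = q"
    "\<And>r. r \<in> ival a R \<Longrightarrow> (u has_real_derivative w r) (at r within ival a R)"
    "\<And>r. r \<in> ival a R \<Longrightarrow> (w has_real_derivative - g (u r)) (at r within ival a R)"
    "R \<noteq> \<infinity> \<Longrightarrow> filterlim (\<lambda>r. \<bar>u r\<bar> + \<bar>w r\<bar>) at_top (to_R R)"
proof -
  define f where "f = (\<lambda>(r::real) (y :: real \<times> real). (snd y, - g (fst y)))"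
  have "\<exists>K. \<forall>s t x y. \<bar>s\<bar> \<le> M \<longrightarrow> \<bar>t\<bar> \<le> M \<longrightarrow> norm x \<le> M \<longrightarrow> norm y \<le> M \<longrightarrow>
    norm (f s x - f t y) \<le> K * \<bar>s - t\<bar> + K * norm (x - y)" for M
  proof -
    obtain K where K: "K \<ge> 0" "\<And>x y. \<bar>x\<bar> \<le> M \<Longrightarrow> \<bar>y\<bar> \<le> M \<Longrightarrow> \<bar>g x - g y\<bar> \<le> K * \<bar>x - y\<bar>"
      using lip[of M] by blast
    have "norm (f s x - f t y) \<le> (1 + K) * \<bar>s - t\<bar> + (1 + K) * norm (x - y)"
      if h: "norm x \<le> M" "norm y \<le> M" for s t x y
    proof -
      have d: "\<bar>fst x - fst y\<bar> \<le> norm (x - y)" "\<bar>snd x - snd y\<bar> \<le> norm (x - y)"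
        using norm_fst_le[of "fst x - fst y" "snd x - snd y"] norm_snd_le[of "snd x - snd y" "fst x - fst y"]
        unfolding fst_diff[symmetric] snd_diff[symmetric] prod.collapse by auto
      have n: "\<bar>fst x\<bar> \<le> M" "\<bar>fst y\<bar> \<le> M"
        using norm_fst_le[of "fst x" "snd x"] norm_fst_le[of "fst y" "snd y"] h by auto
      have "norm (f s x - f t y) \<le> \<bar>snd x - snd y\<bar> + \<bar>g (fst x) - g (fst y)\<bar>"
        unfolding f_def using norm_Pair_le[of "snd x - snd y" "g (fst y) - g (fst x)"] by (simp add: abs_minus_commute)
      also have "\<dots> \<le> norm (x - y) + K * norm (x - y)"
        using K(2)[OF n] d mult_left_mono[OF d(1) K(1)] by linarith
      also have "\<dots> \<le> (1 + K) * \<bar>s - t\<bar> + (1 + K) * norm (x - y)" using K by (simp add: algebra_simps)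
      finally show ?thesis .
    qed
    then show ?thesis by blast
  qed
  then obtain R y where R: "ereal a < R" "y a = (p, q)"
    and y: "\<And>t. t \<in> ival a R \<Longrightarrow> (y has_vector_derivative f t (y t)) (at t within ival a R)"
    and blow: "R \<noteq> \<infinity> \<Longrightarrow> filterlim (\<lambda>t. norm (y t)) at_top (to_R R)"
    using maximal_ode_solution_nonautonomous[of f a "(p, q)"] by blast
  show thesis
  proof (rule that[of R "\<lambda>t. fst (y t)" "\<lambda>t. snd (y t)"])
    fix r assume r: "r \<in> ival a R"
    show "((\<lambda>t. fst (y t)) has_real_derivative snd (y r)) (at r within ival a R)"
      "((\<lambda>t. snd (y t)) has_real_derivative - g (fst (y r))) (at r within ival a R)"
      using bounded_linear.has_vector_derivative[OF bounded_linear_fst y[OF r]]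
        bounded_linear.has_vector_derivative[OF bounded_linear_snd y[OF r]]
      by (simp_all add: f_def has_real_derivative_iff_has_vector_derivative)
  next
    assume "R \<noteq> \<infinity>"
    from blow[OF this] show "filterlim (\<lambda>r. \<bar>fst (y r)\<bar> + \<bar>snd (y r)\<bar>) at_top (to_R R)"
    proof (rule filterlim_at_top_mono, intro always_eventually allI)
      show "norm (y r) \<le> \<bar>fst (y r)\<bar> + \<bar>snd (y r)\<bar>" for r
        using norm_Pair_le[of "fst (y r)" "snd (y r)"] by simp
    qed
  qed (use R in auto)
qed

section \<open>First-order phases\<close>

text \<open>The case distinction that drives the analysis of second-order phases: a strict
  inequality either persists to the end of the domain, which a growth argument then excludes or
  exploits, or it fails at a first radius, where the next piece of the argument begins.\<close>

lemma first_zero: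
  fixes h :: "real \<Rightarrow> real"
  assumes h: "continuous_on (ival a R) h" and c: "c \<in> ival a R" "h c < 0"
  shows "(\<forall>r\<in>ival c R. h r < 0) \<or> (\<exists>b>c. b \<in> ival a R \<and> h b = 0 \<and> (\<forall>r\<in>{c..<b}. h r < 0))"
proof (cases "\<forall>r\<in>ival c R. h r < 0")
  case False
  then obtain r where r: "c \<le> r" "ereal r < R" "0 \<le> h r" by (auto simp: ival_iff)
  then have "r \<in> ival a R" using c by (simp add: ival_iff)
  from ival_subset[OF this] have sub: "{c..r} \<subseteq> ival a R" using c by (auto simp: ival_iff)
  have hc: "continuous_on {c..r} h" by (rule continuous_on_subset[OF h sub])
  define Z where "Z = {s \<in> {c..r}. 0 \<le> h s}"
  have "closed Z"
    unfolding Z_def using continuous_closed_preimage[OF hc closed_atLeastAtMost closed_atLeast[of 0]]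
    by (auto simp: vimage_def Int_def)
  then have "compact Z" unfolding Z_def by (auto simp: compact_eq_bounded_closed intro: bounded_subset[of "{c..r}"])
  moreover have "r \<in> Z" using r unfolding Z_def by simp
  ultimately obtain b where b: "b \<in> Z" "\<And>s. s \<in> Z \<Longrightarrow> b \<le> s" using compact_attains_inf[of Z] by blast
  have bc: "c < b" "b \<le> r" "0 \<le> h b" using b(1) c(2) unfolding Z_def by (auto simp: less_le)
  have neg: "h s < 0" if "s \<in> {c..<b}" for s using b(2)[of s] that bc unfolding Z_def by force
  obtain x where x: "c \<le> x" "x \<le> b" "h x = 0"
    using IVT'[of h c 0 b] c(2) bc continuous_on_subset[OF hc, of "{c..b}"] by auto
  then have "x = b" using neg[of x] by force
  moreover have "b \<in> ival a R" using sub bc by auto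
  ultimately show ?thesis using x(3) bc(1) neg by blast
qed simp

text \<open>With the integrating factor exp(C r) the function becomes nondecreasing. Applied to the
  squared distance from an equilibrium, this says that the equilibrium is not reached at a finite
  radius.\<close>

lemma positive_if_deriv_ge_linear:
  fixes q :: "real \<Rightarrow> real"
  assumes q: "\<And>r. r \<in> {a..t} \<Longrightarrow> (q has_real_derivative q' r) (at r within {a..t})"
    and le: "\<And>r. r \<in> {a..t} \<Longrightarrow> - C * q r \<le> q' r" and "0 < q a" "a \<le> t"
  shows "0 < q t"
proof -
  have "q a * exp (C * a) \<le> q t * exp (C * t)"
  proof (rule le_if_deriv_nonneg_off_finite[OF \<open>a \<le> t\<close>, of "{}" "\<lambda>r. q r * exp (C * r)" "\<lambda>r. (q' r + C * q r) * exp (C * r)"])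
    show "continuous_on {a..t} (\<lambda>r. q r * exp (C * r))"
      by (intro continuous_intros DERIV_continuous_on[OF q])
    fix r assume r: "a < r" "r < t"
    then have "(q has_real_derivative q' r) (at r)" using q[of r] at_within_Icc_at[of a r t] by simp
    then have "((\<lambda>r. q r * exp (C * r)) has_real_derivative (q' r + C * q r) * exp (C * r)) (at r)"
      by (auto intro!: derivative_eq_intros simp: algebra_simps)
    then show "((\<lambda>r. q r * exp (C * r)) has_real_derivative (q' r + C * q r) * exp (C * r)) (at r) \<and> 0 \<le> (q' r + C * q r) * exp (C * r)"
      using le[of r] r by simp
  qed simp
  moreover have "0 < q a * exp (C * a)" using assms by simp
  ultimately show ?thesis by (metis exp_gt_zero less_le_trans zero_less_mult_pos2)
qed

lemma strict_increasing_on_ival: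
  assumes u: "\<And>r. r \<in> ival a R \<Longrightarrow> (u has_real_derivative w r) (at r within ival a R)"
    and st: "a \<le> s" "s < t" "ereal t < R" and pos: "\<And>r. s < r \<Longrightarrow> r < t \<Longrightarrow> 0 < w r"
  shows "u s < (u t :: real)"
proof (rule DERIV_pos_imp_increasing_open[OF st(2)])
  have t: "t \<in> ival a R" using st by (simp add: ival_iff)
  show "continuous_on {s..t} u"
    by (rule continuous_on_subset[OF DERIV_continuous_on[OF u]]) (use ival_subset[OF t] st in auto)
  fix r assume r: "s < r" "r < t"
  have "r \<in> ival a R" by (rule ival_downward[OF t]) (use r st in auto)
  then have "(u has_real_derivative w r) (at r)"
    using u[of r] at_within_ival_interior[of a r R] r st by (simp add: ival_iff)
  then show "\<exists>y. (u has_real_derivative y) (at r) \<and> 0 < y" using pos[OF r] by blast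
qed

lemma strict_decreasing_on_ival:
  assumes u: "\<And>r. r \<in> ival a R \<Longrightarrow> (u has_real_derivative w r) (at r within ival a R)"
    and st: "a \<le> s" "s < t" "ereal t < R" and neg: "\<And>r. s < r \<Longrightarrow> r < t \<Longrightarrow> w r < 0"
  shows "u t < (u s :: real)"
proof -
  have "- u s < - u t"
    by (rule strict_increasing_on_ival[where u = "\<lambda>r. - u r" and w = "\<lambda>r. - w r", OF DERIV_minus[OF u]]) (use st neg in auto)
  then show ?thesis by simp
qed

section \<open>Growth, boundedness and limits at the end of the interval\<close>

lemma at_least_linear_growth:
  fixes u :: "real \<Rightarrow> real"
  assumes u: "\<And>r. r \<in> {a..} \<Longrightarrow> (u has_real_derivative w r) (at r within {a..})"
    and c: "a \<le> c" and d: "0 < d" "\<And>r. c < r \<Longrightarrow> d \<le> w r"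
  shows "filterlim u at_top at_top"
proof (rule filterlim_at_top_mono)
  show "filterlim (\<lambda>r. u c + d * (r - c)) at_top at_top"
    unfolding filterlim_at_top
  proof
    fix Z
    show "eventually (\<lambda>r. Z \<le> u c + d * (r - c)) at_top"
      by (rule eventually_mono[OF eventually_ge_at_top[of "c + (Z - u c) / d"]]) (use d(1) in \<open>simp add: field_simps\<close>)
  qed
  show "eventually (\<lambda>r. u c + d * (r - c) \<le> u r) at_top"
  proof (rule eventually_mono[OF eventually_gt_at_top[of c]])
    fix r assume r: "c < r"
    have "u c - d * c \<le> u r - d * r"
    proof (rule le_if_deriv_nonneg_off_finite[of c r "{}" "\<lambda>r. u r - d * r" "\<lambda>r. w r - d"])
      show "continuous_on {c..r} (\<lambda>r. u r - d * r)"
        by (intro continuous_intros continuous_on_subset[OF DERIV_continuous_on[OF u]]) (use c in auto)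
      fix x assume x: "c < x" "x < r"
      then have "(u has_real_derivative w x) (at x)"
        using u[of x] at_within_ival_interior[of a x \<infinity>] c by simp
      then show "((\<lambda>r. u r - d * r) has_real_derivative w x - d) (at x) \<and> 0 \<le> w x - d"
        using d(2)[of x] x by (auto intro!: derivative_eq_intros)
    qed (use r in auto)
    then show "u c + d * (r - c) \<le> u r" by (simp add: algebra_simps)
  qed
qed

lemma at_most_linear_decay:
  fixes u :: "real \<Rightarrow> real"
  assumes u: "\<And>r. r \<in> {a..} \<Longrightarrow> (u has_real_derivative w r) (at r within {a..})"
    and c: "a \<le> c" and d: "0 < d" "\<And>r. c < r \<Longrightarrow> w r \<le> - d"
  shows "filterlim u at_bot at_top"
proof -
  have "filterlim (\<lambda>r. - u r) at_top at_top"
    by (rule at_least_linear_growth[where a = a and c = c and d = d and w = "\<lambda>r. - w r"])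
      (use DERIV_minus[OF u] c d in force)+
  then show ?thesis by (simp add: filterlim_uminus_at_bot)
qed

lemma to_R_neq_bot: "to_R R \<noteq> bot"
  by (simp add: to_R_def)

lemma no_blow_up_if_bounded:
  assumes a: "ereal a < R" and bd: "\<And>r. r \<in> ival a R \<Longrightarrow> h r \<le> (M::real)"
    and blow: "R \<noteq> \<infinity> \<Longrightarrow> filterlim h at_top (to_R R)"
  shows "R = \<infinity>"
proof (rule ccontr)
  assume "R \<noteq> \<infinity>"
  then have "eventually (\<lambda>r. M + 1 \<le> h r) (to_R R)" using blow unfolding filterlim_at_top by blast
  then have "eventually (\<lambda>r. M + 1 \<le> h r \<and> a < r \<and> ereal r < R) (to_R R)"
    using eventually_to_R[OF a] by eventually_elim simp
  then obtain r where "M + 1 \<le> h r" "a < r" "ereal r < R"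
    using eventually_happens to_R_neq_bot by blast
  then show False using bd[of r] by (simp add: ival_iff)
qed

lemma not_filterlim_at_top_if_bounded:
  fixes u :: "real \<Rightarrow> real"
  assumes "filterlim u at_top at_top" "\<And>r. c \<le> r \<Longrightarrow> u r \<le> (M::real)"
  shows False
proof -
  have "eventually (\<lambda>r. M + 1 \<le> u r) at_top" using assms(1) unfolding filterlim_at_top by blast
  then have "eventually (\<lambda>r. M + 1 \<le> u r \<and> c \<le> r) (at_top :: real filter)"
    using eventually_ge_at_top[of c] by eventually_elim simp
  then obtain r where "M + 1 \<le> u r" "c \<le> r" using eventually_happens trivial_limit_at_top_linorder by blast
  then show False using assms(2)[of r] by simp
qed

lemma not_filterlim_at_bot_if_bounded:
  fixes u :: "real \<Rightarrow> real"
  assumes "filterlim u at_bot at_top" "\<And>r. c \<le> r \<Longrightarrow> (M::real) \<le> u r"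
  shows False
  using not_filterlim_at_top_if_bounded[of "\<lambda>r. - u r" c "- M"] assms by (simp add: filterlim_uminus_at_bot)

lemma tendsto_at_top_if_increasing:
  fixes u :: "real \<Rightarrow> real"
  assumes mono: "\<And>s t. c \<le> s \<Longrightarrow> s < t \<Longrightarrow> u s \<le> u t" and less: "\<And>r. c \<le> r \<Longrightarrow> u r < l"
    and approx: "\<And>e. 0 < e \<Longrightarrow> \<exists>r\<ge>c. l - e < u r"
  shows "(u \<longlongrightarrow> l) at_top"
proof (rule order_tendstoI)
  fix x assume "x < l"
  then obtain r where r: "c \<le> r" "x < u r" using approx[of "l - x"] by auto
  show "eventually (\<lambda>s. x < u s) at_top"
    by (rule eventually_mono[OF eventually_gt_at_top[of r]]) (use r mono less_le_trans in blast)
next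
  fix x assume "l < x"
  then show "eventually (\<lambda>s. u s < x) at_top"
    by (intro eventually_mono[OF eventually_ge_at_top[of c]]) (use less less_trans in blast)
qed

lemma tendsto_at_top_if_decreasing:
  fixes u :: "real \<Rightarrow> real"
  assumes "\<And>s t. c \<le> s \<Longrightarrow> s < t \<Longrightarrow> u t \<le> u s" "\<And>r. c \<le> r \<Longrightarrow> l < u r"
    and "\<And>e. 0 < e \<Longrightarrow> \<exists>r\<ge>c. u r < l + e"
  shows "(u \<longlongrightarrow> l) at_top"
proof -
  have "((\<lambda>r. - u r) \<longlongrightarrow> - l) at_top"
  proof (rule tendsto_at_top_if_increasing[where c = c])
    fix e :: real assume "0 < e"
    then obtain r where "c \<le> r" "u r < l + e" using assms(3) by blast
    then show "\<exists>r\<ge>c. - l - e < - u r" by (intro exI[of _ r]) simp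
  qed (use assms in auto)
  then show ?thesis by (simp add: tendsto_minus_cancel_left)
qed

section \<open>Signs, symmetry and primitive of a bistable nonlinearity\<close>

locale bistable_nonlinearity =
  fixes \<alpha> \<beta> :: real and g :: "real \<Rightarrow> real"
  assumes bistable: "bistable \<alpha> \<beta> g"
begin

lemma \<beta>_pos: "0 < \<beta>" and \<beta>_less: "\<beta> < \<alpha>" and odd: "g (- s) = - g s"
  and g_deriv: "(g has_real_derivative deriv g s) (at s)" and deriv_g_cont: "continuous_on UNIV (deriv g)"
  and g_pos: "0 < s \<Longrightarrow> s < \<alpha> \<Longrightarrow> 0 < g s"
  using bistable DERIV_deriv_iff_real_differentiable unfolding bistable_def by blast+

lemma g_cont: "continuous_on A g"
  by (rule continuous_on_subset[OF DERIV_continuous_on[OF g_deriv]]) auto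

lemma g_neg: "- \<alpha> < s \<Longrightarrow> s < 0 \<Longrightarrow> g s < 0"
  using g_pos[of "- s"] odd[of s] by simp

lemma g_neg_above: "\<alpha> < s \<Longrightarrow> g s < 0"
  using bistable unfolding bistable_def by blast

lemma g_pos_below: "s < - \<alpha> \<Longrightarrow> 0 < g s"
  using g_neg_above[of "- s"] odd[of s] by simp

lemma g_0: "g 0 = 0"
  using odd[of 0] by simp

lemma g_\<alpha>: "g \<alpha> = 0"
proof (rule antisym)
  show "g \<alpha> \<le> 0"
    by (rule continuous_le_on_closure[of "{\<alpha><..}"]) (use g_cont g_neg_above in \<open>auto intro: less_imp_le\<close>)
  show "0 \<le> g \<alpha>"
    by (rule continuous_ge_on_closure[of "{0<..<\<alpha>}"]) (use g_cont g_pos \<beta>_pos \<beta>_less in \<open>auto intro: less_imp_le\<close>)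
qed

lemma g_minus_\<alpha>: "g (- \<alpha>) = 0"
  using odd[of \<alpha>] g_\<alpha> by simp

lemma deriv_g_even: "deriv g (- s) = deriv g s"
proof -
  have "((\<lambda>s. g (- s)) has_real_derivative deriv g (- s) * - 1) (at s)"
    by (rule DERIV_chain2[OF g_deriv DERIV_minus[OF DERIV_ident]])
  from DERIV_minus[OF this] have "(g has_real_derivative deriv g (- s)) (at s)" by (simp add: odd)
  then show ?thesis using g_deriv by (rule DERIV_unique)
qed

lemma deriv_g_abs: "deriv g \<bar>s\<bar> = deriv g s"
  using deriv_g_even[of s] by (simp add: abs_if)

lemma deriv_g_pos: "\<bar>s\<bar> < \<beta> \<Longrightarrow> 0 < deriv g s"
  using bistable abs_ge_zero[of s] unfolding bistable_def deriv_g_abs[of s, symmetric] by blast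

lemma deriv_g_neg: "\<beta> < \<bar>s\<bar> \<Longrightarrow> deriv g s < 0"
  using bistable unfolding bistable_def deriv_g_abs[of s, symmetric] by blast

lemma deriv_g_\<beta>: "deriv g \<beta> = 0"
proof (rule antisym)
  show "deriv g \<beta> \<le> 0"
    by (rule continuous_le_on_closure[of "{\<beta><..}"])
      (use deriv_g_cont deriv_g_neg \<beta>_pos in \<open>auto intro: less_imp_le continuous_on_subset\<close>)
  show "0 \<le> deriv g \<beta>"
    by (rule continuous_ge_on_closure[of "{0<..<\<beta>}"])
      (use deriv_g_cont deriv_g_pos \<beta>_pos in \<open>auto intro: less_imp_le continuous_on_subset\<close>)
qed

lemma deriv_g_nonneg: "\<bar>s\<bar> \<le> \<beta> \<Longrightarrow> 0 \<le> deriv g s"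
  using deriv_g_pos[of s] deriv_g_\<beta> deriv_g_even[of \<beta>] by (cases "\<bar>s\<bar> = \<beta>") (auto simp: abs_if split: if_splits)

lemma deriv_g_nonpos: "\<beta> \<le> \<bar>s\<bar> \<Longrightarrow> deriv g s \<le> 0"
  using deriv_g_neg[of s] deriv_g_\<beta> deriv_g_even[of \<beta>] by (cases "\<bar>s\<bar> = \<beta>") (auto simp: abs_if split: if_splits)

lemma g_lipschitz: "\<exists>K\<ge>0. \<forall>x y. \<bar>x\<bar> \<le> M \<longrightarrow> \<bar>y\<bar> \<le> M \<longrightarrow> \<bar>g x - g y\<bar> \<le> K * \<bar>x - y\<bar>"
proof -
  have "compact (deriv g ` {-M..M})"
    by (intro compact_continuous_image continuous_on_subset[OF deriv_g_cont]) auto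
  from compact_imp_bounded[OF this] obtain K where K: "\<And>s. s \<in> {-M..M} \<Longrightarrow> norm (deriv g s) \<le> K"
    unfolding bounded_iff by blast
  have "\<bar>g x - g y\<bar> \<le> max 0 K * \<bar>x - y\<bar>" if "\<bar>x\<bar> \<le> M" "\<bar>y\<bar> \<le> M" for x y
  proof -
    have "norm (g x - g y) \<le> K * norm (x - y)"
      by (rule field_differentiable_bound[of "{-M..M}" g "deriv g"])
        (use K that g_deriv in \<open>auto intro: has_field_derivative_at_within\<close>)
    also have "\<dots> \<le> max 0 K * norm (x - y)" by (intro mult_right_mono) auto
    finally show ?thesis by simp
  qed
  then show ?thesis by (intro exI[of _ "max 0 K"]) auto
qed

text \<open>The primitive that vanishes at 0, serving as potential energy; for either sign of the
  argument one of the two intervals is empty or a point.\<close>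

definition G :: "real \<Rightarrow> real" where
  "G s = integral {0..s} g - integral {s..0} g"

lemma G_deriv: "(G has_real_derivative g s) (at s)"
proof -
  \<comment> \<open>A base point to the left of both \<open>s\<close> and 0: near \<open>s\<close>,
    both cases of the definition become one integral from \<open>a\<close>, up to a
    constant.\<close>
  define a where "a = min s 0 - 1"
  have int: "g integrable_on {x..y}" for x y by (rule integrable_continuous_real[OF g_cont])
  have eq: "G x = integral {a..x} g - integral {a..0} g" if "a < x" for x
  proof (cases "0 \<le> x")
    case True
    have "integral {a..0} g + integral {0..x} g = integral {a..x} g"
      by (rule Henstock_Kurzweil_Integration.integral_combine[OF _ True int]) (simp add: a_def)
    moreover have "integral {x..0} g = 0" using True by (cases "x = 0") auto
    ultimately show ?thesis unfolding G_def by simp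
  next
    case False
    have "integral {a..x} g + integral {x..0} g = integral {a..0} g"
      by (rule Henstock_Kurzweil_Integration.integral_combine[OF _ _ int]) (use False that in auto)
    then show ?thesis unfolding G_def using False by simp
  qed
  have "((\<lambda>x. integral {a..x} g) has_real_derivative g s) (at s within {a..s + 1})"
    by (rule integral_has_real_derivative[OF g_cont]) (simp add: a_def)
  then have "((\<lambda>x. integral {a..x} g) has_real_derivative g s) (at s)"
    using at_within_Icc_at[of a s "s + 1"] by (simp add: a_def)
  then have "((\<lambda>x. integral {a..x} g - integral {a..0} g) has_real_derivative g s) (at s)"
    by (auto intro!: derivative_eq_intros)
  then show ?thesis
    by (rule has_field_derivative_transform_within_open[of _ _ _ "{a<..}"]) (use eq in \<open>auto simp: a_def\<close>)
qed

lemma G_cont: "continuous_on A G"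
  by (rule continuous_on_subset[OF DERIV_continuous_on[OF G_deriv]]) auto

lemma G_0: "G 0 = 0"
  by (simp add: G_def)

lemma G_even: "G (- s) = G s"
proof -
  have "((\<lambda>s. G (- s) - G s) has_real_derivative 0) (at s)" for s
    using DERIV_diff[OF DERIV_chain2[OF G_deriv DERIV_minus[OF DERIV_ident]] G_deriv, of s] odd by simp
  then have "G (- s) - G s = G (- 0) - G 0" using DERIV_isconst_all by blast
  then show ?thesis by simp
qed

lemma G_abs: "G \<bar>s\<bar> = G s"
  using G_even[of s] by (simp add: abs_if)

lemma G_increasing: "0 \<le> s \<Longrightarrow> s < t \<Longrightarrow> t \<le> \<alpha> \<Longrightarrow> G s < G t"
  by (rule DERIV_pos_imp_increasing_open[of s t G]) (use G_deriv g_pos G_cont in force)+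

text \<open>By evenness only |s| matters, and the primitive rises up to \<alpha> and falls beyond
  it. So G \<alpha> is the energy needed to pass one of the outer equilibria.\<close>

lemma G_less_max:
  assumes "\<bar>s\<bar> \<noteq> \<alpha>"
  shows "G s < G \<alpha>"
proof (cases "\<bar>s\<bar> < \<alpha>")
  case True
  then show ?thesis using G_increasing[of "\<bar>s\<bar>" \<alpha>] G_abs by simp
next
  case False
  then have "G \<bar>s\<bar> < G \<alpha>"
    using assms by (intro DERIV_neg_imp_decreasing_open[of \<alpha> "\<bar>s\<bar>" G]) (use G_deriv g_neg_above G_cont in force)+
  then show ?thesis using G_abs by simp
qed

lemma G_le_max: "G s \<le> G \<alpha>"
  using G_less_max[of s] G_abs[of s] by (cases "\<bar>s\<bar> = \<alpha>") auto

lemma G_diff: "G \<alpha> - G \<beta> = integral {\<beta>..\<alpha>} g"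
proof -
  have "(g has_integral (G \<alpha> - G \<beta>)) {\<beta>..\<alpha>}"
    using \<beta>_less G_deriv
    by (intro fundamental_theorem_of_calculus)
      (auto simp: has_real_derivative_iff_has_vector_derivative[symmetric] intro: has_field_derivative_at_within)
  then show ?thesis by (simp add: integral_unique)
qed

text \<open>Since \<open>g\<close> vanishes at \<open>p\<close> and is Lipschitz on the range of
  \<open>u\<close>, the squared distance to \<open>p\<close> decays at most exponentially, with rate
  2 t K on radii up to \<open>t\<close>. It stays positive.\<close>

lemma first_order_avoids_equilibrium:
  assumes u: "\<And>r. r \<in> ival a R \<Longrightarrow> (u has_real_derivative - r * g (u r)) (at r within ival a R)"
    and a: "0 \<le> a" and p: "g p = 0" "u a \<noteq> p" and t: "t \<in> ival a R"
  shows "u t \<noteq> p"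
proof -
  have sub: "{a..t} \<subseteq> ival a R" by (rule ival_subset[OF t])
  have at: "a \<le> t" using t by (simp add: ival_iff)
  have "bounded (u ` {a..t})"
    by (intro compact_imp_bounded compact_continuous_image continuous_on_subset[OF DERIV_continuous_on[OF u] sub]) auto
  then obtain M0 where M0: "\<And>r. r \<in> {a..t} \<Longrightarrow> norm (u r) \<le> M0" unfolding bounded_iff by blast
  define M where "M = max M0 \<bar>p\<bar>"
  obtain K where K: "K \<ge> 0" "\<And>x y. \<bar>x\<bar> \<le> M \<Longrightarrow> \<bar>y\<bar> \<le> M \<Longrightarrow> \<bar>g x - g y\<bar> \<le> K * \<bar>x - y\<bar>"
    using g_lipschitz[of M] by blast
  have "0 < (u t - p)\<^sup>2"
  proof (rule positive_if_deriv_ge_linear[of a t "\<lambda>r. (u r - p)\<^sup>2" "\<lambda>r. 2 * (u r - p) * (- r * g (u r))" "2 * t * K"])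
    fix r assume r: "r \<in> {a..t}"
    have "(u has_real_derivative - r * g (u r)) (at r within {a..t})"
      using DERIV_subset[OF u sub] r sub by blast
    then show "((\<lambda>r. (u r - p)\<^sup>2) has_real_derivative 2 * (u r - p) * (- r * g (u r))) (at r within {a..t})"
      by (auto intro!: derivative_eq_intros)
    have "\<bar>g (u r)\<bar> \<le> K * \<bar>u r - p\<bar>" using K(2)[of "u r" p] M0[OF r] p unfolding M_def by auto
    then have le: "r * (\<bar>u r - p\<bar> * \<bar>g (u r)\<bar>) \<le> t * (\<bar>u r - p\<bar> * (K * \<bar>u r - p\<bar>))"
      using r a K by (intro mult_mono mult_left_mono) auto
    have le': "r * ((u r - p) * g (u r)) \<le> r * (\<bar>u r - p\<bar> * \<bar>g (u r)\<bar>)"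
      using r a by (intro mult_left_mono) (auto simp: abs_mult[symmetric])
    have sq: "\<bar>u r - p\<bar> * (K * \<bar>u r - p\<bar>) = K * (u r - p)\<^sup>2"
      by (simp add: power2_eq_square abs_mult_self_eq mult.left_commute)
    have "r * ((u r - p) * g (u r)) \<le> t * (K * (u r - p)\<^sup>2)"
      using order.trans[OF le' le] unfolding sq .
    moreover have "2 * (u r - p) * (- r * g (u r)) = - 2 * (r * ((u r - p) * g (u r)))"
      "- (2 * t * K) * (u r - p)\<^sup>2 = - 2 * (t * (K * (u r - p)\<^sup>2))" by simp_all
    ultimately show "- (2 * t * K) * (u r - p)\<^sup>2 \<le> 2 * (u r - p) * (- r * g (u r))" by linarith
  qed (use p at in auto)
  then show ?thesis by auto
qed

lemma stays_between:
  fixes u :: "real \<Rightarrow> real"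
  assumes u: "continuous_on (ival a R) u" and avoid: "\<And>r. r \<in> ival a R \<Longrightarrow> u r \<noteq> p" and r: "r \<in> ival a R"
  shows "u a < p \<Longrightarrow> u r < p" "p < u a \<Longrightarrow> p < u r"
proof -
  have sub: "{a..r} \<subseteq> ival a R" and ar: "a \<le> r" using ival_subset[OF r] r by (auto simp: ival_iff)
  note c = continuous_on_subset[OF u sub]
  show "u a < p \<Longrightarrow> u r < p" using IVT'[of u a p r] c ar avoid sub by (meson atLeastAtMost_iff not_less subsetD less_imp_le)
  show "p < u a \<Longrightarrow> p < u r" using IVT2'[of u r p a] c ar avoid sub by (meson atLeastAtMost_iff not_less subsetD less_imp_le)
qed

lemma max_neg_on_compact:
  assumes "x \<le> y" "\<And>s. s \<in> {x..y} \<Longrightarrow> g s < 0"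
  obtains d where "0 < d" "\<And>s. s \<in> {x..y} \<Longrightarrow> g s \<le> - d"
proof -
  obtain m where "m \<in> {x..y}" "\<And>s. s \<in> {x..y} \<Longrightarrow> g s \<le> g m"
    using continuous_attains_sup[of "{x..y}" g] g_cont assms(1) by auto
  then show thesis using that[of "- g m"] assms(2) by auto
qed

text \<open>On [-\<beta>, 0) one has g < 0 \<le> g', so the phase is admissible and \<open>u\<close>
  increases, while the equilibrium 0 is a barrier. If \<open>u\<close> stayed below some negative
  level, - g(u) would be bounded below by a positive constant, and u' = - r g(u) would drive
  \<open>u\<close> to infinity.\<close>

lemma first_order_to_zero:
  assumes a: "0 \<le> a" and p: "- \<beta> \<le> p" "p < 0"
  obtains u w z where "profile g {a..} u w z {}" "u a = p" "w a = - a * g p"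
    "\<And>r. a \<le> r \<Longrightarrow> 0 < r \<Longrightarrow> 0 < w r" "(u \<longlongrightarrow> 0) at_top"
proof -
  obtain R u where R: "ereal a < R" and ua: "u a = p"
    and u: "\<And>r. r \<in> ival a R \<Longrightarrow> (u has_real_derivative - r * g (u r)) (at r within ival a R)"
    and blow: "R \<noteq> \<infinity> \<Longrightarrow> filterlim (\<lambda>r. \<bar>u r\<bar>) at_top (to_R R)"
    using first_order_solution[of g a p] g_lipschitz by blast
  have uc: "continuous_on (ival a R) u" by (rule DERIV_continuous_on[OF u])
  have lt0: "u r < 0" if "r \<in> ival a R" for r
    by (rule stays_between(1)[OF uc _ that]) (use first_order_avoids_equilibrium[OF u a g_0] ua p in auto)
  have gt: "- \<alpha> < u r" if "r \<in> ival a R" for r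
    by (rule stays_between(2)[OF uc _ that]) (use first_order_avoids_equilibrium[OF u a g_minus_\<alpha>] ua p \<beta>_less in auto)
  have "R = \<infinity>"
    by (rule no_blow_up_if_bounded[OF R _ blow, of \<alpha>]) (use lt0 gt in \<open>force simp: abs_if\<close>)
  note u = u[unfolded \<open>R = \<infinity>\<close> ival_infinity] and lt0 = lt0[unfolded \<open>R = \<infinity>\<close> ival_infinity]
    and gt = gt[unfolded \<open>R = \<infinity>\<close> ival_infinity]
  have w: "0 < - r * g (u r)" if "a \<le> r" "0 < r" for r
    using g_neg[of "u r"] gt[of r] lt0[of r] that by (simp add: mult_neg_pos mult_pos_neg)
  have inc: "u s < u t" if "a \<le> s" "s < t" for s t
    by (rule strict_increasing_on_ival[of a \<infinity>, unfolded ival_infinity, OF u]) (use that a w in auto)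
  have ge: "p \<le> u r" if "a \<le> r" for r using inc[of a r] ua that by (cases "a = r") auto
  have pr: "profile g {a..} u (\<lambda>r. - r * g (u r)) (\<lambda>r. - g (u r) + r\<^sup>2 * (g (u r) * deriv g (u r))) {}"
  proof (rule profile_first_order[OF g_deriv deriv_g_cont u])
    fix r assume r: "r \<in> {a..}"
    then have "- \<beta> \<le> u r" "u r < 0" using ge[of r] p lt0[of r] by auto
    then show "g (u r) * deriv g (u r) \<le> 0"
      using deriv_g_nonneg[of "u r"] g_neg[of "u r"] \<beta>_less by (simp add: mult_nonpos_nonneg)
  qed (use a in auto)
  have lim: "(u \<longlongrightarrow> 0) at_top"
  proof (rule tendsto_at_top_if_increasing[where c = a])
    fix e :: real assume e: "0 < e"
    show "\<exists>r\<ge>a. 0 - e < u r"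
    proof (rule ccontr)
      assume "\<not> ?thesis"
      then have le: "u r \<le> - e" if "a \<le> r" for r using that by force
      have "p \<le> - e" using le[of a] ua by simp
      then obtain d where d: "0 < d" "\<And>s. s \<in> {p..- e} \<Longrightarrow> g s \<le> - d"
        by (rule max_neg_on_compact) (use g_neg p e \<beta>_less in auto)
      have "filterlim u at_top at_top"
      proof (rule at_least_linear_growth[OF u])
        fix r assume r: "max a 1 < r"
        have "d \<le> - g (u r)" using d(2)[of "u r"] le[of r] ge[of r] r by simp
        also have "\<dots> \<le> r * - g (u r)" using r \<open>0 < d\<close> calculation mult_right_mono[of 1 r "- g (u r)"] by simp
        finally show "d \<le> - r * g (u r)" by simp
      qed (use d in auto)
      then show False by (rule not_filterlim_at_top_if_bounded[of _ a 0]) (use lt0 in \<open>auto intro: less_imp_le\<close>)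
    qed
  qed (use inc lt0 in \<open>auto intro: less_imp_le\<close>)
  show thesis using that[OF pr] ua w lim by simp
qed

text \<open>Below -\<alpha> one has g > 0 \<ge> g', so the phase remains admissible while
  \<open>u\<close> decreases. Whether \<open>R\<close> is finite depends on the growth of
  \<open>g\<close>, so both cases occur in the proof: a finite end brings blow-up of |u| with
  negative sign, an infinite one brings decay at least linear.\<close>

lemma first_order_to_minus_infinity:
  assumes a: "0 \<le> a" and p: "p < - \<alpha>"
  obtains R u w z where "ereal a < R" "profile g (ival a R) u w z {}" "u a = p" "w a = - a * g p"
    "\<And>r. r \<in> ival a R \<Longrightarrow> 0 < r \<Longrightarrow> w r < 0" "filterlim u at_bot (to_R R)"
    "R \<noteq> \<infinity> \<Longrightarrow> filterlim (\<lambda>r. \<bar>u r\<bar> + \<bar>w r\<bar>) at_top (to_R R)"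
proof -
  obtain R u where R: "ereal a < R" and ua: "u a = p"
    and u: "\<And>r. r \<in> ival a R \<Longrightarrow> (u has_real_derivative - r * g (u r)) (at r within ival a R)"
    and blow: "R \<noteq> \<infinity> \<Longrightarrow> filterlim (\<lambda>r. \<bar>u r\<bar>) at_top (to_R R)"
    using first_order_solution[of g a p] g_lipschitz by blast
  have uc: "continuous_on (ival a R) u" by (rule DERIV_continuous_on[OF u])
  have lt: "u r < - \<alpha>" if "r \<in> ival a R" for r
    by (rule stays_between(1)[OF uc _ that]) (use first_order_avoids_equilibrium[OF u a g_minus_\<alpha>] ua p in auto)
  have w: "- r * g (u r) < 0" if "r \<in> ival a R" "0 < r" for r
    using g_pos_below[OF lt[OF that(1)]] that by simp
  have dec: "u t < u s" if "a \<le> s" "s < t" "ereal t < R" for s t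
  proof (rule strict_decreasing_on_ival[OF u that(1-3)])
    fix r assume r: "s < r" "r < t"
    have "t \<in> ival a R" using that by (simp add: ival_iff)
    then have "r \<in> ival a R" by (rule ival_downward) (use r that in auto)
    then show "- r * g (u r) < 0" using w r that a by simp
  qed
  have pr: "profile g (ival a R) u (\<lambda>r. - r * g (u r)) (\<lambda>r. - g (u r) + r\<^sup>2 * (g (u r) * deriv g (u r))) {}"
  proof (rule profile_first_order[OF g_deriv deriv_g_cont u])
    fix r assume r: "r \<in> ival a R"
    show "g (u r) * deriv g (u r) \<le> 0"
      using deriv_g_nonpos[of "u r"] g_pos_below[OF lt[OF r]] lt[OF r] \<beta>_less \<beta>_pos by (simp add: mult_nonneg_nonpos)
  qed (use a in \<open>auto simp: ival_iff\<close>)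
  have bot: "filterlim u at_bot (to_R R)"
  proof (cases "R = \<infinity>")
    case True
    note u = u[unfolded \<open>R = \<infinity>\<close> ival_infinity]
    have "filterlim u at_bot at_top"
    proof (rule at_most_linear_decay[OF u])
      show "0 < g p" using p by (rule g_pos_below)
      fix r assume r: "max a 1 < r"
      have up: "u r < p" using dec[of a r] ua r True by simp
      \<comment> \<open>As \<open>g\<close> is nonincreasing below -\<alpha>, its value at the start
        is a positive lower bound along the decreasing solution.\<close>
      have "g p \<le> g (u r)"
      proof (rule DERIV_nonpos_imp_nonincreasing[of "u r" p g])
        fix x assume "u r \<le> x" "x \<le> p"
        then show "\<exists>y. (g has_real_derivative y) (at x) \<and> y \<le> 0"
          using g_deriv deriv_g_nonpos[of x] p \<beta>_less \<beta>_pos by (intro exI[of _ "deriv g x"]) auto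
      qed (use up in simp)
      also have "\<dots> \<le> r * g (u r)" using r \<open>0 < g p\<close> calculation mult_right_mono[of 1 r "g (u r)"] by simp
      finally show "- r * g (u r) \<le> - g p" by simp
    qed auto
    then show ?thesis using True by (simp add: to_R_def)
  next
    case False
    have "filterlim (\<lambda>r. - u r) at_top (to_R R)"
    proof (rule filterlim_at_top_mono[OF blow[OF False]])
      show "eventually (\<lambda>r. \<bar>u r\<bar> \<le> - u r) (to_R R)"
      proof (rule eventually_mono[OF eventually_to_R[OF R]])
        fix r assume "a < r \<and> ereal r < R"
        then show "\<bar>u r\<bar> \<le> - u r" using lt[of r] \<beta>_pos \<beta>_less by (simp add: ival_iff)
      qed
    qed
    then show ?thesis by (simp add: filterlim_uminus_at_bot)
  qed
  show thesis
  proof (rule that[OF R pr])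
    assume "R \<noteq> \<infinity>"
    from blow[OF this] show "filterlim (\<lambda>r. \<bar>u r\<bar> + \<bar>- r * g (u r)\<bar>) at_top (to_R R)"
      by (rule filterlim_at_top_mono) (auto intro!: always_eventually)
  qed (use ua w bot in auto)
qed

lemma inverse_g_integral_deriv:
  assumes "\<beta> \<le> y" "y \<le> x" "x < \<alpha>"
  shows "((\<lambda>y. integral {\<beta>..y} (\<lambda>s. 1 / g s)) has_real_derivative 1 / g y) (at y within {\<beta>..x})"
proof (rule integral_has_real_derivative)
  have "g s \<noteq> 0" if "s \<in> {\<beta>..x}" for s using g_pos[of s] that assms \<beta>_pos by force
  then show "continuous_on {\<beta>..x} (\<lambda>s. 1 / g s)" by (auto intro!: continuous_intros g_cont)
qed (use assms in auto)

text \<open>Separation of variables: the integral of 1 / g from \<beta> to u(r), plus r^2 / 2, is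
  constant. The phase is followed to \<beta> only, because g g' > 0 on (0, \<beta>).\<close>

lemma first_order_to_\<beta>:
  assumes \<xi>: "\<beta> < \<xi>" "\<xi> < \<alpha>"
  obtains a u w z where "0 < a" "profile g {0..a} u w z {}" "u 0 = \<xi>" "w 0 = 0" "u a = \<beta>" "w a = - a * g \<beta>"
    "\<And>r. 0 < r \<Longrightarrow> r \<le> a \<Longrightarrow> w r < 0" "a\<^sup>2 / 2 = integral {\<beta>..\<xi>} (\<lambda>s. 1 / g s)"
proof -
  obtain R u where R: "ereal 0 < R" and u0: "u 0 = \<xi>"
    and u: "\<And>r. r \<in> ival 0 R \<Longrightarrow> (u has_real_derivative - r * g (u r)) (at r within ival 0 R)"
    and blow: "R \<noteq> \<infinity> \<Longrightarrow> filterlim (\<lambda>r. \<bar>u r\<bar>) at_top (to_R R)"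
    using first_order_solution[of g 0 \<xi>] g_lipschitz by blast
  have uc: "continuous_on (ival 0 R) u" by (rule DERIV_continuous_on[OF u])
  have lt: "u r < \<alpha>" if "r \<in> ival 0 R" for r
    by (rule stays_between(1)[OF uc _ that]) (use first_order_avoids_equilibrium[OF u _ g_\<alpha>] u0 \<xi> in auto)
  have gt: "0 < u r" if "r \<in> ival 0 R" for r
    by (rule stays_between(2)[OF uc _ that]) (use first_order_avoids_equilibrium[OF u _ g_0] u0 \<xi> \<beta>_pos in auto)
  have "R = \<infinity>"
    by (rule no_blow_up_if_bounded[OF R _ blow, of \<alpha>]) (use lt gt in \<open>force simp: abs_if\<close>)
  note u = u[unfolded \<open>R = \<infinity>\<close> ival_infinity] and lt = lt[unfolded \<open>R = \<infinity>\<close> ival_infinity]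
    and gt = gt[unfolded \<open>R = \<infinity>\<close> ival_infinity]
  have w: "- r * g (u r) < 0" if "0 < r" for r
    using g_pos[of "u r"] gt[of r] lt[of r] that by simp
  have dec: "u t < u s" if "0 \<le> s" "s < t" for s t
    by (rule strict_decreasing_on_ival[of 0 \<infinity>, unfolded ival_infinity, OF u]) (use that w in auto)
  have le: "u r \<le> \<xi>" if "0 \<le> r" for r using dec[of 0 r] u0 that by (cases "0 = r") auto
  have "\<exists>r\<ge>0. u r \<le> \<beta>"
  proof (rule ccontr)
    assume "\<not> ?thesis"
    then have ge: "\<beta> \<le> u r" if "0 \<le> r" for r using that by force
    \<comment> \<open>By oddness, a negative upper bound on the reflected interval is a positive
      lower bound for \<open>g\<close> on [\<beta>, \<xi>].\<close>
    obtain d where d: "0 < d" "\<And>s. s \<in> {- \<xi>..- \<beta>} \<Longrightarrow> g s \<le> - d"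
      using max_neg_on_compact[of "- \<xi>" "- \<beta>"] g_neg \<xi> \<beta>_pos by auto
    have "filterlim u at_bot at_top"
    proof (rule at_most_linear_decay[OF u])
      fix r :: real assume r: "1 < r"
      have "d \<le> g (u r)" using d(2)[of "- u r"] odd[of "u r"] le[of r] ge[of r] r by simp
      also have "\<dots> \<le> r * g (u r)" using r \<open>0 < d\<close> calculation mult_right_mono[of 1 r "g (u r)"] by simp
      finally show "- r * g (u r) \<le> - d" by simp
    qed (use d in auto)
    then show False by (rule not_filterlim_at_bot_if_bounded[of _ 0 0]) (use gt in \<open>auto intro: less_imp_le\<close>)
  qed
  then obtain r where r: "0 \<le> r" "u r \<le> \<beta>" by blast
  have uc: "continuous_on {0..r} u" by (rule continuous_on_subset[OF DERIV_continuous_on[OF u]]) auto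
  obtain a where a: "0 \<le> a" "a \<le> r" "u a = \<beta>"
    using IVT2'[of u r \<beta> 0] r u0 \<xi> uc by auto
  have a0: "0 < a" using a u0 \<xi> by (cases "a = 0") auto
  have ge: "\<beta> \<le> u s" if "0 \<le> s" "s \<le> a" for s using dec[of s a] a that by (cases "s = a") auto
  have ua: "(u has_real_derivative - s * g (u s)) (at s within {0..a})" if "s \<in> {0..a}" for s
    by (rule DERIV_subset[OF u]) (use that in auto)
  define F where "F = (\<lambda>y. integral {\<beta>..y} (\<lambda>s. 1 / g s))"
  have "\<exists>c. \<forall>s\<in>{0..a}. F (u s) + s\<^sup>2 / 2 = c"
  proof (rule has_field_derivative_zero_constant)
    fix s assume s: "s \<in> {0..a}"
    have us: "\<beta> \<le> u s" "u s \<le> \<xi>" using ge le s by auto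
    have gu: "g (u s) \<noteq> 0" using g_pos[of "u s"] us \<xi> \<beta>_pos by force
    have "u ` {0..a} \<subseteq> {\<beta>..\<xi>}" using ge le by auto
    then have "(F has_real_derivative 1 / g (u s)) (at (u s) within u ` {0..a})"
      unfolding F_def by (rule DERIV_subset[OF inverse_g_integral_deriv[OF us(1,2) \<xi>(2)]])
    from DERIV_image_chain[OF this ua[OF s]]
    have "((\<lambda>s. F (u s)) has_real_derivative - s) (at s within {0..a})" using gu by (simp add: comp_def)
    then show "((\<lambda>s. F (u s) + s\<^sup>2 / 2) has_real_derivative 0) (at s within {0..a})"
      by (auto intro!: derivative_eq_intros)
  qed simp
  then obtain c where c: "\<And>s. s \<in> {0..a} \<Longrightarrow> F (u s) + s\<^sup>2 / 2 = c" by blast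
  have "a\<^sup>2 / 2 = F \<xi>" using c[of 0] c[of a] a0 u0 a(3) by (simp add: F_def)
  moreover have "profile g {0..a} u (\<lambda>r. - r * g (u r)) (\<lambda>r. - g (u r) + r\<^sup>2 * (g (u r) * deriv g (u r))) {}"
  proof (rule profile_first_order[OF g_deriv deriv_g_cont ua])
    fix s assume s: "s \<in> {0..a}"
    then have "\<beta> \<le> u s" "u s < \<alpha>" using ge lt by auto
    then show "g (u s) * deriv g (u s) \<le> 0"
      using deriv_g_nonpos[of "u s"] g_pos[of "u s"] \<beta>_pos by (simp add: mult_nonneg_nonpos)
  qed auto
  ultimately show thesis using that[of a u "\<lambda>r. - r * g (u r)"] a0 a(3) u0 w unfolding F_def by auto
qed

end

section \<open>Second-order phases\<close>

locale second_order_phase = bistable_nonlinearity +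
  fixes a :: real and R :: ereal and u w :: "real \<Rightarrow> real"
  assumes a_nonneg: "0 \<le> a" and a_less: "ereal a < R"
    and u_deriv: "\<And>r. r \<in> ival a R \<Longrightarrow> (u has_real_derivative w r) (at r within ival a R)"
    and w_deriv: "\<And>r. r \<in> ival a R \<Longrightarrow> (w has_real_derivative - g (u r)) (at r within ival a R)"
    and blow_up: "R \<noteq> \<infinity> \<Longrightarrow> filterlim (\<lambda>r. \<bar>u r\<bar> + \<bar>w r\<bar>) at_top (to_R R)"
begin

definition \<phi> :: "real \<Rightarrow> real" where
  "\<phi> r = w r + r * g (u r)"

text \<open>The terms with g(u) cancel. Whether the constraint \<phi> \<le> 0 gains or loses room is
  thus decided by the sign of g'(u) u'.\<close>

lemma \<phi>_deriv:
  assumes "r \<in> ival a R"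
  shows "(\<phi> has_real_derivative r * (deriv g (u r) * w r)) (at r within ival a R)"
  unfolding \<phi>_def using DERIV_chain2[OF g_deriv u_deriv[OF assms]] w_deriv[OF assms]
  by (auto intro!: derivative_eq_intros)

lemma u_cont: "continuous_on (ival a R) u" and w_cont: "continuous_on (ival a R) w"
  and \<phi>_cont: "continuous_on (ival a R) \<phi>"
  by (rule DERIV_continuous_on, erule u_deriv, rule DERIV_continuous_on, erule w_deriv,
      rule DERIV_continuous_on, erule \<phi>_deriv)

lemma a_in: "a \<in> ival a R"
  using a_less by (simp add: ival_iff)

lemma ival_mono: "c \<in> ival a R \<Longrightarrow> ival c R \<subseteq> ival a R"
  by (auto simp: ival_iff)

lemma energy:
  assumes "r \<in> ival a R" "s \<in> ival a R"
  shows "(w r)\<^sup>2 / 2 + G (u r) = (w s)\<^sup>2 / 2 + G (u s)"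
proof -
  have "\<exists>c. \<forall>r\<in>ival a R. (w r)\<^sup>2 / 2 + G (u r) = c"
  proof (rule has_field_derivative_zero_constant)
    show "convex (ival a R)"
      by (rule is_interval_convex) (unfold is_interval_1, meson ival_downward ival_iff order_trans)
    fix r assume r: "r \<in> ival a R"
    show "((\<lambda>r. (w r)\<^sup>2 / 2 + G (u r)) has_real_derivative 0) (at r within ival a R)"
      using DERIV_chain2[OF G_deriv u_deriv[OF r]] w_deriv[OF r]
      by (auto intro!: derivative_eq_intros)
  qed
  then show ?thesis using assms by auto
qed

text \<open>On a bounded range of values, conservation of energy bounds the speed too, so the
  blow-up alternative leaves only an infinite end.\<close>

lemma bounded_imp_global:
  assumes c: "c \<in> ival a R" and bd: "\<And>r. r \<in> ival c R \<Longrightarrow> \<bar>u r\<bar> \<le> M"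
  shows "R = \<infinity>"
proof -
  have "compact (G ` {-M..M})" by (intro compact_continuous_image G_cont) auto
  from compact_imp_bounded[OF this] obtain B where B: "\<And>s. s \<in> {-M..M} \<Longrightarrow> norm (G s) \<le> B"
    unfolding bounded_iff by blast
  have "\<bar>u r\<bar> + \<bar>w r\<bar> \<le> M + ((w c)\<^sup>2 / 2 + G (u c) + B + 1)" if r: "r \<in> ival c R" for r
  proof -
    have "(w r)\<^sup>2 / 2 + G (u r) = (w c)\<^sup>2 / 2 + G (u c)"
      by (rule energy) (use c r ival_mono in auto)
    moreover have "\<bar>G (u r)\<bar> \<le> B" using B[of "u r"] bd[OF r] by (simp add: abs_le_iff)
    moreover have "\<bar>w r\<bar> \<le> (w r)\<^sup>2 / 2 + 1"
      using zero_le_power2[of "\<bar>w r\<bar> - 1"] by (simp add: power2_diff)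
    ultimately show ?thesis using bd[OF r] by linarith
  qed
  note bound = this
  show ?thesis
    by (rule no_blow_up_if_bounded[of c, OF _ bound blow_up]) (use c in \<open>auto simp: ival_iff\<close>)
qed

text \<open>The values \<alpha> and -\<alpha> cost the potential energy G \<alpha>, which is more
  than is available.\<close>

lemma confined:
  assumes c: "c \<in> ival a R" and E: "(w c)\<^sup>2 / 2 + G (u c) < G \<alpha>" and uc: "\<bar>u c\<bar> < \<alpha>" and r: "r \<in> ival c R"
  shows "\<bar>u r\<bar> < \<alpha>"
proof -
  have cont: "continuous_on (ival c R) u" by (rule continuous_on_subset[OF u_cont ival_mono[OF c]])
  have "u s \<noteq> \<alpha> \<and> u s \<noteq> - \<alpha>" if "s \<in> ival c R" for s
  proof -
    have "G (u s) \<le> (w s)\<^sup>2 / 2 + G (u s)" by simp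
    also have "\<dots> = (w c)\<^sup>2 / 2 + G (u c)" by (rule energy) (use c ival_mono that in auto)
    finally have "G (u s) \<noteq> G \<alpha>" using E by simp
    then show ?thesis using G_even[of \<alpha>] by auto
  qed
  then show ?thesis
    using stays_between(1)[OF cont _ r, of \<alpha>] stays_between(2)[OF cont _ r, of "- \<alpha>"] uc by (auto simp: abs_less_iff)
qed

text \<open>The constraint \<open>\<phi> \<le> 0\<close> forbids the second-order phase to reach \<open>0\<close> with positive speed, so it
  ends before, and it cannot end below \<open>- \<beta>\<close>, where \<open>\<phi>\<close> decreases.\<close>

lemma landing:
  assumes c: "c \<in> ival a R" "- \<alpha> < u c" "u c < 0" "w c = 0"
    and c': "c < c'" "c' \<in> ival a R" "\<And>r. c < r \<Longrightarrow> r \<le> c' \<Longrightarrow> \<phi> r < 0"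
  obtains b where "c < b" "b \<in> ival a R" "\<phi> b = 0" "\<And>r. c < r \<Longrightarrow> r < b \<Longrightarrow> \<phi> r < 0"
    "\<And>r. c < r \<Longrightarrow> r \<le> b \<Longrightarrow> 0 < w r" "- \<beta> \<le> u b" "u b < 0"
proof -
  have ac: "a \<le> c" using c(1) by (simp add: ival_iff)
  have "G (u c) < G \<alpha>" by (rule G_less_max) (use c in auto)
  then have conf: "\<bar>u r\<bar> < \<alpha>" if "r \<in> ival c R" for r
    using confined[OF c(1) _ _ that] c by auto
  have R: "R = \<infinity>" by (rule bounded_imp_global[OF c(1)]) (use conf less_imp_le in blast)
  have w_pos: "0 < w t" if t: "c < t" "\<And>r. c < r \<Longrightarrow> r < t \<Longrightarrow> u r < 0" for t
  proof -
    have "w c < w t"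
    proof (rule strict_increasing_on_ival[OF w_deriv ac t(1)])
      fix r assume r: "c < r" "r < t"
      then show "0 < - g (u r)" using g_neg[of "u r"] conf[of r] t(2)[OF r] R by (simp add: abs_less_iff)
    qed (simp_all add: R)
    then show ?thesis using c by simp
  qed
  \<comment> \<open>On reaching 0 the solution would have \<phi> = w > 0, because g(0) = 0; this
    violates the constraint.\<close>
  have u_neg: "u r < 0" if \<phi>: "\<And>r. c < r \<Longrightarrow> r \<le> t \<Longrightarrow> \<phi> r \<le> 0" and r: "c \<le> r" "r \<le> t" for t r
    using first_zero[OF u_cont c(1,3)]
  proof
    assume "\<forall>r\<in>ival c R. u r < 0"
    then show ?thesis using r R by simp
  next
    assume "\<exists>b>c. b \<in> ival a R \<and> u b = 0 \<and> (\<forall>r\<in>{c..<b}. u r < 0)"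
    then obtain b where b: "c < b" "u b = 0" "\<And>r. r \<in> {c..<b} \<Longrightarrow> u r < 0" by blast
    have "0 < w b" by (rule w_pos) (use b in auto)
    then have "0 < \<phi> b" using b by (simp add: \<phi>_def g_0)
    then have "t < b" using \<phi>[of b] b(1) by force
    then show ?thesis using b(3) r by simp
  qed
  \<comment> \<open>The search for the contact starts at \<open>c'\<close> and not at
    \<open>c\<close>, since \<phi> c = c g(u c) vanishes when c = 0.\<close>
  show thesis
    using first_zero[OF \<phi>_cont c'(2) c'(3)[OF c'(1) order.refl]]
  proof
    assume "\<forall>r\<in>ival c' R. \<phi> r < 0"
    then have \<phi>: "\<phi> r < 0" if "c < r" for r using c'(3)[OF that] R by (cases "r \<le> c'") auto
    have un: "u r < 0" if "c \<le> r" for r by (rule u_neg[of r]) (use \<phi> that less_imp_le in auto)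
    have wp: "0 < w r" if "c < r" for r by (rule w_pos) (use un that in auto)
    have inc: "w (c + 1) < w r" if "c + 1 < r" for r
    proof (rule strict_increasing_on_ival[OF w_deriv _ that])
      fix s assume s: "c + 1 < s" "s < r"
      then show "0 < - g (u s)" using g_neg[of "u s"] conf[of s] un[of s] R by (simp add: abs_less_iff)
    qed (use ac in \<open>simp_all add: R\<close>)
    \<comment> \<open>Without a contact the solution would be convex and grow at least linearly,
      although it remains negative.\<close>
    have "filterlim u at_top at_top"
      by (rule at_least_linear_growth[where a = a and c = "c + 1" and d = "w (c + 1)" and w = w])
        (use u_deriv R ac wp[of "c + 1"] inc in \<open>auto intro: less_imp_le\<close>)
    then show thesis
      using not_filterlim_at_top_if_bounded[of u c 0] un by (auto intro: less_imp_le)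
  next
    assume "\<exists>b>c'. b \<in> ival a R \<and> \<phi> b = 0 \<and> (\<forall>r\<in>{c'..<b}. \<phi> r < 0)"
    then obtain b where b: "c' < b" "b \<in> ival a R" "\<phi> b = 0" "\<And>r. r \<in> {c'..<b} \<Longrightarrow> \<phi> r < 0" by blast
    have \<phi>: "\<phi> r < 0" if "c < r" "r < b" for r using c'(3)[OF that(1)] b(4)[of r] that by (cases "r \<le> c'") auto
    have un: "u r < 0" if "c \<le> r" "r \<le> b" for r
    proof (rule u_neg[of b])
      show "\<phi> s \<le> 0" if "c < s" "s \<le> b" for s using \<phi>[of s] b(3) that by (cases "s = b") auto
    qed (use that in auto)
    have wp: "0 < w r" if "c < r" "r \<le> b" for r by (rule w_pos) (use un that in auto)
    have "- \<beta> \<le> u b"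
    proof (rule ccontr)
      assume ub: "\<not> - \<beta> \<le> u b"
      \<comment> \<open>As long as the values are below -\<beta>, the signs g'(u) < 0 < w make
        \<phi> decrease, so it cannot climb from a negative value back to 0.\<close>
      have "\<phi> b < \<phi> c'"
      proof (rule strict_decreasing_on_ival[OF \<phi>_deriv])
        fix r assume r: "c' < r" "r < b"
        have "u r < u b"
          by (rule strict_increasing_on_ival[OF u_deriv]) (use r wp c' ac R in auto)
        then have "deriv g (u r) < 0" using deriv_g_neg[of "u r"] ub by simp
        then show "r * (deriv g (u r) * w r) < 0"
          using wp[of r] r c' ac a_nonneg by (simp add: mult_pos_neg mult_neg_pos)
      qed (use c' ac b R in auto)
      then show False using c'(3)[of c'] c'(1) b(3) by simp
    qed
    then show thesis using that[of b] b c' \<phi> wp un[of b] by auto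
  qed
qed

text \<open>On (0, \<beta>) both \<open>g\<close> and its derivative are positive: the first makes
  \<open>u\<close> concave and thus brings it down to 0 with nonzero speed, the second makes \<phi>
  decrease from its initial value 0. A start at rest at the origin is included as a = 0.\<close>

lemma descent_to_zero:
  assumes p: "0 < u a" "u a \<le> \<beta>" and wa: "w a = - a * g (u a)"
  obtains c where "a < c" "c \<in> ival a R" "u c = 0" "\<And>r. a < r \<Longrightarrow> r \<le> c \<Longrightarrow> w r < 0"
    "\<And>r. a < r \<Longrightarrow> r \<le> c \<Longrightarrow> \<phi> r < 0"
proof -
  have wa0: "w a \<le> 0" using wa a_nonneg g_pos[OF p(1)] p \<beta>_less by simp
  \<comment> \<open>Negative exactly while 0 < u < \<alpha>, so its first zero is the first exit
    from this interval. Monotonicity of \<open>u\<close> then excludes an exit through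
    \<alpha>.\<close>
  define h where "h = (\<lambda>r. max (- u r) (u r - \<alpha>))"
  have hc: "continuous_on (ival a R) h" unfolding h_def by (intro continuous_intros u_cont)
  have ha: "h a < 0" unfolding h_def using p \<beta>_less by simp
  have w_less: "w t < w s" if "a \<le> s" "s < t" "t \<in> ival a R" "\<And>r. s < r \<Longrightarrow> r < t \<Longrightarrow> h r < 0" for s t
    by (rule strict_decreasing_on_ival[OF w_deriv that(1,2)]) (use that g_pos in \<open>auto simp: ival_iff h_def\<close>)
  show thesis
    using first_zero[OF hc a_in ha]
  proof
    assume neg: "\<forall>r\<in>ival a R. h r < 0"
    then have bd: "0 < u r \<and> u r < \<alpha>" if "r \<in> ival a R" for r using that unfolding h_def by auto
    have R: "R = \<infinity>" by (rule bounded_imp_global[OF a_in, of \<alpha>]) (use bd in force)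
    have "w (a + 1) < w a" by (rule w_less) (use neg R in auto)
    moreover have "w r < w (a + 1)" if "a + 1 < r" for r by (rule w_less) (use neg R that in auto)
    ultimately have "filterlim u at_bot at_top"
      using u_deriv R wa0
      by (intro at_most_linear_decay[where a = a and c = "a + 1" and d = "- w (a + 1)" and w = w])
        (auto intro: less_imp_le)
    then show thesis using not_filterlim_at_bot_if_bounded[of u a 0] bd R by (auto intro: less_imp_le)
  next
    assume "\<exists>b>a. b \<in> ival a R \<and> h b = 0 \<and> (\<forall>r\<in>{a..<b}. h r < 0)"
    then obtain b where b: "a < b" "b \<in> ival a R" "h b = 0" "\<And>r. r \<in> {a..<b} \<Longrightarrow> h r < 0" by blast
    have in_ival: "r \<in> ival a R" if "a \<le> r" "r \<le> b" for r by (rule ival_downward[OF b(2) that])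
    have wn: "w r < 0" if "a < r" "r \<le> b" for r
      using w_less[of a r] wa0 that b(4) in_ival by (meson atLeastLessThan_iff less_imp_le less_le_trans order.refl)
    have u_less: "u r < u a" if "a < r" "r \<le> b" for r
      by (rule strict_decreasing_on_ival[OF u_deriv]) (use wn that in_ival[of r] in \<open>auto simp: ival_iff\<close>)
    have "u b = 0" using b(3) u_less[of b] b(1) p \<beta>_less unfolding h_def by (auto simp: max_def split: if_splits)
    moreover have "\<phi> r < 0" if "a < r" "r \<le> b" for r
    proof -
      have "\<phi> r < \<phi> a"
      proof (rule strict_decreasing_on_ival[OF \<phi>_deriv])
        fix s assume s: "a < s" "s < r"
        have "0 < u s" using b(4)[of s] s that unfolding h_def by simp
        moreover have "u s < \<beta>" using u_less[of s] s that p by simp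
        ultimately have "0 < deriv g (u s)" by (intro deriv_g_pos) simp
        then show "s * (deriv g (u s) * w s) < 0"
          using wn[of s] s that a_nonneg by (simp add: mult_pos_neg)
      qed (use that in_ival[of r] in \<open>auto simp: ival_iff\<close>)
      also have "\<phi> a = 0" unfolding \<phi>_def using wa by simp
      finally show ?thesis .
    qed
    ultimately show thesis using that[of b] b wn by blast
  qed
qed

text \<open>The low energy keeps \<open>u\<close> in a compact part of (-\<alpha>, \<alpha>), so
  once \<open>u\<close> is below zero the restoring term - g(u) has a positive lower bound and the
  speed returns to 0. Meanwhile \<phi> is negative because w \<le> 0 and g(u) < 0.\<close>

lemma turning:
  assumes c: "c \<in> ival a R" "u c = 0" "w c < 0" and E: "(w c)\<^sup>2 / 2 < G \<alpha>"
  obtains d where "c < d" "d \<in> ival a R" "w d = 0" "\<And>r. c \<le> r \<Longrightarrow> r < d \<Longrightarrow> w r < 0"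
    "- \<alpha> < u d" "u d < 0" "\<And>r. c < r \<Longrightarrow> r \<le> d \<Longrightarrow> \<phi> r < 0"
proof -
  have ac: "a \<le> c" using c(1) by (simp add: ival_iff)
  have \<alpha>: "0 < \<alpha>" using \<beta>_pos \<beta>_less by simp
  \<comment> \<open>An intermediate level, here the midpoint, between the energy and G \<alpha>: it
    bounds |u| by some y < \<alpha> uniformly, which a bound by \<alpha> alone would not do.\<close>
  obtain y where y: "0 \<le> y" "y \<le> \<alpha>" "G y = ((w c)\<^sup>2 / 2 + G \<alpha>) / 2"
  proof -
    have "0 \<le> (w c)\<^sup>2" by simp
    then have "0 \<le> (w c)\<^sup>2 / 2 + G \<alpha>" using E by linarith
    then have "G 0 \<le> ((w c)\<^sup>2 / 2 + G \<alpha>) / 2" "((w c)\<^sup>2 / 2 + G \<alpha>) / 2 \<le> G \<alpha>" using E G_0 by simp_all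
    then show thesis using IVT'[of G 0 "((w c)\<^sup>2 / 2 + G \<alpha>) / 2" \<alpha>] \<alpha> G_cont that by auto
  qed
  have y\<alpha>: "y < \<alpha>" using y E by (cases "y = \<alpha>") auto
  have conf: "\<bar>u r\<bar> < y" if r: "r \<in> ival c R" for r
  proof (rule ccontr)
    assume "\<not> \<bar>u r\<bar> < y"
    moreover have "\<bar>u r\<bar> < \<alpha>" by (rule confined[OF c(1) _ _ r]) (use c E G_0 \<alpha> in auto)
    ultimately have "G y \<le> G \<bar>u r\<bar>" using G_increasing[of y "\<bar>u r\<bar>"] y by (cases "y = \<bar>u r\<bar>") auto
    moreover have "(w r)\<^sup>2 / 2 + G (u r) = (w c)\<^sup>2 / 2 + G (u c)"
      by (rule energy) (use c r ival_mono in auto)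
    moreover have "0 \<le> (w r)\<^sup>2" by simp
    ultimately show False using y E c G_0 G_abs[of "u r"] by simp
  qed
  have R: "R = \<infinity>" by (rule bounded_imp_global[OF c(1)]) (use conf less_imp_le in blast)
  have u_less: "u t < u s" if "c \<le> s" "s < t" "\<And>r. s < r \<Longrightarrow> r < t \<Longrightarrow> w r < 0" for s t
    by (rule strict_decreasing_on_ival[OF u_deriv]) (use that ac R in auto)
  show thesis
    using first_zero[OF w_cont c(1,3)]
  proof
    assume neg: "\<forall>r\<in>ival c R. w r < 0"
    have un: "u (c + 1) < 0" using u_less[of c "c + 1"] neg R c by simp
    have "- y \<le> u (c + 1)" using conf[of "c + 1"] R by simp
    then obtain e where e: "0 < e" "\<And>s. s \<in> {- y..u (c + 1)} \<Longrightarrow> g s \<le> - e"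
      by (rule max_neg_on_compact) (use g_neg un y\<alpha> in auto)
    have "filterlim w at_top at_top"
    proof (rule at_least_linear_growth[where a = a and c = "c + 1" and d = e])
      fix r assume r: "c + 1 < r"
      then have "u r < u (c + 1)" by (intro u_less) (use neg R in auto)
      moreover have "- y < u r" using conf[of r] r R by (simp add: abs_less_iff)
      ultimately show "e \<le> - g (u r)" using e(2)[of "u r"] by simp
    qed (use w_deriv R ac e in auto)
    then show thesis using not_filterlim_at_top_if_bounded[of w c 0] neg R by (auto intro: less_imp_le)
  next
    assume "\<exists>b>c. b \<in> ival a R \<and> w b = 0 \<and> (\<forall>r\<in>{c..<b}. w r < 0)"
    then obtain d where d: "c < d" "d \<in> ival a R" "w d = 0" "\<And>r. r \<in> {c..<d} \<Longrightarrow> w r < 0" by blast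
    have un: "u r < 0" if "c < r" "r \<le> d" for r using u_less[of c r] d that c by simp
    have um: "- \<alpha> < u r" if "c < r" for r using conf[of r] that R y\<alpha> by (simp add: abs_less_iff)
    have "\<phi> r < 0" if r: "c < r" "r \<le> d" for r
    proof -
      have "w r \<le> 0" using d(3) d(4)[of r] r by (cases "r = d") auto
      moreover have "r * g (u r) < 0"
        using g_neg[OF um un] r ac a_nonneg by (simp add: mult_pos_neg)
      ultimately show ?thesis unfolding \<phi>_def by simp
    qed
    then show thesis using that[of d] d un[of d] um[of d] by auto
  qed
qed

text \<open>The energy is that of the equilibrium (-\<alpha>, 0) in the phase plane. A zero of
  \<open>w\<close> would force |u| = \<alpha>, and -\<alpha> is not reached at a finite radius, so
  \<open>u\<close> decreases forever. Were its limit above -\<alpha>, then w' = - g(u) would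
  eventually have a positive lower bound, against w < 0.\<close>

lemma heteroclinic:
  assumes c: "c \<in> ival a R" "u c = 0" "w c < 0" and E: "(w c)\<^sup>2 / 2 = G \<alpha>"
  shows "R = \<infinity>" "\<And>r. c \<le> r \<Longrightarrow> w r < 0" "\<And>r. c < r \<Longrightarrow> \<phi> r < 0" "(u \<longlongrightarrow> - \<alpha>) at_top"
proof -
  have ac: "a \<le> c" using c(1) by (simp add: ival_iff)
  have \<alpha>: "0 < \<alpha>" using \<beta>_pos \<beta>_less by simp
  have en: "(w r)\<^sup>2 / 2 + G (u r) = G \<alpha>" if "r \<in> ival c R" for r
    using energy[OF _ c(1), of r] ival_mono[OF c(1)] that E c G_0 by auto
  have avoid: "u t \<noteq> - \<alpha>" if t: "t \<in> ival c R" for t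
  proof
    assume ut: "u t = - \<alpha>"
    then have wt: "w t = 0" using en[OF t] G_even[of \<alpha>] by simp
    have sub: "{c..t} \<subseteq> ival a R" using ival_subset[OF t] ival_mono[OF c(1)] by blast
    have "compact (u ` {c..t})" by (intro compact_continuous_image continuous_on_subset[OF u_cont sub]) auto
    from compact_imp_bounded[OF this] obtain M0 where M0: "\<And>r. r \<in> {c..t} \<Longrightarrow> norm (u r) \<le> M0"
      unfolding bounded_iff by blast
    define M where "M = max M0 \<alpha>"
    obtain K where K: "K \<ge> 0" "\<And>x y. \<bar>x\<bar> \<le> M \<Longrightarrow> \<bar>y\<bar> \<le> M \<Longrightarrow> \<bar>g x - g y\<bar> \<le> K * \<bar>x - y\<bar>"
      using g_lipschitz[of M] by blast
    \<comment> \<open>The squared distance to the equilibrium decays at most at rate 1 + K, by 2 x y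
      \<le> x^2 + y^2 applied to the two mixed products.\<close>
    have "0 < (u t + \<alpha>)\<^sup>2 + (w t)\<^sup>2"
    proof (rule positive_if_deriv_ge_linear[of c t "\<lambda>r. (u r + \<alpha>)\<^sup>2 + (w r)\<^sup>2" "\<lambda>r. 2 * (u r + \<alpha>) * w r + 2 * w r * (- g (u r))" "1 + K"])
      fix r assume r: "r \<in> {c..t}"
      have "(u has_real_derivative w r) (at r within {c..t})" "(w has_real_derivative - g (u r)) (at r within {c..t})"
        using DERIV_subset[OF u_deriv sub] DERIV_subset[OF w_deriv sub] r sub by blast+
      then show "((\<lambda>r. (u r + \<alpha>)\<^sup>2 + (w r)\<^sup>2) has_real_derivative 2 * (u r + \<alpha>) * w r + 2 * w r * (- g (u r))) (at r within {c..t})"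
        by (auto intro!: derivative_eq_intros)
      define x y where "x = \<bar>u r + \<alpha>\<bar>" and "y = \<bar>w r\<bar>"
      have xy: "0 \<le> x" "0 \<le> y" unfolding x_def y_def by auto
      have "\<bar>g (u r) - g (- \<alpha>)\<bar> \<le> K * \<bar>u r - - \<alpha>\<bar>"
        by (rule K) (use M0[OF r] \<alpha> in \<open>auto simp: M_def\<close>)
      then have gx: "\<bar>g (u r)\<bar> \<le> K * x" unfolding x_def by (simp add: g_minus_\<alpha>)
      have "\<bar>w r * g (u r)\<bar> \<le> y * (K * x)" unfolding abs_mult y_def by (intro mult_left_mono gx) auto
      then have "w r * g (u r) \<le> K * (x * y)" by (simp add: mult_ac abs_le_iff)
      moreover have "- ((u r + \<alpha>) * w r) \<le> x * y" unfolding x_def y_def abs_mult[symmetric] by simp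
      moreover have two: "2 * (x * y) \<le> x\<^sup>2 + y\<^sup>2" using zero_le_power2[of "x - y"] by (simp add: power2_diff)
      moreover have "K * (2 * (x * y)) \<le> K * (x\<^sup>2 + y\<^sup>2)" by (rule mult_left_mono[OF two K(1)])
      moreover have "x\<^sup>2 = (u r + \<alpha>)\<^sup>2" "y\<^sup>2 = (w r)\<^sup>2" unfolding x_def y_def by simp_all
      ultimately show "- (1 + K) * ((u r + \<alpha>)\<^sup>2 + (w r)\<^sup>2) \<le> 2 * (u r + \<alpha>) * w r + 2 * w r * (- g (u r))"
        by (simp add: algebra_simps)
    next
      show "0 < (u c + \<alpha>)\<^sup>2 + (w c)\<^sup>2" using c \<alpha> by (simp add: add_pos_pos)
      show "c \<le> t" using t by (simp add: ival_iff)
    qed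
    then show False using ut wt by simp
  qed
  have gt: "- \<alpha> < u r" if "r \<in> ival c R" for r
    by (rule stays_between(2)[OF continuous_on_subset[OF u_cont ival_mono[OF c(1)]] avoid that]) (use c \<alpha> in auto)
  have wn: "w r < 0" if r: "r \<in> ival c R" for r
    using first_zero[OF w_cont c(1,3)]
  proof
    assume "\<exists>b>c. b \<in> ival a R \<and> w b = 0 \<and> (\<forall>r\<in>{c..<b}. w r < 0)"
    then obtain b where b: "c < b" "b \<in> ival a R" "w b = 0" "\<And>r. r \<in> {c..<b} \<Longrightarrow> w r < 0" by blast
    have "u b < u c"
      by (rule strict_decreasing_on_ival[OF u_deriv ac b(1)]) (use b in \<open>auto simp: ival_iff\<close>)
    have bi: "b \<in> ival c R" using b by (simp add: ival_iff)
    have "G (u b) = G \<alpha>" using en[OF bi] b(3) by simp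
    then have "\<bar>u b\<bar> = \<alpha>" using G_less_max[of "u b"] by force
    then show ?thesis using gt[OF bi] \<open>u b < u c\<close> c by simp
  qed (use r in blast)
  have u_less: "u t < u s" if "c \<le> s" "s < t" "t \<in> ival c R" for s t
  proof (rule strict_decreasing_on_ival[OF u_deriv])
    show "w r < 0" if "s < r" "r < t" for r
      by (rule wn, rule ival_downward[OF \<open>t \<in> ival c R\<close>]) (use that \<open>c \<le> s\<close> in auto)
  qed (use that ac in \<open>auto simp: ival_iff\<close>)
  have un: "u r < 0" if "r \<in> ival c R" "c < r" for r using u_less[of c r] that c by simp
  show R: "R = \<infinity>"
  proof (rule bounded_imp_global[OF c(1), of \<alpha>])
    fix r assume r: "r \<in> ival c R"
    have "u r \<le> 0" using un[OF r] c r by (cases "r = c") (auto simp: ival_iff)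
    then show "\<bar>u r\<bar> \<le> \<alpha>" using gt[OF r] by simp
  qed
  show wn': "w r < 0" if "c \<le> r" for r using wn[of r] that R by simp
  show "\<phi> r < 0" if "c < r" for r
  proof -
    have "g (u r) < 0" by (rule g_neg) (use gt[of r] un[of r] that R in auto)
    then have "r * g (u r) < 0" using that ac a_nonneg by (simp add: mult_pos_neg)
    then show ?thesis unfolding \<phi>_def using wn'[of r] that by simp
  qed
  show "(u \<longlongrightarrow> - \<alpha>) at_top"
  proof (rule tendsto_at_top_if_decreasing[where c = "c + 1"])
    fix e :: real assume e: "0 < e"
    show "\<exists>r\<ge>c + 1. u r < - \<alpha> + e"
    proof (rule ccontr)
      assume "\<not> ?thesis"
      then have ge: "- \<alpha> + e \<le> u r" if "c + 1 \<le> r" for r using that by force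
      then obtain d where d: "0 < d" "\<And>s. s \<in> {- \<alpha> + e..u (c + 1)} \<Longrightarrow> g s \<le> - d"
        using max_neg_on_compact[of "- \<alpha> + e" "u (c + 1)"] g_neg un[of "c + 1"] R e by auto
      have "filterlim w at_top at_top"
      proof (rule at_least_linear_growth[where a = a and c = "c + 1" and d = d])
        fix r assume r: "c + 1 < r"
        then have "u r < u (c + 1)" using u_less[of "c + 1" r] R by simp
        then show "d \<le> - g (u r)" using d(2)[of "u r"] ge[of r] r by simp
      qed (use w_deriv R ac d in auto)
      then show False using not_filterlim_at_top_if_bounded[of w c 0] wn' by (auto intro: less_imp_le)
    qed
  qed (use u_less gt R in \<open>auto intro: less_imp_le\<close>)
qed

text \<open>No blow-up occurs before \<open>\<phi>\<close> vanishes, because \<open>(w / r)' = - \<phi> / r\<^sup>2 > 0\<close>.\<close>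

lemma escape:
  assumes c: "a < c" "c \<in> ival a R" "u c = 0" "w a < 0" and \<phi>c: "\<phi> c < 0"
    and E: "G \<alpha> < (w a)\<^sup>2 / 2 + G (u a)"
  shows "\<And>r. r \<in> ival a R \<Longrightarrow> w r < 0"
    and "R = \<infinity> \<and> (\<forall>r\<ge>c. \<phi> r < 0) \<and> filterlim u at_bot at_top \<or>
      (\<exists>b>c. b \<in> ival a R \<and> \<phi> b = 0 \<and> (\<forall>r\<in>{c..<b}. \<phi> r < 0) \<and> u b < - \<alpha>)"
proof -
  \<comment> \<open>A zero of \<open>w\<close> would turn the whole energy into potential energy,
    which is at most G \<alpha>.\<close>
  have "w r \<noteq> 0" if "r \<in> ival a R" for r
    using energy[OF that a_in] G_le_max[of "u r"] E by auto
  then show wn: "w r < 0" if "r \<in> ival a R" for r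
    using stays_between(1)[OF w_cont _ that, of 0] c by blast
  have u_less: "u t < u s" if "a \<le> s" "s < t" "t \<in> ival a R" for s t
  proof (rule strict_decreasing_on_ival[OF u_deriv])
    show "w r < 0" if "s < r" "r < t" for r
      by (rule wn, rule ival_downward[OF \<open>t \<in> ival a R\<close>]) (use that \<open>a \<le> s\<close> in auto)
  qed (use that in \<open>auto simp: ival_iff\<close>)
  have c0: "0 < c" using c a_nonneg by simp
  show "R = \<infinity> \<and> (\<forall>r\<ge>c. \<phi> r < 0) \<and> filterlim u at_bot at_top \<or>
      (\<exists>b>c. b \<in> ival a R \<and> \<phi> b = 0 \<and> (\<forall>r\<in>{c..<b}. \<phi> r < 0) \<and> u b < - \<alpha>)"
    using first_zero[OF \<phi>_cont c(2) \<phi>c]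
  proof
    assume neg: "\<forall>r\<in>ival c R. \<phi> r < 0"
    \<comment> \<open>Monotonicity of w / r gives w \<ge> - k r from \<open>c\<close> on. Over a
      finite interval this would bound \<open>u\<close>, and then the solution would be
      global.\<close>
    define k where "k = - w c / c"
    have k: "0 < k" unfolding k_def using wn[OF c(2)] c0 by (simp add: divide_neg_pos)
    have w_ge: "- k * r \<le> w r" if r: "r \<in> ival c R" for r
    proof -
      have cr: "c \<le> r" using r by (simp add: ival_iff)
      have sub: "{c..r} \<subseteq> ival a R" using ival_subset[OF r] ival_mono[OF c(2)] by blast
      have "w c / c \<le> w r / r"
      proof (rule le_if_deriv_nonneg_off_finite[OF cr, of "{}" "\<lambda>r. w r / r" "\<lambda>r. - \<phi> r / r\<^sup>2"])
        show "continuous_on {c..r} (\<lambda>r. w r / r)"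
          using c0 by (intro continuous_intros continuous_on_subset[OF w_cont sub]) auto
        fix s assume s: "c < s" "s < r"
        have si: "s \<in> ival a R" "s \<in> ival c R" using s sub ival_subset[OF r] by auto
        have "(w has_real_derivative - g (u s)) (at s)"
          using w_deriv[OF si(1)] at_within_ival_interior[of a s R] si s c by (simp add: ival_iff)
        then have "((\<lambda>r. w r / r) has_real_derivative - \<phi> s / s\<^sup>2) (at s)"
          using s c0 unfolding \<phi>_def by (auto intro!: derivative_eq_intros simp: field_simps power2_eq_square)
        then show "((\<lambda>r. w r / r) has_real_derivative - \<phi> s / s\<^sup>2) (at s) \<and> 0 \<le> - \<phi> s / s\<^sup>2"
          using neg si(2) divide_nonpos_nonneg[of "\<phi> s" "s\<^sup>2"] by (simp add: less_imp_le)
      qed simp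
      then have "- k \<le> w r / r" unfolding k_def by simp
      then show ?thesis using cr c0 by (simp add: pos_le_divide_eq)
    qed
    have R: "R = \<infinity>"
    proof (rule ccontr)
      assume "R \<noteq> \<infinity>"
      then obtain \<rho> where \<rho>: "R = ereal \<rho>" using c(2) by (cases R) (auto simp: ival_iff)
      have "\<bar>u r\<bar> \<le> k * \<rho> * (\<rho> - c)" if r: "r \<in> ival c R" for r
      proof -
        have cr: "c \<le> r" "r < \<rho>" using r \<rho> by (auto simp: ival_iff)
        have sub: "{c..r} \<subseteq> ival a R" using ival_subset[OF r] ival_mono[OF c(2)] by blast
        have "u c + k * \<rho> * c \<le> u r + k * \<rho> * r"
        proof (rule le_if_deriv_nonneg_off_finite[OF cr(1), of "{}" "\<lambda>r. u r + k * \<rho> * r" "\<lambda>r. w r + k * \<rho>"])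
          show "continuous_on {c..r} (\<lambda>r. u r + k * \<rho> * r)"
            by (intro continuous_intros continuous_on_subset[OF u_cont sub])
          fix s assume s: "c < s" "s < r"
          have si: "s \<in> ival a R" "s \<in> ival c R" using s sub ival_subset[OF r] by auto
          have "(u has_real_derivative w s) (at s)"
            using u_deriv[OF si(1)] at_within_ival_interior[of a s R] si s c by (simp add: ival_iff)
          moreover have "k * s \<le> k * \<rho>" using k s cr by (intro mult_left_mono) auto
          ultimately show "((\<lambda>r. u r + k * \<rho> * r) has_real_derivative w s + k * \<rho>) (at s) \<and> 0 \<le> w s + k * \<rho>"
            using w_ge[OF si(2)] by (auto intro!: derivative_eq_intros)
        qed simp
        moreover have "u r \<le> 0" using u_less[of c r] c cr r by (cases "r = c") (auto simp: ival_iff)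
        moreover have "k * \<rho> * (r - c) \<le> k * \<rho> * (\<rho> - c)"
          using k cr c0 by (intro mult_left_mono) auto
        ultimately show ?thesis using c by (simp add: algebra_simps)
      qed
      then show False using bounded_imp_global[OF c(2)] \<open>R \<noteq> \<infinity>\<close> by blast
    qed
    \<comment> \<open>The excess of energy over the maximum of the potential; it keeps the speed at
      least sqrt d for all radii.\<close>
    define d where "d = (w a)\<^sup>2 / 2 + G (u a) - G \<alpha>"
    have d: "0 < d" unfolding d_def using E by simp
    have "filterlim u at_bot at_top"
    proof (rule at_most_linear_decay[where a = a and c = a and d = "sqrt d" and w = w])
      fix r assume r: "a < r"
      have "(w r)\<^sup>2 / 2 + G (u r) = (w a)\<^sup>2 / 2 + G (u a)" by (rule energy) (use r R in auto)
      then have "d \<le> (- w r)\<^sup>2" using G_le_max[of "u r"] d unfolding d_def by simp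
      then have "sqrt d \<le> \<bar>- w r\<bar>" using real_sqrt_le_mono by fastforce
      then show "w r \<le> - sqrt d" using wn[of r] r R by simp
    qed (use u_deriv R d in auto)
    then show ?thesis using R neg by simp
  next
    assume "\<exists>b>c. b \<in> ival a R \<and> \<phi> b = 0 \<and> (\<forall>r\<in>{c..<b}. \<phi> r < 0)"
    then obtain b where b: "c < b" "b \<in> ival a R" "\<phi> b = 0" "\<forall>r\<in>{c..<b}. \<phi> r < 0" by blast
    have "u b < 0" using u_less[of c b] c b by simp
    \<comment> \<open>At the contact w = - b g(u), and w < 0 makes g(u b) positive. For a negative
      value of \<open>u\<close> this means that it lies below -\<alpha>, where a first-order phase
      can take over.\<close>
    moreover have "0 < b * g (u b)" using b(3) wn[OF b(2)] unfolding \<phi>_def by simp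
    then have "0 < g (u b)" using b(1) c0 by (simp add: zero_less_mult_iff)
    ultimately have "u b < - \<alpha>" using g_neg[of "u b"] g_minus_\<alpha> by (cases "u b = - \<alpha>") force+
    then show ?thesis using b by blast
  qed
qed

text \<open>Above \<alpha> both \<open>g\<close> and its derivative are negative: the solution is
  convex and rises, and \<phi> decreases from 0. The second-order phase thus never ends, whereas g
  g' > 0 rules out a first-order one.\<close>

lemma upward_from_above:
  assumes a: "a = 0" and u0: "\<alpha> < u 0" and w0: "w 0 = 0"
  shows "\<And>r. r \<in> ival 0 R \<Longrightarrow> 0 < r \<Longrightarrow> 0 < w r" "\<And>r. r \<in> ival 0 R \<Longrightarrow> \<phi> r \<le> 0"
    "filterlim u at_top (to_R R)"
proof -
  note a_in = a_in[unfolded a] and u_deriv = u_deriv[unfolded a] and w_deriv = w_deriv[unfolded a]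
    and \<phi>_deriv = \<phi>_deriv[unfolded a]
  have w_pos: "0 < w t" if "0 < t" "ereal t < R" "\<And>r. 0 < r \<Longrightarrow> r < t \<Longrightarrow> \<alpha> < u r" for t
    using strict_increasing_on_ival[OF w_deriv, of 0 t] that g_neg_above w0 by simp
  have gt: "\<alpha> < u r" if r: "r \<in> ival 0 R" for r
  proof -
    have "continuous_on (ival 0 R) (\<lambda>r. \<alpha> - u r)" by (intro continuous_intros DERIV_continuous_on[OF u_deriv])
    from first_zero[OF this a_in] u0
    have "(\<forall>r\<in>ival 0 R. \<alpha> - u r < 0) \<or> (\<exists>b>0. b \<in> ival 0 R \<and> \<alpha> - u b = 0 \<and> (\<forall>r\<in>{0..<b}. \<alpha> - u r < 0))"
      by simp
    then show ?thesis
    proof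
      assume "\<exists>b>0. b \<in> ival 0 R \<and> \<alpha> - u b = 0 \<and> (\<forall>r\<in>{0..<b}. \<alpha> - u r < 0)"
      then obtain b where b: "0 < b" "ereal b < R" "u b = \<alpha>" "\<And>r. r \<in> {0..<b} \<Longrightarrow> \<alpha> - u r < 0"
        by (auto simp: ival_iff)
      have "u 0 < u b"
      proof (rule strict_increasing_on_ival[OF u_deriv order.refl b(1,2)])
        fix r assume r: "0 < r" "r < b"
        show "0 < w r" by (rule w_pos) (use r b in \<open>auto intro: less_trans[of _ "ereal b"]\<close>)
      qed
      then show ?thesis using b u0 by simp
    qed (use r in auto)
  qed
  show wp: "0 < w r" if "r \<in> ival 0 R" "0 < r" for r
    by (rule w_pos) (use gt ival_downward[OF that(1)] that in \<open>auto simp: ival_iff\<close>)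
  show "\<phi> r \<le> 0" if r: "r \<in> ival 0 R" for r
  proof (cases "r = 0")
    case False
    then have r0: "0 < r" using r by (simp add: ival_iff)
    have "\<phi> r < \<phi> 0"
    proof (rule strict_decreasing_on_ival[OF \<phi>_deriv order.refl r0])
      fix s assume s: "0 < s" "s < r"
      have si: "s \<in> ival 0 R" by (rule ival_downward[OF r]) (use s in auto)
      have "deriv g (u s) < 0" using gt[OF si] \<beta>_less \<beta>_pos by (intro deriv_g_neg) simp
      then show "s * (deriv g (u s) * w s) < 0" using wp[OF si s(1)] s by (simp add: mult_pos_neg mult_neg_pos)
    qed (use r in \<open>auto simp: ival_iff\<close>)
    then show ?thesis using w0 by (simp add: \<phi>_def)
  qed (simp add: \<phi>_def w0)
  have u_less: "u s < u t" if "0 \<le> s" "s < t" "t \<in> ival 0 R" for s t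
  proof (rule strict_increasing_on_ival[OF u_deriv])
    show "0 < w r" if "s < r" "r < t" for r
      by (rule wp, rule ival_downward[OF \<open>t \<in> ival 0 R\<close>]) (use that \<open>0 \<le> s\<close> in auto)
  qed (use that in \<open>auto simp: ival_iff\<close>)
  show "filterlim u at_top (to_R R)"
  proof (cases "R = \<infinity>")
    case True
    have "w 1 \<le> w r" if "1 < r" for r
    proof -
      have "w 1 < w r"
        by (rule strict_increasing_on_ival[OF w_deriv _ that]) (use True gt g_neg_above in auto)
      then show ?thesis by simp
    qed
    then have "filterlim u at_top at_top"
      by (intro at_least_linear_growth[where a = 0 and c = 1 and d = "w 1" and w = w])
        (use u_deriv True wp[of 1] in auto)
    then show ?thesis using True by (simp add: to_R_def)
  next
    case False
    show ?thesis
      unfolding filterlim_at_top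
    proof
      fix Z
      define M where "M = max Z \<alpha>"
      \<comment> \<open>The alternative speaks of |u| + |w|, but a bounded \<open>u\<close> would
        make the solution global; hence \<open>u\<close> itself is unbounded, and monotonicity turns
        this into a limit.\<close>
      obtain r where r: "r \<in> ival 0 R" "M < u r"
      proof (rule ccontr)
        assume "\<not> thesis"
        then have "u r \<le> M" if "r \<in> ival 0 R" for r using \<open>\<And>r. r \<in> ival 0 R \<Longrightarrow> M < u r \<Longrightarrow> thesis\<close> that by force
        then have "\<bar>u r\<bar> \<le> M" if "r \<in> ival 0 R" for r
          using gt[OF that] that \<beta>_pos \<beta>_less by simp
        then show False using bounded_imp_global[of a M] a a_in False by blast
      qed
      have "eventually (\<lambda>s. r < s \<and> ereal s < R) (to_R R)"
        by (rule eventually_to_R) (use r in \<open>simp add: ival_iff\<close>)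
      then show "eventually (\<lambda>s. Z \<le> u s) (to_R R)"
      proof (rule eventually_mono)
        fix s assume s: "r < s \<and> ereal s < R"
        then have "u r < u s" using u_less[of r s] r by (simp add: ival_iff)
        then show "Z \<le> u s" using r(2) unfolding M_def by simp
      qed
    qed
  qed
qed

end

section \<open>The threshold and the shooting cases\<close>

context bistable_nonlinearity
begin

section \<open>Existence and uniqueness of the threshold\<close>

definition inv_g_integral :: "real \<Rightarrow> real" where
  "inv_g_integral x = integral {\<beta>..x} (\<lambda>s. 1 / g s)"

lemma g_\<beta>: "0 < g \<beta>"
  using g_pos \<beta>_pos \<beta>_less by simp

lemma inv_g_integral_cont:
  assumes "x < \<alpha>"
  shows "continuous_on {\<beta>..x} inv_g_integral"
  unfolding inv_g_integral_def
  by (rule DERIV_continuous_on[OF inverse_g_integral_deriv]) (use assms in auto)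

lemma inv_g_integral_deriv:
  assumes "\<beta> < x" "x < \<alpha>"
  shows "(inv_g_integral has_real_derivative 1 / g x) (at x)"
proof -
  obtain y where y: "x < y" "y < \<alpha>" using dense assms by blast
  have "(inv_g_integral has_real_derivative 1 / g x) (at x within {\<beta>..y})"
    unfolding inv_g_integral_def by (rule inverse_g_integral_deriv) (use assms y in auto)
  then show ?thesis using at_within_Icc_at[of \<beta> x y] assms y by simp
qed

lemma inv_g_integral_strict_mono:
  assumes "\<beta> \<le> x" "x < y" "y < \<alpha>"
  shows "inv_g_integral x < inv_g_integral y"
proof (rule DERIV_pos_imp_increasing_open[OF assms(2)])
  show "continuous_on {x..y} inv_g_integral"
    by (rule continuous_on_subset[OF inv_g_integral_cont[OF assms(3)]]) (use assms in auto)
  fix s assume "x < s" "s < y"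
  then show "\<exists>d. (inv_g_integral has_real_derivative d) (at s) \<and> 0 < d"
    using inv_g_integral_deriv[of s] g_pos[of s] assms \<beta>_pos by (intro exI[of _ "1 / g s"]) auto
qed

text \<open>As \<open>g\<close> vanishes at \<alpha> and is Lipschitz, g(s) \<le> K (\<alpha> - s),
  so the integral of 1 / g diverges at least logarithmically at \<alpha>.\<close>

lemma inv_g_integral_unbounded:
  assumes C: "0 < C"
  obtains x where "\<beta> < x" "x < \<alpha>" "C \<le> inv_g_integral x"
proof -
  obtain K0 where K0: "\<And>x y. \<bar>x\<bar> \<le> \<alpha> \<Longrightarrow> \<bar>y\<bar> \<le> \<alpha> \<Longrightarrow> \<bar>g x - g y\<bar> \<le> K0 * \<bar>x - y\<bar>" "K0 \<ge> 0"
    using g_lipschitz[of \<alpha>] by blast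
  define K where "K = K0 + 1"
  have K: "0 < K" unfolding K_def using K0 by simp
  have gK: "g s \<le> K * (\<alpha> - s)" if "\<beta> \<le> s" "s \<le> \<alpha>" for s
  proof -
    have "\<bar>g s - g \<alpha>\<bar> \<le> K0 * \<bar>s - \<alpha>\<bar>" using that \<beta>_pos by (intro K0) auto
    then show ?thesis using that g_\<alpha> unfolding K_def by (simp add: abs_le_iff algebra_simps)
  qed
  \<comment> \<open>Solves ln((\<alpha> - \<beta>) / (\<alpha> - x)) = K C, the value at which the
    logarithmic lower bound equals \<open>C\<close>.\<close>
  define x where "x = \<alpha> - (\<alpha> - \<beta>) * exp (- (K * C))"
  have "(\<alpha> - \<beta>) * exp (- (K * C)) < (\<alpha> - \<beta>) * 1"
    using \<beta>_less K C by (intro mult_strict_left_mono) auto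
  moreover have "0 < (\<alpha> - \<beta>) * exp (- (K * C))" using \<beta>_less by simp
  ultimately have x: "\<beta> < x" "x < \<alpha>" unfolding x_def by auto
  have "inv_g_integral \<beta> + ln (\<alpha> - \<beta>) / K \<le> inv_g_integral x + ln (\<alpha> - x) / K"
  proof (rule le_if_deriv_nonneg_off_finite[of \<beta> x "{}" "\<lambda>s. inv_g_integral s + ln (\<alpha> - s) / K" "\<lambda>s. 1 / g s - 1 / (K * (\<alpha> - s))"])
    show "continuous_on {\<beta>..x} (\<lambda>s. inv_g_integral s + ln (\<alpha> - s) / K)"
      by (intro continuous_intros inv_g_integral_cont) (use x K in auto)
    fix s assume s: "\<beta> < s" "s < x"
    have "((\<lambda>s. inv_g_integral s + ln (\<alpha> - s) / K) has_real_derivative 1 / g s - 1 / (K * (\<alpha> - s))) (at s)"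
    proof -
      have "((\<lambda>s. ln (\<alpha> - s) / K) has_real_derivative - (1 / (K * (\<alpha> - s)))) (at s)"
        using s x K by (auto intro!: derivative_eq_intros simp: field_simps)
      from DERIV_add[OF inv_g_integral_deriv[of s] this] show ?thesis using s x by simp
    qed
    moreover have "1 / (K * (\<alpha> - s)) \<le> 1 / g s"
      using gK[of s] g_pos[of s] s x \<beta>_pos by (intro divide_left_mono) auto
    ultimately show "((\<lambda>s. inv_g_integral s + ln (\<alpha> - s) / K) has_real_derivative 1 / g s - 1 / (K * (\<alpha> - s))) (at s) \<and> 0 \<le> 1 / g s - 1 / (K * (\<alpha> - s))"
      by simp
  qed (use x in auto)
  moreover have "ln (\<alpha> - x) = ln (\<alpha> - \<beta>) - K * C" unfolding x_def using \<beta>_less by (simp add: ln_mult)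
  moreover have "inv_g_integral \<beta> = 0" unfolding inv_g_integral_def by simp
  ultimately have "C \<le> inv_g_integral x" using K by (simp add: field_simps)
  then show thesis using that x by blast
qed

lemma threshold_iff:
  "threshold \<alpha> \<beta> g x \<longleftrightarrow> \<beta> < x \<and> x < \<alpha> \<and> (g \<beta>)\<^sup>2 * inv_g_integral x = G \<alpha> - G \<beta>"
  by (simp add: threshold_def inv_g_integral_def G_diff)

text \<open>The integral of 1 / g climbs continuously and strictly from 0 at \<beta> to arbitrarily
  large values, and its prescribed value is positive because the primitive is larger at \<alpha>
  than at \<beta>.\<close>

lemma threshold_ex1: "\<exists>!x. threshold \<alpha> \<beta> g x"
proof -
  define C where "C = (G \<alpha> - G \<beta>) / (g \<beta>)\<^sup>2"
  have C: "0 < C" unfolding C_def using g_\<beta> G_less_max[of \<beta>] \<beta>_pos \<beta>_less by simp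
  have iff: "threshold \<alpha> \<beta> g x \<longleftrightarrow> \<beta> < x \<and> x < \<alpha> \<and> inv_g_integral x = C" for x
    unfolding threshold_iff C_def using g_\<beta> by (auto simp: field_simps)
  obtain y where y: "\<beta> < y" "y < \<alpha>" "C \<le> inv_g_integral y" by (rule inv_g_integral_unbounded[OF C])
  have \<beta>0: "inv_g_integral \<beta> = 0" unfolding inv_g_integral_def by simp
  obtain x where x: "\<beta> \<le> x" "x \<le> y" "inv_g_integral x = C"
    using IVT'[of inv_g_integral \<beta> C y] inv_g_integral_cont[OF y(2)] y C \<beta>0 by auto
  have "x \<noteq> \<beta>" using x(3) \<beta>0 C by auto
  then have "threshold \<alpha> \<beta> g x" unfolding iff using x y by simp
  moreover have "x' = x" if "threshold \<alpha> \<beta> g x'" for x'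
    using inv_g_integral_strict_mono[of x x'] inv_g_integral_strict_mono[of x' x] that calculation
    unfolding iff by (cases x x' rule: linorder_cases) auto
  ultimately show ?thesis by blast
qed

text \<open>u'' and the exceptional set are hidden, because gluing needs only the values of u and u'
  at the joint. The starting radius is free, so that the remainder of a solution after a joint is
  again such an object.\<close>

definition maximal_profile :: "real \<Rightarrow> ereal \<Rightarrow> (real \<Rightarrow> real) \<Rightarrow> (real \<Rightarrow> real) \<Rightarrow> bool" where
  "maximal_profile a R u w \<longleftrightarrow> ereal a < R \<and>
    (\<exists>z E. profile g (ival a R) u w z E \<and> E \<subseteq> ival a R - {a}) \<and>
    (R \<noteq> \<infinity> \<longrightarrow> filterlim (\<lambda>r. \<bar>u r\<bar> + \<bar>w r\<bar>) at_top (to_R R))"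

lemma filterlim_If_to_R:
  assumes "ereal c < R"
  shows "filterlim (\<lambda>r. f r (if r \<le> c then u1 r else u2 r) (if r \<le> c then w1 r else w2 r)) F (to_R R) \<longleftrightarrow>
    filterlim (\<lambda>r. f r (u2 r) (w2 r)) F (to_R R)"
  by (rule filterlim_cong[OF refl refl], rule eventually_mono[OF eventually_to_R[OF assms]]) auto

lemma maximal_profile_glue:
  assumes p1: "profile g {a..c} u1 w1 z1 {}" and p2: "maximal_profile c R u2 w2"
    and ac: "a < c" and eq: "u1 c = u2 c" "w1 c = w2 c"
  shows "maximal_profile a R (\<lambda>r. if r \<le> c then u1 r else u2 r) (\<lambda>r. if r \<le> c then w1 r else w2 r)"
proof -
  obtain z E where c: "ereal c < R" and p: "profile g (ival c R) u2 w2 z E" "E \<subseteq> ival c R - {c}"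
    and blow: "R \<noteq> \<infinity> \<Longrightarrow> filterlim (\<lambda>r. \<bar>u2 r\<bar> + \<bar>w2 r\<bar>) at_top (to_R R)"
    using p2 unfolding maximal_profile_def by blast
  have "ereal a < R" using ac c by (meson ereal_less(1) less_ereal.simps(1) less_trans)
  moreover note profile_glue[OF p1 p(1) ac c p(2) eq]
  moreover have "filterlim (\<lambda>r. \<bar>if r \<le> c then u1 r else u2 r\<bar> + \<bar>if r \<le> c then w1 r else w2 r\<bar>) at_top (to_R R)"
    if "R \<noteq> \<infinity>"
    using blow[OF that] filterlim_If_to_R[OF c, of "\<lambda>r x y. \<bar>x\<bar> + \<bar>y\<bar>" u1 u2 w1 w2 at_top] by simp
  ultimately show ?thesis unfolding maximal_profile_def by blast
qed

lemma second_order_phase_exists: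
  assumes "0 \<le> a"
  obtains R u w where "second_order_phase \<alpha> \<beta> g a R u w" "u a = p" "w a = q"
proof -
  obtain R u w where sol: "ereal a < R" "u a = p" "w a = q"
    "\<And>r. r \<in> ival a R \<Longrightarrow> (u has_real_derivative w r) (at r within ival a R)"
    "\<And>r. r \<in> ival a R \<Longrightarrow> (w has_real_derivative - g (u r)) (at r within ival a R)"
    "R \<noteq> \<infinity> \<Longrightarrow> filterlim (\<lambda>r. \<bar>u r\<bar> + \<bar>w r\<bar>) at_top (to_R R)"
    using second_order_solution[of g a p q] g_lipschitz by blast
  have "second_order_phase \<alpha> \<beta> g a R u w" by unfold_locales (rule assms sol; assumption)+
  then show thesis using that sol(2,3) by blast
qed

end

context second_order_phase
begin

lemma profile_up_to:
  assumes b: "b \<in> ival a R" and neg: "\<And>r. a \<le> r \<Longrightarrow> r \<le> b \<Longrightarrow> \<phi> r \<le> 0"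
  shows "profile g {a..b} u w (\<lambda>r. - g (u r)) {}"
proof (rule profile_second_order[OF g_cont])
  note sub = ival_subset[OF b]
  fix r assume r: "r \<in> {a..b}"
  show "(u has_real_derivative w r) (at r within {a..b})" "(w has_real_derivative - g (u r)) (at r within {a..b})"
    using DERIV_subset[OF u_deriv sub] DERIV_subset[OF w_deriv sub] r sub by blast+
  show "w r \<le> - r * g (u r)" using neg[of r] r by (simp add: \<phi>_def)
qed

lemma maximal_profile:
  assumes neg: "\<And>r. r \<in> ival a R \<Longrightarrow> \<phi> r \<le> 0"
  shows "maximal_profile a R u w"
proof -
  have "profile g (ival a R) u w (\<lambda>r. - g (u r)) {}"
    by (rule profile_second_order[OF g_cont u_deriv w_deriv]) (use neg in \<open>force simp: \<phi>_def\<close>)+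
  then show ?thesis unfolding maximal_profile_def using a_less blow_up by blast
qed

text \<open>The second-order phase is left at its next contact. There \<phi> = 0 says that u' has
  exactly the initial value required by the first-order phase, and \<open>landing\<close> places the
  value in [-\<beta>, 0), where that phase tends to 0.\<close>

lemma continue_to_zero:
  assumes c: "c \<in> ival a R" "- \<alpha> < u c" "u c < 0" "w c = 0"
    and c': "c < c'" "c' \<in> ival a R" "\<And>r. c < r \<Longrightarrow> r \<le> c' \<Longrightarrow> \<phi> r < 0"
    and before: "\<And>r. a \<le> r \<Longrightarrow> r \<le> c \<Longrightarrow> \<phi> r \<le> 0"
  obtains v y where "maximal_profile a \<infinity> v y" "\<And>r. r \<le> c \<Longrightarrow> v r = u r" "\<And>r. r \<le> c \<Longrightarrow> y r = w r"
    "\<And>r. c < r \<Longrightarrow> 0 < y r" "(v \<longlongrightarrow> 0) at_top"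
proof -
  obtain b where b: "c < b" "b \<in> ival a R" "\<phi> b = 0" "\<And>r. c < r \<Longrightarrow> r < b \<Longrightarrow> \<phi> r < 0"
    "\<And>r. c < r \<Longrightarrow> r \<le> b \<Longrightarrow> 0 < w r" "- \<beta> \<le> u b" "u b < 0"
    using landing[OF c c'] by blast
  have ab: "a < b" "0 < b" using b(1) c(1) a_nonneg by (auto simp: ival_iff)
  have p1: "profile g {a..b} u w (\<lambda>r. - g (u r)) {}"
  proof (rule profile_up_to[OF b(2)])
    fix r assume "a \<le> r" "r \<le> b"
    then show "\<phi> r \<le> 0" using before[of r] b(3) b(4)[of r] by (cases "r \<le> c"; cases "r = b") auto
  qed
  obtain u2 w2 z2 where 2: "profile g {b..} u2 w2 z2 {}" "u2 b = u b" "w2 b = - b * g (u b)"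
    "\<And>r. b \<le> r \<Longrightarrow> 0 < r \<Longrightarrow> 0 < w2 r" "(u2 \<longlongrightarrow> 0) at_top"
    using first_order_to_zero[of b "u b"] ab b(6,7) by auto
  have "maximal_profile b \<infinity> u2 w2" unfolding maximal_profile_def using 2(1) by auto
  from maximal_profile_glue[OF p1 this ab(1)] have
    m: "maximal_profile a \<infinity> (\<lambda>r. if r \<le> b then u r else u2 r) (\<lambda>r. if r \<le> b then w r else w2 r)"
    using 2 b(3) by (simp add: \<phi>_def)
  have lim: "((\<lambda>r. if r \<le> b then u r else u2 r) \<longlongrightarrow> 0) at_top"
    using filterlim_If_to_R[of b \<infinity> "\<lambda>r x y. x" u u2 u u2 "nhds 0"] 2(5) by (simp add: to_R_def)
  show thesis by (rule that[OF m _ _ _ lim]) (use b ab 2(4) in auto)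
qed

end

section \<open>Solutions from the various starting data\<close>

context bistable_nonlinearity
begin

text \<open>Descent through 0, turning above -\<alpha>, landing in [-\<beta>, 0), then convergence
  to 0. The initial radius and value are kept general: a = 0 serves starting values in (0, \<beta>],
  while p = \<beta> serves those above \<beta> after their first phase.\<close>

lemma maximal_profile_undershooting:
  assumes a: "0 \<le> a" and p: "0 < p" "p \<le> \<beta>" and E: "(a * g p)\<^sup>2 / 2 + G p < G \<alpha>"
  obtains u w b where "maximal_profile a \<infinity> u w" "u a = p" "w a = - a * g p" "a < b"
    "\<And>r. a < r \<Longrightarrow> r < b \<Longrightarrow> w r < 0" "u b < 0" "\<And>r. b < r \<Longrightarrow> 0 < w r" "(u \<longlongrightarrow> 0) at_top"
proof -
  obtain R u w where phase: "second_order_phase \<alpha> \<beta> g a R u w" and ini: "u a = p" "w a = - a * g p"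
    using second_order_phase_exists[OF a] by blast
  interpret second_order_phase \<alpha> \<beta> g a R u w by (rule phase)
  obtain c where c: "a < c" "c \<in> ival a R" "u c = 0" "\<And>r. a < r \<Longrightarrow> r \<le> c \<Longrightarrow> w r < 0"
    "\<And>r. a < r \<Longrightarrow> r \<le> c \<Longrightarrow> \<phi> r < 0"
    using descent_to_zero p ini by metis
  have "(w c)\<^sup>2 / 2 < G \<alpha>"
    using energy[OF c(2) a_in] E ini c(3) G_0 by (simp add: power_mult_distrib)
  then obtain d where d: "c < d" "d \<in> ival a R" "w d = 0" "\<And>r. c \<le> r \<Longrightarrow> r < d \<Longrightarrow> w r < 0"
    "- \<alpha> < u d" "u d < 0" "\<And>r. c < r \<Longrightarrow> r \<le> d \<Longrightarrow> \<phi> r < 0"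
    using turning[OF c(2,3) c(4)[OF c(1) order.refl]] by blast
  have "\<phi> d < 0" using d by simp
  \<comment> \<open>The landing argument needs the strict constraint on some interval after the
    turning point; it is inherited by continuity from \<phi> d < 0.\<close>
  obtain c' where c': "d < c'" "c' \<in> ival a R" "\<And>r. d < r \<Longrightarrow> r \<le> c' \<Longrightarrow> \<phi> r < 0"
    using first_zero[OF \<phi>_cont d(2) \<open>\<phi> d < 0\<close>]
  proof
    assume neg: "\<forall>r\<in>ival d R. \<phi> r < 0"
    obtain s where s: "s > d" "s \<in> ival a R" using ival_exceeds[OF d(2)] .
    then have "s \<in> ival d R" by (simp add: ival_iff)
    show thesis
      by (rule that[OF s]) (rule bspec[OF neg], rule ival_downward[OF \<open>s \<in> ival d R\<close>], auto)
  next
    assume "\<exists>b>d. b \<in> ival a R \<and> \<phi> b = 0 \<and> (\<forall>r\<in>{d..<b}. \<phi> r < 0)"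
    then obtain b where b: "d < b" "b \<in> ival a R" "\<And>r. r \<in> {d..<b} \<Longrightarrow> \<phi> r < 0" by blast
    obtain s where s: "d < s" "s < b" using dense[OF b(1)] by blast
    have "s \<in> ival a R" by (rule ival_downward[OF b(2)]) (use s d(2) in \<open>auto simp: ival_iff\<close>)
    then show thesis by (rule that[OF s(1)]) (use b(3) s in auto)
  qed
  have before: "\<phi> r \<le> 0" if "a \<le> r" "r \<le> d" for r
    using c(5)[of r] d(7)[of r] that ini by (cases "r = a"; cases "r \<le> c") (auto simp: \<phi>_def)
  obtain v y where vy: "maximal_profile a \<infinity> v y" "\<And>r. r \<le> d \<Longrightarrow> v r = u r" "\<And>r. r \<le> d \<Longrightarrow> y r = w r"
    "\<And>r. d < r \<Longrightarrow> 0 < y r" "(v \<longlongrightarrow> 0) at_top"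
    using continue_to_zero[OF d(2,5,6,3) c' before] by blast
  show thesis
  proof (rule that[OF vy(1)])
    show "y r < 0" if "a < r" "r < d" for r
      using vy(3)[of r] c(4)[of r] d(4)[of r] that by (cases "r \<le> c") auto
  qed (use vy c d ini in auto)
qed

text \<open>Here g and g' are both negative, so a first-order start is excluded. Starting at rest,
  \<open>u\<close> rises, and g'(u) < 0 makes \<phi> negative at once although it vanishes at the
  origin; from there the solution lands as after a turning point, with 0 in that role.\<close>

lemma maximal_profile_from_below_\<beta>:
  assumes p: "- \<alpha> < p" "p < - \<beta>"
  obtains u w where "maximal_profile 0 \<infinity> u w" "u 0 = p" "w 0 = 0"
    "\<And>r. 0 < r \<Longrightarrow> 0 < w r" "(u \<longlongrightarrow> 0) at_top"
proof -
  obtain R u w where phase: "second_order_phase \<alpha> \<beta> g 0 R u w" and ini: "u 0 = p" "w 0 = 0"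
    using second_order_phase_exists[of 0 p 0] by blast
  interpret second_order_phase \<alpha> \<beta> g 0 R u w by (rule phase)
  have "G p < G \<alpha>" using G_less_max[of p] p \<beta>_pos by simp
  then have gt: "- \<alpha> < u r" if "r \<in> ival 0 R" for r
    using confined[OF a_in _ _ that] ini p \<beta>_pos \<beta>_less by (simp add: abs_less_iff)
  have hc: "continuous_on (ival 0 R) (\<lambda>r. u r + \<beta>)" by (intro continuous_intros u_cont)
  have h0: "u 0 + \<beta> < 0" using ini p by simp
  obtain c' where c': "0 < c'" "c' \<in> ival 0 R" "\<And>r. 0 \<le> r \<Longrightarrow> r \<le> c' \<Longrightarrow> u r < - \<beta>"
    using first_zero[OF hc a_in h0]
  proof
    assume neg: "\<forall>r\<in>ival 0 R. u r + \<beta> < 0"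
    obtain s where s: "s > 0" "s \<in> ival 0 R" using ival_exceeds[OF a_in] .
    have "u r < - \<beta>" if "0 \<le> r" "r \<le> s" for r using bspec[OF neg ival_downward[OF s(2) that]] by simp
    then show thesis by (rule that[OF s])
  next
    assume "\<exists>b>0. b \<in> ival 0 R \<and> u b + \<beta> = 0 \<and> (\<forall>r\<in>{0..<b}. u r + \<beta> < 0)"
    then obtain b where b: "0 < b" "b \<in> ival 0 R" "\<And>r. r \<in> {0..<b} \<Longrightarrow> u r + \<beta> < 0" by blast
    obtain s where s: "0 < s" "s < b" using dense[OF b(1)] by blast
    have si: "s \<in> ival 0 R" by (rule ival_downward[OF b(2)]) (use s in auto)
    have "u r < - \<beta>" if "0 \<le> r" "r \<le> s" for r using b(3)[of r] that s by simp
    then show thesis by (rule that[OF s(1) si])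
  qed
  have in_ival: "r \<in> ival 0 R" if "0 \<le> r" "r \<le> c'" for r by (rule ival_downward[OF c'(2) that])
  have wp: "0 < w r" if "0 < r" "r \<le> c'" for r
  proof -
    have "w 0 < w r"
    proof (rule strict_increasing_on_ival[OF w_deriv order.refl that(1)])
      fix s assume s: "0 < s" "s < r"
      then show "0 < - g (u s)"
        using g_neg[of "u s"] gt[OF in_ival[of s]] c'(3)[of s] that \<beta>_pos by simp
    qed (use in_ival[of r] that in \<open>auto simp: ival_iff\<close>)
    then show ?thesis using ini by simp
  qed
  have \<phi>: "\<phi> r < 0" if "0 < r" "r \<le> c'" for r
  proof -
    have "\<phi> r < \<phi> 0"
    proof (rule strict_decreasing_on_ival[OF \<phi>_deriv order.refl that(1)])
      fix s assume s: "0 < s" "s < r"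
      have "deriv g (u s) < 0" using c'(3)[of s] s that \<beta>_pos by (intro deriv_g_neg) simp
      then show "s * (deriv g (u s) * w s) < 0"
        using wp[of s] s that by (simp add: mult_pos_neg mult_neg_pos)
    qed (use in_ival[of r] that in \<open>auto simp: ival_iff\<close>)
    then show ?thesis using ini by (simp add: \<phi>_def)
  qed
  have before: "\<phi> r \<le> 0" if "0 \<le> r" "r \<le> 0" for r
    using that ini by (simp add: \<phi>_def)
  obtain v y where "maximal_profile 0 \<infinity> v y" "\<And>r. r \<le> 0 \<Longrightarrow> v r = u r" "\<And>r. r \<le> 0 \<Longrightarrow> y r = w r"
    "\<And>r. 0 < r \<Longrightarrow> 0 < y r" "(v \<longlongrightarrow> 0) at_top"
    using continue_to_zero[OF a_in _ _ ini(2) c'(1,2) \<phi> before] ini p \<beta>_pos by auto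
  then show thesis using that[of v y] ini by simp
qed

text \<open>The energy is that of the outer equilibria, so the orbit tends to (-\<alpha>, 0). After
  radius \<open>a\<close> the constraint is strict, and no further switch occurs.\<close>

lemma maximal_profile_critical:
  assumes a: "0 < a" and E: "(a * g \<beta>)\<^sup>2 / 2 + G \<beta> = G \<alpha>"
  obtains u w where "maximal_profile a \<infinity> u w" "u a = \<beta>" "w a = - a * g \<beta>"
    "\<And>r. a < r \<Longrightarrow> w r < 0" "(u \<longlongrightarrow> - \<alpha>) at_top"
proof -
  obtain R u w where phase: "second_order_phase \<alpha> \<beta> g a R u w" and ini: "u a = \<beta>" "w a = - a * g \<beta>"
    using second_order_phase_exists[of a \<beta> "- a * g \<beta>"] a by auto
  interpret second_order_phase \<alpha> \<beta> g a R u w by (rule phase)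
  obtain c where c: "a < c" "c \<in> ival a R" "u c = 0" "\<And>r. a < r \<Longrightarrow> r \<le> c \<Longrightarrow> w r < 0"
    "\<And>r. a < r \<Longrightarrow> r \<le> c \<Longrightarrow> \<phi> r < 0"
    using descent_to_zero ini \<beta>_pos by (metis order.refl)
  have "(w c)\<^sup>2 / 2 = G \<alpha>"
    using energy[OF c(2) a_in] E ini c(3) G_0 by (simp add: power_mult_distrib)
  note h = heteroclinic[OF c(2,3) c(4)[OF c(1) order.refl] this]
  have "\<phi> r \<le> 0" if "a \<le> r" for r
    using c(5)[of r] h(3)[of r] that ini by (cases "r = a"; cases "r \<le> c") (auto simp: \<phi>_def)
  then have m: "maximal_profile a \<infinity> u w" using maximal_profile h(1) by simp
  show thesis
  proof (rule that[OF m ini _ h(4)])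
    show "w r < 0" if "a < r" for r using c(4)[of r] h(2)[of r] that by (cases "r \<le> c") auto
  qed
qed

text \<open>With more energy than the maximum of the potential the solution never turns. If \<phi>
  returns to 0, this happens below -\<alpha>, and the first-order phase that takes over goes to
  minus infinity as well.\<close>

lemma maximal_profile_overshooting:
  assumes a: "0 < a" and E: "G \<alpha> < (a * g \<beta>)\<^sup>2 / 2 + G \<beta>"
  obtains R u w where "maximal_profile a R u w" "u a = \<beta>" "w a = - a * g \<beta>"
    "\<And>r. r \<in> ival a R \<Longrightarrow> w r < 0" "filterlim u at_bot (to_R R)"
proof -
  obtain R u w where phase: "second_order_phase \<alpha> \<beta> g a R u w" and ini: "u a = \<beta>" "w a = - a * g \<beta>"
    using second_order_phase_exists[of a \<beta> "- a * g \<beta>"] a by auto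
  interpret second_order_phase \<alpha> \<beta> g a R u w by (rule phase)
  obtain c where c: "a < c" "c \<in> ival a R" "u c = 0" "\<And>r. a < r \<Longrightarrow> r \<le> c \<Longrightarrow> w r < 0"
    "\<And>r. a < r \<Longrightarrow> r \<le> c \<Longrightarrow> \<phi> r < 0"
    using descent_to_zero ini \<beta>_pos by (metis order.refl)
  have wa: "w a < 0" using ini a g_\<beta> by simp
  have "G \<alpha> < (w a)\<^sup>2 / 2 + G (u a)" using E ini by (simp add: power_mult_distrib)
  note e = escape[OF c(1-3) wa c(5)[OF c(1) order.refl] this]
  have before: "\<phi> r \<le> 0" if "a \<le> r" "r \<le> c" for r
    using c(5)[of r] that ini by (cases "r = a") (auto simp: \<phi>_def)
  from e(2) show thesis
  proof
    assume esc: "R = \<infinity> \<and> (\<forall>r\<ge>c. \<phi> r < 0) \<and> filterlim u at_bot at_top"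
    have "\<phi> r \<le> 0" if "r \<in> ival a R" for r
      using before[of r] esc that by (cases "r \<le> c") (auto simp: ival_iff intro: less_imp_le)
    then have m: "maximal_profile a R u w" by (rule maximal_profile)
    show thesis by (rule that[OF m ini e(1)]) (use esc in \<open>auto simp: to_R_def\<close>)
  next
    assume "\<exists>b>c. b \<in> ival a R \<and> \<phi> b = 0 \<and> (\<forall>r\<in>{c..<b}. \<phi> r < 0) \<and> u b < - \<alpha>"
    then obtain b where b: "c < b" "b \<in> ival a R" "\<phi> b = 0" "\<And>r. r \<in> {c..<b} \<Longrightarrow> \<phi> r < 0" "u b < - \<alpha>" by blast
    have ab: "a < b" "0 \<le> b" using b(1) c(1) a by auto
    have p1: "profile g {a..b} u w (\<lambda>r. - g (u r)) {}"
    proof (rule profile_up_to[OF b(2)])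
      fix r assume "a \<le> r" "r \<le> b"
      then show "\<phi> r \<le> 0" using before[of r] b(3) b(4)[of r] by (cases "r \<le> c"; cases "r = b") auto
    qed
    obtain S u2 w2 z2 where 2: "ereal b < S" "profile g (ival b S) u2 w2 z2 {}" "u2 b = u b" "w2 b = - b * g (u b)"
      "\<And>r. r \<in> ival b S \<Longrightarrow> 0 < r \<Longrightarrow> w2 r < 0" "filterlim u2 at_bot (to_R S)"
      "S \<noteq> \<infinity> \<Longrightarrow> filterlim (\<lambda>r. \<bar>u2 r\<bar> + \<bar>w2 r\<bar>) at_top (to_R S)"
      using first_order_to_minus_infinity[OF ab(2) b(5)] by blast
    have "maximal_profile b S u2 w2" unfolding maximal_profile_def using 2 by blast
    from maximal_profile_glue[OF p1 this ab(1)] have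
      m: "maximal_profile a S (\<lambda>r. if r \<le> b then u r else u2 r) (\<lambda>r. if r \<le> b then w r else w2 r)"
      using 2 b(3) by (simp add: \<phi>_def)
    have lim: "filterlim (\<lambda>r. if r \<le> b then u r else u2 r) at_bot (to_R S)"
      using filterlim_If_to_R[OF 2(1), of "\<lambda>r x y. x" u u2 u u2 at_bot] 2(6) by simp
    show thesis
    proof (rule that[OF m _ _ _ lim])
      fix r assume r: "r \<in> ival a S"
      show "(if r \<le> b then w r else w2 r) < 0"
      proof (cases "r \<le> b")
        case True
        then have "r \<in> ival a R" using ival_downward[OF b(2)] r by (simp add: ival_iff)
        then show ?thesis using e(1) True by simp
      next
        case False
        then show ?thesis using 2(5)[of r] r ab by (simp add: ival_iff)
      qed
    qed (use ini ab in auto)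
  qed
qed

section \<open>Collecting the outcomes for all starting values\<close>

lemma maximal_profile_constant:
  assumes "g p = 0"
  shows "maximal_profile 0 \<infinity> (\<lambda>_. p) (\<lambda>_. 0)"
proof -
  have "profile g {0..} (\<lambda>_. p) (\<lambda>_. 0) (\<lambda>_. 0) {}" unfolding profile_def using assms by auto
  then show ?thesis unfolding maximal_profile_def by (auto simp: zero_ereal_def[symmetric])
qed

text \<open>The derivative is a separate argument because the \<open>w\<close> of a profile and
  \<open>deriv u\<close> are known to agree only on (0, R), and only such radii enter the conditions
  on it.\<close>

definition shooting_outcome :: "real \<Rightarrow> real \<Rightarrow> ereal \<Rightarrow> (real \<Rightarrow> real) \<Rightarrow> (real \<Rightarrow> real) \<Rightarrow> bool" where
  "shooting_outcome \<xi>s \<xi> R u w \<longleftrightarrow>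
    (\<xi> \<in> {- \<alpha>, 0, \<alpha>} \<longrightarrow> R = \<infinity> \<and> (\<forall>r\<in>upto_R R. u r = \<xi>)) \<and>
    (\<xi> < - \<alpha> \<longrightarrow> (\<forall>r. 0 < r \<and> ereal r < R \<longrightarrow> w r < 0) \<and> filterlim u at_bot (to_R R)) \<and>
    (\<xi> > \<alpha> \<longrightarrow> (\<forall>r. 0 < r \<and> ereal r < R \<longrightarrow> w r > 0) \<and> filterlim u at_top (to_R R)) \<and>
    (- \<alpha> < \<xi> \<and> \<xi> < 0 \<longrightarrow> R = \<infinity> \<and> (\<forall>r>0. w r > 0) \<and> (u \<longlongrightarrow> 0) at_top) \<and>
    (\<xi>s < \<xi> \<and> \<xi> < \<alpha> \<longrightarrow> (\<forall>r. 0 < r \<and> ereal r < R \<longrightarrow> w r < 0) \<and> filterlim u at_bot (to_R R)) \<and>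
    (\<xi> = \<xi>s \<longrightarrow> R = \<infinity> \<and> (\<forall>r>0. w r < 0) \<and> (u \<longlongrightarrow> - \<alpha>) at_top) \<and>
    (0 < \<xi> \<and> \<xi> < \<xi>s \<longrightarrow> R = \<infinity> \<and>
      (\<exists>b>0. (\<forall>r. 0 < r \<and> r < b \<longrightarrow> w r < 0) \<and> u b < 0 \<and> (\<forall>r>b. w r > 0) \<and> (u \<longlongrightarrow> 0) at_top))"

lemma shooting_outcome_cong:
  assumes "shooting_outcome \<xi>s \<xi> R u w" and d: "\<And>r. 0 < r \<Longrightarrow> ereal r < R \<Longrightarrow> y r = w r"
  shows "shooting_outcome \<xi>s \<xi> R u y"
proof -
  have "(\<exists>b>0. (\<forall>r. 0 < r \<and> r < b \<longrightarrow> w r < 0) \<and> u b < 0 \<and> (\<forall>r>b. w r > 0) \<and> (u \<longlongrightarrow> 0) at_top) \<longrightarrow>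
      (\<exists>b>0. (\<forall>r. 0 < r \<and> r < b \<longrightarrow> y r < 0) \<and> u b < 0 \<and> (\<forall>r>b. y r > 0) \<and> (u \<longlongrightarrow> 0) at_top)"
    if "R = \<infinity>"
    using d that by (intro impI, elim exE conjE, intro exI conjI) auto
  then show ?thesis using assms unfolding shooting_outcome_def by auto
qed

lemma maximal_profile_exists:
  assumes th: "threshold \<alpha> \<beta> g \<xi>s"
  shows "\<exists>R u w. maximal_profile 0 R u w \<and> u 0 = \<xi> \<and> w 0 = 0 \<and> shooting_outcome \<xi>s \<xi> R u w"
    (is "\<exists>R u w. ?Q R u w")
proof -
  have \<xi>s: "\<beta> < \<xi>s" "\<xi>s < \<alpha>" "(g \<beta>)\<^sup>2 * inv_g_integral \<xi>s = G \<alpha> - G \<beta>"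
    using th unfolding threshold_iff by auto
  have \<alpha>: "0 < \<alpha>" using \<beta>_pos \<beta>_less by simp
  \<comment> \<open>Finer than the list of outcomes: the extra division at -\<beta> and \<beta>
    separates first-order from second-order starts.\<close>
  consider "\<xi> \<in> {- \<alpha>, 0, \<alpha>}" | "\<xi> < - \<alpha>" | "\<xi> > \<alpha>" | "- \<alpha> < \<xi>" "\<xi> < - \<beta>" | "- \<beta> \<le> \<xi>" "\<xi> < 0"
    | "0 < \<xi>" "\<xi> \<le> \<beta>" | "\<beta> < \<xi>" "\<xi> < \<alpha>" using \<beta>_less by fastforce
  then show ?thesis
  proof cases
    case 1
    then have "g \<xi> = 0" using g_0 g_\<alpha> g_minus_\<alpha> by auto
    from maximal_profile_constant[OF this]
    have "?Q \<infinity> (\<lambda>_. \<xi>) (\<lambda>_. 0)"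
      unfolding shooting_outcome_def by (intro conjI) (simp_all, use 1 \<alpha> \<xi>s \<beta>_pos in auto)
    then show ?thesis by (intro exI)
  next
    case 2
    obtain R u w z where "ereal 0 < R" "profile g (ival 0 R) u w z {}" "u 0 = \<xi>" "w 0 = - 0 * g \<xi>"
      "\<And>r. r \<in> ival 0 R \<Longrightarrow> 0 < r \<Longrightarrow> w r < 0" "filterlim u at_bot (to_R R)"
      "R \<noteq> \<infinity> \<Longrightarrow> filterlim (\<lambda>r. \<bar>u r\<bar> + \<bar>w r\<bar>) at_top (to_R R)"
      using first_order_to_minus_infinity[OF order.refl 2] by blast
    moreover from this have "maximal_profile 0 R u w" unfolding maximal_profile_def by blast
    moreover have "\<not> \<xi> \<in> {- \<alpha>, 0, \<alpha>}" "\<not> \<xi> > \<alpha>" "\<not> (- \<alpha> < \<xi> \<and> \<xi> < 0)" "\<not> (\<xi>s < \<xi> \<and> \<xi> < \<alpha>)" "\<xi> \<noteq> \<xi>s" "\<not> (0 < \<xi> \<and> \<xi> < \<xi>s)"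
      using 2 \<alpha> \<xi>s \<beta>_pos by auto
    ultimately have "?Q R u w" by (simp add: ival_iff shooting_outcome_def)
    then show ?thesis by (intro exI)
  next
    case 3
    obtain R u w where phase: "second_order_phase \<alpha> \<beta> g 0 R u w" and ini: "u 0 = \<xi>" "w 0 = 0"
      using second_order_phase_exists[of 0 \<xi> 0] by blast
    interpret second_order_phase \<alpha> \<beta> g 0 R u w by (rule phase)
    note up = upward_from_above[OF refl _ ini(2)]
    have m: "maximal_profile 0 R u w" by (rule maximal_profile) (rule up(2), use 3 ini in auto)
    have "\<forall>r. 0 < r \<and> ereal r < R \<longrightarrow> 0 < w r" "filterlim u at_top (to_R R)"
      using up 3 ini(1) by (simp_all add: ival_iff)
    moreover have "\<not> \<xi> \<in> {- \<alpha>, 0, \<alpha>}" "\<not> \<xi> < - \<alpha>" "\<not> (- \<alpha> < \<xi> \<and> \<xi> < 0)" "\<not> (\<xi>s < \<xi> \<and> \<xi> < \<alpha>)" "\<xi> \<noteq> \<xi>s" "\<not> (0 < \<xi> \<and> \<xi> < \<xi>s)"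
      using 3 \<alpha> \<xi>s \<beta>_pos by auto
    ultimately have "?Q R u w" using m ini by (simp add: shooting_outcome_def)
    then show ?thesis by (intro exI)
  next
    case 4
    obtain u w where "maximal_profile 0 \<infinity> u w" "u 0 = \<xi>" "w 0 = 0"
      "\<And>r. 0 < r \<Longrightarrow> 0 < w r" "(u \<longlongrightarrow> 0) at_top"
      using maximal_profile_from_below_\<beta>[OF 4] by blast
    moreover have "\<not> \<xi> \<in> {- \<alpha>, 0, \<alpha>}" "\<not> \<xi> < - \<alpha>" "\<not> \<xi> > \<alpha>" "\<not> (\<xi>s < \<xi> \<and> \<xi> < \<alpha>)" "\<xi> \<noteq> \<xi>s" "\<not> (0 < \<xi> \<and> \<xi> < \<xi>s)"
      using 4 \<alpha> \<xi>s \<beta>_pos by auto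
    ultimately have "?Q \<infinity> u w" by (simp add: shooting_outcome_def)
    then show ?thesis by (intro exI)
  next
    case 5
    obtain u w z where "profile g {0..} u w z {}" "u 0 = \<xi>" "w 0 = - 0 * g \<xi>"
      "\<And>r. 0 \<le> r \<Longrightarrow> 0 < r \<Longrightarrow> 0 < w r" "(u \<longlongrightarrow> 0) at_top"
      using first_order_to_zero[OF order.refl 5] by blast
    moreover from this have "maximal_profile 0 \<infinity> u w" unfolding maximal_profile_def by auto
    moreover have "\<not> \<xi> \<in> {- \<alpha>, 0, \<alpha>}" "\<not> \<xi> < - \<alpha>" "\<not> \<xi> > \<alpha>" "\<not> (\<xi>s < \<xi> \<and> \<xi> < \<alpha>)" "\<xi> \<noteq> \<xi>s" "\<not> (0 < \<xi> \<and> \<xi> < \<xi>s)"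
      using 5 \<alpha> \<xi>s \<beta>_pos \<beta>_less by auto
    ultimately have "?Q \<infinity> u w" by (simp add: shooting_outcome_def)
    then show ?thesis by (intro exI)
  next
    case 6
    have "G \<xi> < G \<alpha>" using G_less_max[of \<xi>] 6 \<beta>_less by simp
    then obtain u w b where "maximal_profile 0 \<infinity> u w" "u 0 = \<xi>" "w 0 = - 0 * g \<xi>" "0 < b"
      "\<And>r. 0 < r \<Longrightarrow> r < b \<Longrightarrow> w r < 0" "u b < 0" "\<And>r. b < r \<Longrightarrow> 0 < w r" "(u \<longlongrightarrow> 0) at_top"
      using maximal_profile_undershooting[OF order.refl 6] by auto
    moreover from this have "\<exists>b>0. (\<forall>r. 0 < r \<and> r < b \<longrightarrow> w r < 0) \<and> u b < 0 \<and> (\<forall>r>b. w r > 0) \<and> (u \<longlongrightarrow> 0) at_top"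
      by blast
    moreover have "\<not> \<xi> \<in> {- \<alpha>, 0, \<alpha>}" "\<not> \<xi> < - \<alpha>" "\<not> \<xi> > \<alpha>" "\<not> (- \<alpha> < \<xi> \<and> \<xi> < 0)" "\<not> (\<xi>s < \<xi> \<and> \<xi> < \<alpha>)" "\<xi> \<noteq> \<xi>s"
      using 6 \<alpha> \<xi>s \<beta>_pos \<beta>_less by auto
    ultimately have "?Q \<infinity> u w" by (simp add: shooting_outcome_def)
    then show ?thesis by (intro exI)
  next
    case 7
    obtain a u1 w1 z1 where a: "0 < a" and 1: "profile g {0..a} u1 w1 z1 {}" "u1 0 = \<xi>" "w1 0 = 0"
      "u1 a = \<beta>" "w1 a = - a * g \<beta>" "\<And>r. 0 < r \<Longrightarrow> r \<le> a \<Longrightarrow> w1 r < 0" and a2: "a\<^sup>2 / 2 = inv_g_integral \<xi>"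
      unfolding inv_g_integral_def using first_order_to_\<beta>[OF 7] by blast
    \<comment> \<open>The origin of the threshold equation: the first phase ends with u' = - a
      g(\<beta>), so its kinetic energy is g(\<beta>)^2 times the integral of 1 / g. By strict
      monotonicity of that integral, comparing this energy with G \<alpha> - G \<beta> amounts to
      comparing \<xi> with \<open>\<xi>s\<close>.\<close>
    have E: "(a * g \<beta>)\<^sup>2 / 2 = (g \<beta>)\<^sup>2 * inv_g_integral \<xi>"
      unfolding a2[symmetric] by (simp add: power_mult_distrib)
    have g2: "0 < (g \<beta>)\<^sup>2" using g_\<beta> by simp
    consider "\<xi> < \<xi>s" | "\<xi> = \<xi>s" | "\<xi>s < \<xi>" by linarith
    then show ?thesis
    proof cases
      case lt: 1
      have "(g \<beta>)\<^sup>2 * inv_g_integral \<xi> < (g \<beta>)\<^sup>2 * inv_g_integral \<xi>s"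
        by (intro mult_strict_left_mono g2 inv_g_integral_strict_mono) (use lt 7 \<xi>s in auto)
      then have E': "(a * g \<beta>)\<^sup>2 / 2 + G \<beta> < G \<alpha>" using E \<xi>s by simp
      obtain u2 w2 b where 2: "maximal_profile a \<infinity> u2 w2" "u2 a = \<beta>" "w2 a = - a * g \<beta>" "a < b"
        "\<And>r. a < r \<Longrightarrow> r < b \<Longrightarrow> w2 r < 0" "u2 b < 0" "\<And>r. b < r \<Longrightarrow> 0 < w2 r" "(u2 \<longlongrightarrow> 0) at_top"
        using maximal_profile_undershooting[OF less_imp_le[OF a] \<beta>_pos order.refl E'] by blast
      let ?u = "\<lambda>r. if r \<le> a then u1 r else u2 r" and ?w = "\<lambda>r. if r \<le> a then w1 r else w2 r"
      have m: "maximal_profile 0 \<infinity> ?u ?w"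
        by (rule maximal_profile_glue[OF 1(1) 2(1) a]) (simp_all add: 1 2)
      have lim: "(?u \<longlongrightarrow> 0) at_top"
        using filterlim_If_to_R[of a \<infinity> "\<lambda>r x y. x" u1 u2 u1 u2 "nhds 0"] 2(8) by (simp add: to_R_def)
      have "(\<forall>r. 0 < r \<and> r < b \<longrightarrow> ?w r < 0) \<and> ?u b < 0 \<and> (\<forall>r>b. ?w r > 0)"
        using 2 1(6) by auto
      then have "\<exists>b>0. (\<forall>r. 0 < r \<and> r < b \<longrightarrow> ?w r < 0) \<and> ?u b < 0 \<and> (\<forall>r>b. ?w r > 0) \<and> (?u \<longlongrightarrow> 0) at_top"
        using lim 2(4) a by (intro exI[of _ b]) auto
      moreover have "?u 0 = \<xi>" "?w 0 = 0" using 1 a by simp_all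
      moreover have "\<not> \<xi> \<in> {- \<alpha>, 0, \<alpha>}" "\<not> \<xi> < - \<alpha>" "\<not> \<xi> > \<alpha>" "\<not> (- \<alpha> < \<xi> \<and> \<xi> < 0)" "\<not> (\<xi>s < \<xi> \<and> \<xi> < \<alpha>)" "\<xi> \<noteq> \<xi>s"
        using lt 7 \<alpha> \<beta>_pos by auto
      ultimately have "?Q \<infinity> ?u ?w" using m unfolding shooting_outcome_def by blast
      then show ?thesis by (intro exI)
    next
      case eq: 2
      then have E': "(a * g \<beta>)\<^sup>2 / 2 + G \<beta> = G \<alpha>" unfolding E using \<xi>s(3) by simp
      obtain u2 w2 where 2: "maximal_profile a \<infinity> u2 w2" "u2 a = \<beta>" "w2 a = - a * g \<beta>"
        "\<And>r. a < r \<Longrightarrow> w2 r < 0" "(u2 \<longlongrightarrow> - \<alpha>) at_top"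
        using maximal_profile_critical[OF a E'] by blast
      let ?u = "\<lambda>r. if r \<le> a then u1 r else u2 r" and ?w = "\<lambda>r. if r \<le> a then w1 r else w2 r"
      have m: "maximal_profile 0 \<infinity> ?u ?w"
        by (rule maximal_profile_glue[OF 1(1) 2(1) a]) (simp_all add: 1 2)
      have lim: "(?u \<longlongrightarrow> - \<alpha>) at_top"
        using filterlim_If_to_R[of a \<infinity> "\<lambda>r x y. x" u1 u2 u1 u2 "nhds (- \<alpha>)"] 2(5) by (simp add: to_R_def)
      have "\<forall>r>0. ?w r < 0" using 2(4) 1(6) by simp
      moreover have "?u 0 = \<xi>" "?w 0 = 0" using 1 a by simp_all
      moreover have "\<not> \<xi> \<in> {- \<alpha>, 0, \<alpha>}" "\<not> \<xi> < - \<alpha>" "\<not> \<xi> > \<alpha>" "\<not> (- \<alpha> < \<xi> \<and> \<xi> < 0)" "\<not> (\<xi>s < \<xi> \<and> \<xi> < \<alpha>)" "\<not> (0 < \<xi> \<and> \<xi> < \<xi>s)"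
        using eq 7 \<alpha> \<beta>_pos by auto
      ultimately have "?Q \<infinity> ?u ?w" using m lim unfolding shooting_outcome_def by blast
      then show ?thesis by (intro exI)
    next
      case gt: 3
      have "(g \<beta>)\<^sup>2 * inv_g_integral \<xi>s < (g \<beta>)\<^sup>2 * inv_g_integral \<xi>"
        by (intro mult_strict_left_mono g2 inv_g_integral_strict_mono) (use gt 7 \<xi>s in auto)
      then have E': "G \<alpha> < (a * g \<beta>)\<^sup>2 / 2 + G \<beta>" using E \<xi>s by simp
      obtain R u2 w2 where 2: "maximal_profile a R u2 w2" "u2 a = \<beta>" "w2 a = - a * g \<beta>"
        "\<And>r. r \<in> ival a R \<Longrightarrow> w2 r < 0" "filterlim u2 at_bot (to_R R)"
        using maximal_profile_overshooting[OF a E'] by blast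
      let ?u = "\<lambda>r. if r \<le> a then u1 r else u2 r" and ?w = "\<lambda>r. if r \<le> a then w1 r else w2 r"
      have m: "maximal_profile 0 R ?u ?w"
        by (rule maximal_profile_glue[OF 1(1) 2(1) a]) (simp_all add: 1 2)
      have aR: "ereal a < R" using 2(1) unfolding maximal_profile_def by blast
      have lim: "filterlim ?u at_bot (to_R R)"
        using filterlim_If_to_R[OF aR, of "\<lambda>r x y. x" u1 u2 u1 u2 at_bot] 2(5) by simp
      have "\<forall>r. 0 < r \<and> ereal r < R \<longrightarrow> ?w r < 0" using 2(4) 1(6) by (simp add: ival_iff)
      moreover have "?u 0 = \<xi>" "?w 0 = 0" using 1 a by simp_all
      moreover have "\<not> \<xi> \<in> {- \<alpha>, 0, \<alpha>}" "\<not> \<xi> < - \<alpha>" "\<not> \<xi> > \<alpha>" "\<not> (- \<alpha> < \<xi> \<and> \<xi> < 0)" "\<xi> \<noteq> \<xi>s" "\<not> (0 < \<xi> \<and> \<xi> < \<xi>s)"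
        using gt 7 \<alpha> \<beta>_pos by auto
      ultimately have "?Q R ?u ?w" using m lim unfolding shooting_outcome_def by blast
      then show ?thesis by (intro exI)
    qed
  qed
qed

lemma maximal_profile_radial_solution:
  assumes N: "CARD('n::finite) \<ge> 2" and m: "maximal_profile 0 R u w" and w0: "w 0 = 0"
  shows "radial_solution TYPE('n) 1 g R u"
    and "\<And>S v. radial_solution TYPE('n) 1 g S v \<Longrightarrow> v 0 = u 0 \<Longrightarrow> S = R \<and> (\<forall>r\<in>upto_R R. v r = u r)"
    and "\<And>r. 0 < r \<Longrightarrow> ereal r < R \<Longrightarrow> deriv u r = w r"
proof -
  obtain z E where R: "ereal 0 < R" and p: "profile g (ival 0 R) u w z E" "E \<subseteq> ival 0 R - {0}"
    and blow: "R \<noteq> \<infinity> \<Longrightarrow> filterlim (\<lambda>r. \<bar>u r\<bar> + \<bar>w r\<bar>) at_top (to_R R)"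
    using m unfolding maximal_profile_def by blast
  show sol: "radial_solution TYPE('n) 1 g R u"
    by (rule profile_imp_radial_solution[OF N _ p w0 blow]) (use R in \<open>simp_all add: zero_ereal_def\<close>)
  show "S = R \<and> (\<forall>r\<in>upto_R R. v r = u r)" if "radial_solution TYPE('n) 1 g S v" "v 0 = u 0" for S v
    by (rule radial_solution_unique[OF N g_lipschitz g_cont sol that(1) that(2)[symmetric]])
  have "(u has_real_derivative w r) (at r within ival 0 R)" if "r \<in> ival 0 R" for r
    using p that unfolding profile_def by blast
  from deriv_eq_on_ival[OF this] show "deriv u r = w r" if "0 < r" "ereal r < R" for r
    using that by blast
qed

end

theorem theorem2p5:
  fixes g :: "real \<Rightarrow> real" and \<alpha> \<beta> :: real
  assumes "CARD('n::finite) \<ge> 2"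
    and "bistable \<alpha> \<beta> g"
  shows "(\<exists>!\<xi>s. threshold \<alpha> \<beta> g \<xi>s) \<and>
    (\<forall>\<xi>s \<xi>. threshold \<alpha> \<beta> g \<xi>s \<longrightarrow>
      (\<exists>R u. radial_solution TYPE('n) 1 g R u \<and> u 0 = \<xi> \<and>
        (\<forall>S v. radial_solution TYPE('n) 1 g S v \<and> v 0 = \<xi> \<longrightarrow>
           S = R \<and> (\<forall>r\<in>upto_R R. v r = u r)) \<and>
        (\<xi> \<in> {- \<alpha>, 0, \<alpha>} \<longrightarrow> R = \<infinity> \<and> (\<forall>r\<in>upto_R R. u r = \<xi>)) \<and>
        (\<xi> < - \<alpha> \<longrightarrow>
           (\<forall>r. 0 < r \<and> ereal r < R \<longrightarrow> deriv u r < 0) \<and> filterlim u at_bot (to_R R)) \<and>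
        (\<xi> > \<alpha> \<longrightarrow>
           (\<forall>r. 0 < r \<and> ereal r < R \<longrightarrow> deriv u r > 0) \<and> filterlim u at_top (to_R R)) \<and>
        (- \<alpha> < \<xi> \<and> \<xi> < 0 \<longrightarrow>
           R = \<infinity> \<and> (\<forall>r>0. deriv u r > 0) \<and> (u \<longlongrightarrow> 0) at_top) \<and>
        (\<xi>s < \<xi> \<and> \<xi> < \<alpha> \<longrightarrow>
           (\<forall>r. 0 < r \<and> ereal r < R \<longrightarrow> deriv u r < 0) \<and> filterlim u at_bot (to_R R)) \<and>
        (\<xi> = \<xi>s \<longrightarrow>
           R = \<infinity> \<and> (\<forall>r>0. deriv u r < 0) \<and> (u \<longlongrightarrow> - \<alpha>) at_top) \<and>
        (0 < \<xi> \<and> \<xi> < \<xi>s \<longrightarrow>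
           R = \<infinity> \<and>
           (\<exists>b>0. (\<forall>r. 0 < r \<and> r < b \<longrightarrow> deriv u r < 0) \<and> u b < 0 \<and>
                  (\<forall>r>b. deriv u r > 0) \<and> (u \<longlongrightarrow> 0) at_top))))"
proof -
  interpret bistable_nonlinearity \<alpha> \<beta> g by unfold_locales (rule assms(2))
  show ?thesis
  proof (intro conjI threshold_ex1 allI impI, goal_cases)
    case (1 \<xi>s \<xi>)
    obtain R u w where m: "maximal_profile 0 R u w" and u0: "u 0 = \<xi>" and w0: "w 0 = 0"
      and out: "shooting_outcome \<xi>s \<xi> R u w"
      using maximal_profile_exists[OF 1] by blast
    note sol = maximal_profile_radial_solution[OF assms(1) m w0]
    have "\<forall>S v. radial_solution TYPE('n) 1 g S v \<and> v 0 = \<xi> \<longrightarrow> S = R \<and> (\<forall>r\<in>upto_R R. v r = u r)"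
      using sol(2) unfolding u0 by blast
    \<comment> \<open>On (0, R) the profile's \<open>w\<close> is the derivative of
      \<open>u\<close>, so the outcome may be restated with \<open>deriv u\<close>.\<close>
    with sol(1) u0 shooting_outcome_cong[OF out sol(3)]
    have "radial_solution TYPE('n) 1 g R u \<and> u 0 = \<xi> \<and>
        (\<forall>S v. radial_solution TYPE('n) 1 g S v \<and> v 0 = \<xi> \<longrightarrow> S = R \<and> (\<forall>r\<in>upto_R R. v r = u r)) \<and>
        shooting_outcome \<xi>s \<xi> R u (deriv u)" by blast
    then show ?case unfolding shooting_outcome_def by (intro exI)
  qed
qed

end
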